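(* Let $\Omega$ be a bounded, convex, simply-connected domain and let $f(z)=F_1(z)+|z|^2F_2(z)$ be a univalent biharmonic mapping of $\mathbb{D}$ onto $\Omega$. Let $e^{i\theta_0}\in\partial\mathbb{D}$. Suppose that $F_1=H_1+\overline{G_1}$ and $F_2=H_2+\overline{G_2}$ are two harmonic mappings in $\mathbb{D}$ (with $H_1,G_1,H_2,G_2$ analytic in $\mathbb{D}$), that $F_2(z)=o\left(\frac{1}{1-|z|}\right)$ as $|z|\to1^-$, and that $$|\phi(z)|:=\left|\frac{G_1'(z)+G_2'(z)}{H_1'(z)+H_2'(z)}\right|<1\qquad (z\in\mathbb{D}).$$ If $$\int_{\Gamma_{m,\theta_0}}\frac{1-|\phi(z)|^2}{1-|z|^2}\,|dz|=\infty\quad\text{for all } 0<m<1/\pi,$$ then the boundary function of $f$ is continuous at $e^{i\theta_0}$.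
   Context: $\mathbb{D}=\{z\in\mathbb{C}:|z|<1\}$. A harmonic mapping in $\mathbb{D}$ is a complex-valued function whose real and imaginary parts are harmonic; it can be written as $H+\overline{G}$ with $H,G$ analytic in $\mathbb{D}$. A biharmonic mapping is a complex-valued function $f$ with $\Delta^2 f=\Delta(\Delta f)=0$, where $\Delta=4\frac{\partial^2}{\partial z\,\partial\overline z}$. Univalent means injective. The boundary function $f^*$ of a univalent mapping $f$ of $\mathbb{D}$ is the unrestricted limit $f^*(e^{it})=\lim_{z\to e^{it}}f(z)$ (with $z\in\mathbb{D}$), at those points where it exists. For $e^{i\theta_0}\in\partial\mathbb{D}$ and $m>0$, $\Gamma_{m,\theta_0}$ denotes the curve contained in $\mathbb{D}$ given by $\Gamma_{m,\theta_0}(\theta)=(1-m|\theta-\theta_0|)e^{i\theta}$ for $0<|\theta-\theta_0|\le\min\{\pi,1/m\}$, and $|dz|$ denotes integration with respect to arc length. *)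

theory Defs
  imports "HOL-Complex_Analysis.Complex_Analysis" "HOL-Library.Landau_Symbols"
begin

definition partial_x :: "(complex \<Rightarrow> complex) \<Rightarrow> complex \<Rightarrow> complex" where
  "partial_x f z = vector_derivative (\<lambda>t::real. f (z + of_real t)) (at 0)"

definition partial_y :: "(complex \<Rightarrow> complex) \<Rightarrow> complex \<Rightarrow> complex" where
  "partial_y f z = vector_derivative (\<lambda>t::real. f (z + \<i> * of_real t)) (at 0)"

definition partial_z :: "(complex \<Rightarrow> complex) \<Rightarrow> complex \<Rightarrow> complex" where
  "partial_z f z = (partial_x f z - \<i> * partial_y f z) / 2"

definition partial_zbar :: "(complex \<Rightarrow> complex) \<Rightarrow> complex \<Rightarrow> complex" where
  "partial_zbar f z = (partial_x f z + \<i> * partial_y f z) / 2"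

definition laplacian :: "(complex \<Rightarrow> complex) \<Rightarrow> complex \<Rightarrow> complex" where
  "laplacian f z = 4 * partial_z (partial_zbar f) z"

(* Differentiability is over the reals. Meant for open S, where this is the usual class C^k. *)
primrec Ck_on :: "nat \<Rightarrow> complex set \<Rightarrow> (complex \<Rightarrow> complex) \<Rightarrow> bool" where
  "Ck_on 0 S f \<longleftrightarrow> continuous_on S f"
| "Ck_on (Suc k) S f \<longleftrightarrow>
     (\<forall>z\<in>S. f differentiable (at z)) \<and> Ck_on k S (partial_x f) \<and> Ck_on k S (partial_y f)"

definition harmonic_on :: "complex set \<Rightarrow> (complex \<Rightarrow> real) \<Rightarrow> bool" where
  "harmonic_on S u \<longleftrightarrow>
     Ck_on 2 S (\<lambda>z. of_real (u z)) \<and> (\<forall>z\<in>S. laplacian (\<lambda>z. of_real (u z)) z = 0)"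

definition harmonic_mapping_on :: "complex set \<Rightarrow> (complex \<Rightarrow> complex) \<Rightarrow> bool" where
  "harmonic_mapping_on S F \<longleftrightarrow>
     harmonic_on S (\<lambda>z. Re (F z)) \<and> harmonic_on S (\<lambda>z. Im (F z))"

definition biharmonic_mapping_on :: "complex set \<Rightarrow> (complex \<Rightarrow> complex) \<Rightarrow> bool" where
  "biharmonic_mapping_on S f \<longleftrightarrow>
     Ck_on 4 S f \<and> (\<forall>z\<in>S. laplacian (laplacian f) z = 0)"

(* Unrestricted limits from inside the unit disk; the boundary function is only meaningful on
   boundary_domain f, the set of points of the circle at which the limit exists. *)
definition boundary_domain :: "(complex \<Rightarrow> complex) \<Rightarrow> complex set" where
  "boundary_domain f = {\<zeta> \<in> sphere 0 1. \<exists>l. (f \<longlongrightarrow> l) (at \<zeta> within ball 0 1)}"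

definition boundary_function :: "(complex \<Rightarrow> complex) \<Rightarrow> complex \<Rightarrow> complex" where
  "boundary_function f \<zeta> = Lim (at \<zeta> within ball 0 1) f"

definition boundary_function_continuous_at :: "(complex \<Rightarrow> complex) \<Rightarrow> complex \<Rightarrow> bool" where
  "boundary_function_continuous_at f \<zeta> \<longleftrightarrow>
     \<zeta> \<in> boundary_domain f \<and>
     continuous (at \<zeta> within boundary_domain f) (boundary_function f)"

definition Gamma_curve :: "real \<Rightarrow> real \<Rightarrow> real \<Rightarrow> complex" where
  "Gamma_curve m \<theta>0 \<theta> = of_real (1 - m * \<bar>\<theta> - \<theta>0\<bar>) * cis \<theta>"

definition Gamma_params :: "real \<Rightarrow> real \<Rightarrow> real set" where
  "Gamma_params m \<theta>0 = {\<theta>. 0 < \<bar>\<theta> - \<theta>0\<bar> \<and> \<bar>\<theta> - \<theta>0\<bar> \<le> min pi (1 / m)}"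

(* For nonnegative u only, with values in [0, \<infinity>]: ennreal truncates negative values to 0. *)
definition arc_length_integral ::
    "real set \<Rightarrow> (real \<Rightarrow> complex) \<Rightarrow> (complex \<Rightarrow> real) \<Rightarrow> ennreal" where
  "arc_length_integral T \<gamma> u =
     (\<integral>\<^sup>+ t \<in> T. ennreal (u (\<gamma> t) * norm (vector_derivative \<gamma> (at t))) \<partial>lborel)"

(* The rest shows that H + cnj G is a harmonic mapping and that a function of the form
   F1 + |z|^2 F2 with F1, F2 of this shape is a biharmonic mapping in the above sense.
   sep S consists of the functions agreeing on S with finite sums of products A * cnj B,
   A and B holomorphic. *)

inductive sep :: "complex set \<Rightarrow> (complex \<Rightarrow> complex) \<Rightarrow> bool" for S where
  sep_base: "A holomorphic_on S \<Longrightarrow> B holomorphic_on S \<Longrightarrow> sep S (\<lambda>z. A z * cnj (B z))"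
| sep_add: "sep S f \<Longrightarrow> sep S g \<Longrightarrow> sep S (\<lambda>z. f z + g z)"
| sep_cong: "sep S f \<Longrightarrow> (\<And>z. z \<in> S \<Longrightarrow> g z = f z) \<Longrightarrow> sep S g"

definition has_wirtinger ::
    "complex set \<Rightarrow> (complex \<Rightarrow> complex) \<Rightarrow> (complex \<Rightarrow> complex) \<Rightarrow> (complex \<Rightarrow> complex) \<Rightarrow> bool" where
  "has_wirtinger S f a b \<longleftrightarrow>
     (\<forall>z\<in>S. (f has_derivative (\<lambda>h. a z * h + b z * cnj h)) (at z))"

lemma has_wirtinger_prod:
  assumes "open S" "A holomorphic_on S" "B holomorphic_on S"
  shows "has_wirtinger S (\<lambda>z. A z * cnj (B z))
           (\<lambda>z. deriv A z * cnj (B z)) (\<lambda>z. A z * cnj (deriv B z))"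
  unfolding has_wirtinger_def
proof
  fix z assume z: "z \<in> S"
  have "(A has_derivative (\<lambda>h. deriv A z * h)) (at z)"
    using holomorphic_derivI[OF assms(2,1) z] by (simp add: has_field_derivative_def)
  moreover have "(B has_derivative (\<lambda>h. deriv B z * h)) (at z)"
    using holomorphic_derivI[OF assms(3,1) z] by (simp add: has_field_derivative_def)
  then have "((\<lambda>z. cnj (B z)) has_derivative (\<lambda>h. cnj (deriv B z * h))) (at z)"
    by (rule bounded_linear.has_derivative[OF bounded_linear_cnj])
  ultimately have "((\<lambda>z. A z * cnj (B z)) has_derivative
      (\<lambda>h. A z * cnj (deriv B z * h) + deriv A z * h * cnj (B z))) (at z)"
    by (rule has_derivative_mult)
  then show "((\<lambda>z. A z * cnj (B z)) has_derivative
      (\<lambda>h. deriv A z * cnj (B z) * h + A z * cnj (deriv B z) * cnj h)) (at z)"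
    by (simp add: algebra_simps)
qed

lemma has_wirtinger_add:
  "has_wirtinger S f a b \<Longrightarrow> has_wirtinger S g c d \<Longrightarrow>
   has_wirtinger S (\<lambda>z. f z + g z) (\<lambda>z. a z + c z) (\<lambda>z. b z + d z)"
  unfolding has_wirtinger_def
  by (auto intro!: derivative_eq_intros simp: algebra_simps)

lemma has_wirtinger_cong:
  assumes "open S" "has_wirtinger S f a b" "\<And>z. z \<in> S \<Longrightarrow> g z = f z"
  shows "has_wirtinger S g a b"
  unfolding has_wirtinger_def
proof
  fix z assume z: "z \<in> S"
  then have "(f has_derivative (\<lambda>h. a z * h + b z * cnj h)) (at z)"
    using assms(2) by (simp add: has_wirtinger_def)
  then show "(g has_derivative (\<lambda>h. a z * h + b z * cnj h)) (at z)"
    by (rule has_derivative_transform_within_open[OF _ assms(1) z]) (simp add: assms(3))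
qed

lemma
  assumes "has_wirtinger S f a b" "z \<in> S"
  shows partial_x_wirtinger: "partial_x f z = a z + b z"
    and partial_y_wirtinger: "partial_y f z = \<i> * (a z - b z)"
    and partial_z_wirtinger: "partial_z f z = a z"
    and partial_zbar_wirtinger: "partial_zbar f z = b z"
proof -
  have d: "(f has_derivative (\<lambda>h. a z * h + b z * cnj h)) (at z)"
    using assms by (simp add: has_wirtinger_def)
  have *: "((\<lambda>t::real. f (z + c * of_real t)) has_vector_derivative (a z * c + b z * cnj c)) (at 0)"
    for c
  proof -
    have "((\<lambda>t::real. z + c * of_real t) has_derivative (\<lambda>t. c * of_real t)) (at 0)"
      by (auto intro!: derivative_eq_intros)
    moreover have "(f has_derivative (\<lambda>h. a z * h + b z * cnj h)) (at (z + c * of_real 0))"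
      using d by simp
    ultimately have "((\<lambda>t::real. f (z + c * of_real t)) has_derivative
        (\<lambda>t. a z * (c * of_real t) + b z * cnj (c * of_real t))) (at 0)"
      by (rule has_derivative_compose)
    then show ?thesis
      by (simp add: has_vector_derivative_def scaleR_conv_of_real algebra_simps)
  qed
  show x: "partial_x f z = a z + b z"
    unfolding partial_x_def using *[of 1] by (simp add: vector_derivative_at)
  show y: "partial_y f z = \<i> * (a z - b z)"
    unfolding partial_y_def using *[of \<i>] by (simp add: vector_derivative_at algebra_simps)
  show "partial_z f z = a z" "partial_zbar f z = b z"
    by (simp_all add: partial_z_def partial_zbar_def x y algebra_simps)
qed

lemma sep_cmult: "sep S f \<Longrightarrow> sep S (\<lambda>z. c * f z)"
proof (induction rule: sep.induct)
  case (sep_base A B)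
  then have "sep S (\<lambda>z. (c * A z) * cnj (B z))"
    by (intro sep.sep_base holomorphic_intros)
  then show ?case by (simp add: mult.assoc)
next
  case (sep_add f g)
  then show ?case by (simp add: distrib_left sep.sep_add)
next
  case (sep_cong f g)
  show ?case by (rule sep.sep_cong[OF sep_cong(3)]) (simp add: sep_cong(2))
qed

lemma sep_cnj: "sep S f \<Longrightarrow> sep S (\<lambda>z. cnj (f z))"
proof (induction rule: sep.induct)
  case (sep_base A B)
  then show ?case using sep.sep_base[of B S A] by (simp add: mult.commute)
next
  case (sep_add f g)
  then show ?case by (simp add: sep.sep_add)
next
  case (sep_cong f g)
  show ?case by (rule sep.sep_cong[OF sep_cong(3)]) (simp add: sep_cong(2))
qed

lemma sep_wirtinger:
  assumes "open S" "sep S f"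
  shows "\<exists>a b. sep S a \<and> sep S b \<and> has_wirtinger S f a b"
  using assms(2)
proof (induction rule: sep.induct)
  case (sep_base A B)
  have "sep S (\<lambda>z. deriv A z * cnj (B z))" "sep S (\<lambda>z. A z * cnj (deriv B z))"
    using sep_base assms(1) by (auto intro!: sep.sep_base holomorphic_deriv)
  then show ?case using has_wirtinger_prod[OF assms(1) sep_base] by blast
next
  case (sep_add f g)
  then obtain a b c d where "sep S a" "sep S b" "has_wirtinger S f a b"
    "sep S c" "sep S d" "has_wirtinger S g c d" by blast
  then show ?case
    by (intro exI[of _ "\<lambda>z. a z + c z"] exI[of _ "\<lambda>z. b z + d z"] conjI
        sep.sep_add has_wirtinger_add)
next
  case (sep_cong f g)
  from sep_cong.IH obtain a b where "sep S a" "sep S b" "has_wirtinger S f a b" by blast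
  then show ?case
    using has_wirtinger_cong[OF assms(1), of f a b g] sep_cong.hyps(2) by blast
qed

lemma sep_Ck_on:
  assumes "open S" "sep S f"
  shows "Ck_on k S f"
  using assms(2)
proof (induction k arbitrary: f)
  case 0
  obtain a b where "has_wirtinger S f a b" using sep_wirtinger[OF assms(1) 0] by blast
  then show ?case
    by (auto simp: has_wirtinger_def intro!: continuous_at_imp_continuous_on has_derivative_continuous)
next
  case (Suc k)
  obtain a b where ab: "sep S a" "sep S b" "has_wirtinger S f a b"
    using sep_wirtinger[OF assms(1) Suc.prems] by blast
  have "sep S (\<lambda>z. a z + b z)" "sep S (\<lambda>z. \<i> * (a z + (-1) * b z))"
    by (intro sep_add sep_cmult ab)+
  from sep_cong[OF this(1), of "partial_x f"] sep_cong[OF this(2), of "partial_y f"]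
  have "sep S (partial_x f)" "sep S (partial_y f)"
    by (simp_all add: partial_x_wirtinger[OF ab(3)] partial_y_wirtinger[OF ab(3)])
  moreover have "\<forall>z\<in>S. f differentiable (at z)"
    using ab(3) by (auto simp: has_wirtinger_def differentiable_def)
  ultimately show ?case using Suc.IH by simp
qed

lemma laplacian_wirtinger:
  assumes "open S" "has_wirtinger S f a b" "has_wirtinger S b c d" "z \<in> S"
  shows "laplacian f z = 4 * c z"
proof -
  have "has_wirtinger S (partial_zbar f) c d"
    by (rule has_wirtinger_cong[OF assms(1,3)]) (rule partial_zbar_wirtinger[OF assms(2)])
  then show ?thesis using assms(4) by (simp add: laplacian_def partial_z_wirtinger)
qed

lemma sep_holomorphic: "A holomorphic_on S \<Longrightarrow> sep S A"
  using sep_base[of A S "\<lambda>_. 1"] by simp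

lemma has_wirtinger_holomorphic:
  assumes "open S" "A holomorphic_on S"
  shows "has_wirtinger S A (deriv A) (\<lambda>_. 0)"
  using has_wirtinger_prod[OF assms, of "\<lambda>_. 1"] by simp

lemma has_wirtinger_cnj_holomorphic:
  assumes "open S" "B holomorphic_on S"
  shows "has_wirtinger S (\<lambda>z. cnj (B z)) (\<lambda>_. 0) (\<lambda>z. cnj (deriv B z))"
  using has_wirtinger_prod[OF assms(1) _ assms(2), of "\<lambda>_. 1"] by simp

lemma harmonic_mapping_on_holomorphic_add_cnj:
  assumes "open S" "H holomorphic_on S" "G holomorphic_on S"
    and F: "\<And>z. z \<in> S \<Longrightarrow> F z = H z + cnj (G z)"
  shows "harmonic_mapping_on S F"
proof -
  have harm: "harmonic_on S u"
    if u: "\<And>z. z \<in> S \<Longrightarrow> complex_of_real (u z) = A z + cnj (A z)" and A: "A holomorphic_on S" for u A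
  proof -
    have W: "has_wirtinger S (\<lambda>z. complex_of_real (u z)) (deriv A) (\<lambda>z. cnj (deriv A z))"
      using has_wirtinger_cong[OF assms(1) has_wirtinger_add[OF has_wirtinger_holomorphic[OF assms(1) A]
            has_wirtinger_cnj_holomorphic[OF assms(1) A]] u] by simp
    have "sep S (\<lambda>z. complex_of_real (u z))"
      by (rule sep_cong[OF sep_add[OF sep_holomorphic[OF A] sep_cnj[OF sep_holomorphic[OF A]]] u])
    then show ?thesis
      using laplacian_wirtinger[OF assms(1) W
          has_wirtinger_cnj_holomorphic[OF assms(1) holomorphic_deriv[OF A assms(1)]]]
      by (auto simp: harmonic_on_def intro: sep_Ck_on[OF assms(1)])
  qed
  have "harmonic_on S (\<lambda>z. Re (F z))"
    by (rule harm[where A = "\<lambda>z. (H z + G z) / 2"])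
       (auto simp: F complex_eq_iff field_simps intro!: holomorphic_intros assms)
  moreover have "harmonic_on S (\<lambda>z. Im (F z))"
    by (rule harm[where A = "\<lambda>z. (H z - G z) / (2 * \<i>)"])
       (auto simp: F complex_eq_iff Re_divide Im_divide field_simps intro!: holomorphic_intros assms)
  ultimately show ?thesis by (simp add: harmonic_mapping_on_def)
qed

lemma biharmonic_mapping_on_representation:
  assumes S: "open S" and hol: "H1 holomorphic_on S" "G1 holomorphic_on S"
    "H2 holomorphic_on S" "G2 holomorphic_on S"
    and f: "\<And>z. z \<in> S \<Longrightarrow>
      f z = (H1 z + cnj (G1 z)) + of_real ((norm z)\<^sup>2) * (H2 z + cnj (G2 z))"
  shows "biharmonic_mapping_on S f"
proof -
  define P where "P z = z * H2 z" for z
  define Q where "Q z = z * G2 z" for z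
  have P: "P holomorphic_on S" and Q: "Q holomorphic_on S"
    unfolding P_def Q_def by (intro holomorphic_intros hol)+
  have id: "(\<lambda>z. z) holomorphic_on S" by (rule holomorphic_on_ident)
  have eq: "f z = ((H1 z + cnj (G1 z)) + P z * cnj z) + z * cnj (Q z)" if "z \<in> S" for z
    unfolding f[OF that] complex_norm_square by (simp add: P_def Q_def algebra_simps)
  have "sep S f"
    by (rule sep_cong[OF _ eq])
       (intro sep_add sep_holomorphic sep_cnj sep_base P Q id hol)
  then have "Ck_on 4 S f" by (rule sep_Ck_on[OF S])
  moreover have "laplacian (laplacian f) z = 0" if z: "z \<in> S" for z
  proof -
    have W1: "has_wirtinger S f
       (\<lambda>z. ((deriv H1 z + 0) + deriv P z * cnj z) + deriv (\<lambda>z. z) z * cnj (Q z))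
       (\<lambda>z. ((0 + cnj (deriv G1 z)) + P z * cnj (deriv (\<lambda>z. z) z)) + z * cnj (deriv Q z))"
      by (rule has_wirtinger_cong[OF S _ eq])
         (intro has_wirtinger_add has_wirtinger_holomorphic has_wirtinger_cnj_holomorphic
           has_wirtinger_prod S P Q id hol)
    have W2: "has_wirtinger S
       (\<lambda>z. ((0 + cnj (deriv G1 z)) + P z * cnj (deriv (\<lambda>z. z) z)) + z * cnj (deriv Q z))
       (\<lambda>z. (0 + deriv P z) + deriv (\<lambda>z. z) z * cnj (deriv Q z))
       (\<lambda>z. (cnj (deriv (deriv G1) z) + 0) + z * cnj (deriv (deriv Q) z))"
      by (rule has_wirtinger_cong[OF S, where
            f = "\<lambda>z. (cnj (deriv G1 z) + P z) + z * cnj (deriv Q z)"])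
         (intro has_wirtinger_add has_wirtinger_holomorphic has_wirtinger_cnj_holomorphic
           has_wirtinger_prod S P Q id hol holomorphic_deriv, simp)
    have L: "laplacian f w = (4 * deriv P w) + cnj (4 * deriv Q w)" if "w \<in> S" for w
      using laplacian_wirtinger[OF S W1 W2 that] by simp
    have hL: "(\<lambda>w. 4 * deriv P w) holomorphic_on S" "(\<lambda>w. 4 * deriv Q w) holomorphic_on S"
      by (intro holomorphic_intros holomorphic_deriv P Q S)+
    have "has_wirtinger S (laplacian f) (\<lambda>w. deriv (\<lambda>w. 4 * deriv P w) w + 0)
            (\<lambda>w. 0 + cnj (deriv (\<lambda>w. 4 * deriv Q w) w))"
      by (rule has_wirtinger_cong[OF S _ L])
         (intro has_wirtinger_add has_wirtinger_holomorphic has_wirtinger_cnj_holomorphic S hL)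
    then show ?thesis
      using laplacian_wirtinger[OF S _ _ z, of "laplacian f" _ _ "\<lambda>_. 0"]
        has_wirtinger_cnj_holomorphic[OF S holomorphic_deriv[OF hL(2) S]] by auto
  qed
  ultimately show ?thesis by (simp add: biharmonic_mapping_on_def)
qed

end

theory Submission
  imports Defs
begin

text \<open>
  The harmonic mapping \<open>F = F1 + F2 = H + cnj G\<close> satisfies \<open>F - f = (1 - |z|\<^sup>2) F2 \<longrightarrow> 0\<close> at the circle, so \<open>F\<close> has
  the same boundary behaviour as \<open>f\<close>. Like \<open>f\<close> it is proper onto \<open>\<Omega>\<close>, and it is locally injective because
  \<open>|G'| < |H'|\<close>; hence it is a covering map, and therefore a homeomorphism, onto the convex set \<open>\<Omega>\<close>.

  Move the boundary point to 0 by a Cayley transform. By convexity of \<open>\<Omega>\<close> the sets \<open>{u > c}\<close> and \<open>{u < c}\<close> are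
  connected for every real component \<open>u\<close> of \<open>F\<close>. By the maximum principle, if \<open>limsup u > c\<close> at a boundary point
  then some component of \<open>{u > c}\<close> near that point accumulates at the real line, so four boundary points that are
  alternately high and low would give two crossing paths in disjoint regions. Hence \<open>u\<close> has one-sided boundary
  limits at 0, and by the Lindelof maximum principle \<open>u\<close> differs by \<open>o(1)\<close> from an affine function of \<open>arg\<close>.

  If \<open>F\<close> has no jump, its limit exists. Otherwise \<open>|H'(z)| \<ge> C / |z - \<zeta>|\<close> in nontangential approach, so that on
  the curves the integrand, written in the coordinates \<open>(m, \<theta>)\<close>, is at most a constant times the Jacobian of
  \<open>(m, \<theta>) \<mapsto> F (\<Gamma> m \<theta>)\<close>. Its double integral is an area inside \<open>\<Omega>\<close>, hence finite, and by Tonelli's theorem the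
  integral over almost every curve is finite.
\<close>

subsection \<open>Level regions of harmonic functions in the half plane\<close>

text \<open>The curve integral fits an area for the following reason. With
  \<open>s = \<theta> - \<theta>0\<close>, the map
  \<open>(m, \<theta>) \<mapsto> \<Gamma> m \<theta>\<close> has absolute Jacobian
  \<open>\<bar>s\<bar> * (1 - m * \<bar>s\<bar>)\<close>, and \<open>F\<close> has Jacobian
  \<open>|H'|^2 * (1 - |\<phi>|^2)\<close>. The bound \<open>|H'| >= C / |z - \<zeta>|\<close> makes
  \<open>1 - |\<phi>|^2\<close> at most a constant times \<open>s^2\<close> times the Jacobian of
  \<open>F\<close>. The factor \<open>1 / (1 - |z|^2)\<close> uses up one power of
  \<open>\<bar>s\<bar>\<close>, and the power left over is the Jacobian of the curve family.

  The lower bound holds because the analytic part of an affine function of \<open>arg\<close> has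
  derivative \<open>D / w\<close>. Closeness \<open>o(1)\<close> of harmonic functions gives only
  \<open>o(1 / Im w)\<close> for derivatives, which is negligible against \<open>D / w\<close> in
  nontangential approach only. Hence the slopes \<open>m\<close> are kept away from 0.

  The obstacle is that \<open>F\<close> has no boundary values to begin with. Behaviour at a real
  point \<open>x\<close> is therefore expressed by what happens eventually or frequently in the
  filter \<open>at x within uhp\<close>, and each real component of \<open>F\<close> is treated as
  the real part of a holomorphic function.\<close>

abbreviation uhp :: "complex set" where "uhp \<equiv> {w. 0 < Im w}"

lemma open_uhp: "open uhp"
  by (rule open_halfspace_Im_gt)

text \<open>No continuity at the frontier is assumed, so the maximum principle is applied on a
  superlevel set \<open>V\<close> of level \<open>s > B\<close> instead of \<open>W\<close>: the
  limsup bound keeps \<open>closure V\<close> inside \<open>W\<close>.\<close>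

lemma Re_holomorphic_le_limsup:
  assumes W: "open W" "bounded W" and A: "A holomorphic_on W"
    and lim: "\<And>\<xi> e. \<xi> \<in> frontier W \<Longrightarrow> 0 < e \<Longrightarrow> \<forall>\<^sub>F w in at \<xi> within W. Re (A w) < B + e"
    and z: "z \<in> W"
  shows "Re (A z) \<le> B"
proof (rule ccontr)
  assume n: "\<not> Re (A z) \<le> B"
  define s where "s = (B + Re (A z)) / 2"
  have s: "B < s" "s < Re (A z)" using n by (auto simp: s_def field_simps)
  define V where "V = {w \<in> W. s < Re (A w)}"
  have contA: "continuous_on W (\<lambda>w. Re (A w))"
    using holomorphic_on_imp_continuous_on[OF A] by (intro continuous_intros)
  have "open (W \<inter> (\<lambda>w. Re (A w)) -` {s<..})"
    using continuous_open_preimage[OF contA W(1), of "{s<..}"] by auto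
  then have oV: "open V" by (simp add: V_def Int_def vimage_def)
  have cl: "w \<in> W \<and> s \<le> Re (A w)" if w: "w \<in> closure V" for w
  proof -
    have nt: "at w within V \<noteq> bot" if "w \<notin> V"
      using w that by (metis closure_def Un_iff islimpt_in_closure trivial_limit_within mem_Collect_eq)
    have "w \<in> W"
    proof (rule ccontr)
      assume n: "w \<notin> W"
      have "w \<in> closure W" using w closure_mono[of V W] by (auto simp: V_def)
      then have "w \<in> frontier W" using n W(1) by (simp add: frontier_def interior_open)
      from lim[OF this, of "s - B"] s have "\<forall>\<^sub>F x in at w within W. Re (A x) < s" by simp
      then have "\<forall>\<^sub>F x in at w within V. Re (A x) < s"
        by (rule filter_leD[rotated]) (auto simp: V_def intro: at_le)
      moreover have "\<forall>\<^sub>F x in at w within V. x \<in> V"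
        by (simp add: eventually_at_topological) (auto intro: exI[of _ UNIV])
      ultimately have "\<forall>\<^sub>F x in at w within V. False"
        by eventually_elim (auto simp: V_def)
      with nt n show False by (auto simp: V_def)
    qed
    moreover have "s \<le> Re (A w)"
    proof (cases "w \<in> V")
      case True then show ?thesis by (simp add: V_def)
    next
      case False
      have "((\<lambda>x. Re (A x)) \<longlongrightarrow> Re (A w)) (at w within W)"
        using contA \<open>w \<in> W\<close> by (simp add: continuous_on_def)
      then have "((\<lambda>x. Re (A x)) \<longlongrightarrow> Re (A w)) (at w within V)"
        by (rule tendsto_within_subset) (auto simp: V_def)
      then show ?thesis
        by (rule tendsto_lowerbound[OF _ _ nt[OF False]])
          (auto simp: eventually_at_topological V_def intro!: exI[of _ UNIV])
    qed
    ultimately show ?thesis by blast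
  qed
  have "Re (A z) \<le> s"
  proof (rule maximum_real_frontier[of A V])
    show "A holomorphic_on interior V"
      by (rule holomorphic_on_subset[OF A]) (use oV in \<open>auto simp: interior_open V_def\<close>)
    show "continuous_on (closure V) A"
      by (rule continuous_on_subset[OF holomorphic_on_imp_continuous_on[OF A]]) (use cl in blast)
    show "bounded V" by (rule bounded_subset[OF W(2)]) (auto simp: V_def)
    show "Re (A w) \<le> s" if "w \<in> frontier V" for w
      using that oV cl[of w] by (auto simp: frontier_def interior_open V_def)
    show "z \<in> V" using z s by (simp add: V_def)
  qed
  with s show False by simp
qed

text \<open>Suppose the component through a point \<open>z\<close> stays above some height
  \<open>h\<close>. Then \<open>A\<close> is holomorphic near its closure, and
  \<open>A - (K - c) * b\<close> has real part at most \<open>c\<close> on the frontier: on the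
  circular side the barrier outweighs the bound \<open>K\<close>, and elsewhere \<open>Re A\<close>
  is at most \<open>c\<close>. The maximum principle carries this to \<open>z\<close>, which was
  chosen so close to \<open>x\<close> that the barrier costs less than \<open>a - c\<close>.\<close>

lemma superlevel_component_reaches_real_line:
  assumes A: "A holomorphic_on uhp" and bd: "\<And>w. w \<in> uhp \<Longrightarrow> Re (A w) \<le> K"
    and freq: "\<exists>\<^sub>F w in at (of_real x) within uhp. a < Re (A w)"
    and c: "c < a" and \<delta>: "0 < \<delta>"
  obtains W where "open W" "connected W" "W \<subseteq> uhp \<inter> ball (of_real x) \<delta> \<inter> {w. c < Re (A w)}"
    "\<And>h. 0 < h \<Longrightarrow> \<exists>w\<in>W. Im w < h"
proof -
  \<comment> \<open>The barrier \<^term>\<open>Re (b w)\<close> is nonnegative on the half disc, at least 1 on its circular side, and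
    vanishes at the centre.\<close>
  define b where "b = (\<lambda>w. ((w - of_real x)\<^sup>2 - 2 * \<i> * of_real \<delta> * (w - of_real x)) / of_real (\<delta>\<^sup>2))"
  have b_alt: "Re (b w) = ((Re w - x)\<^sup>2 - (Im w)\<^sup>2 + 2 * \<delta> * Im w) / \<delta>\<^sup>2" for w
    by (simp add: b_def power2_eq_square Re_divide_of_real del: of_real_power of_real_mult)
  have n2: "(norm (w - of_real x))\<^sup>2 = (Re w - x)\<^sup>2 + (Im w)\<^sup>2" for w
    by (simp add: cmod_power2)
  have Imle: "\<bar>Im w\<bar> \<le> \<delta>" if "norm (w - of_real x) \<le> \<delta>" for w
    using abs_Im_le_cmod[of "w - of_real x"] that by simp
  have b0: "0 \<le> Re (b w)" if "norm (w - of_real x) \<le> \<delta>" "0 \<le> Im w" for w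
  proof -
    have "(Im w)\<^sup>2 \<le> \<delta> * Im w" using Imle[OF that(1)] that(2)
      by (simp add: power2_eq_square mult_right_mono)
    moreover have "0 \<le> \<delta> * Im w" using that(2) \<delta> by simp
    moreover have "0 \<le> (Re w - x)\<^sup>2" by simp
    ultimately have "0 \<le> (Re w - x)\<^sup>2 - (Im w)\<^sup>2 + 2 * \<delta> * Im w" by linarith
    then show ?thesis unfolding b_alt by simp
  qed
  have b1: "1 \<le> Re (b w)" if "norm (w - of_real x) = \<delta>" "0 \<le> Im w" for w
  proof -
    have "(Im w)\<^sup>2 \<le> \<delta> * Im w" using Imle[of w] that
      by (simp add: power2_eq_square mult_right_mono)
    moreover have "\<delta>\<^sup>2 = (Re w - x)\<^sup>2 + (Im w)\<^sup>2" using n2[of w] that by simp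
    ultimately have "\<delta>\<^sup>2 \<le> (Re w - x)\<^sup>2 - (Im w)\<^sup>2 + 2 * \<delta> * Im w" by linarith
    then show ?thesis using \<delta> by (simp add: b_alt)
  qed
  obtain w0 where "0 < Im w0" "a < Re (A w0)"
    using freq by (auto simp: frequently_def eventually_at_topological)
  then have Ka: "a < K" using bd[of w0] by auto
  have "((\<lambda>w. (K - c) * Re (b w)) \<longlongrightarrow> (K - c) * Re (b (of_real x))) (at (of_real x) within uhp)"
    unfolding b_def using \<delta> by (intro tendsto_intros) auto
  then have "\<forall>\<^sub>F w in at (of_real x) within uhp. (K - c) * Re (b w) < a - c"
    by (rule order_tendstoD) (use c in \<open>simp add: b_def\<close>)
  moreover have "\<forall>\<^sub>F w in at (of_real x) within uhp. w \<in> uhp \<inter> ball (of_real x) \<delta>"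
    using \<delta> by (auto simp: eventually_at_topological intro!: exI[of _ "ball (of_real x) \<delta>"])
  ultimately have "\<forall>\<^sub>F w in at (of_real x) within uhp.
      (K - c) * Re (b w) < a - c \<and> w \<in> uhp \<inter> ball (of_real x) \<delta>" by (rule eventually_conj)
  from frequently_ex[OF frequently_eventually_frequently[OF freq this]]
  obtain z where z: "z \<in> uhp \<inter> ball (of_real x) \<delta>" "a < Re (A z)" "(K - c) * Re (b z) < a - c"
    by blast
  define S where "S = uhp \<inter> ball (of_real x) \<delta> \<inter> {w. c < Re (A w)}"
  have contA: "continuous_on uhp (\<lambda>w. Re (A w))"
    using holomorphic_on_imp_continuous_on[OF A] by (intro continuous_intros)
  have oS: "open S"
  proof -
    have "open (uhp \<inter> (\<lambda>w. Re (A w)) -` {c<..})"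
      using continuous_open_preimage[OF contA open_uhp, of "{c<..}"] by auto
    then have "open (uhp \<inter> (\<lambda>w. Re (A w)) -` {c<..} \<inter> ball (of_real x) \<delta>)"
      by (rule open_Int) simp
    moreover have "uhp \<inter> (\<lambda>w. Re (A w)) -` {c<..} \<inter> ball (of_real x) \<delta> = S" by (auto simp: S_def)
    ultimately show ?thesis by simp
  qed
  have zS: "z \<in> S" using z c by (auto simp: S_def)
  define W where "W = connected_component_set S z"
  have WS: "W \<subseteq> S" by (simp add: W_def connected_component_subset)
  have oW: "open W" using oS by (simp add: W_def open_connected_component)
  have zW: "z \<in> W" using zS by (simp add: W_def)
  show thesis
  proof
    show "open W" by fact
    show "connected W" by (simp add: W_def)
    show "W \<subseteq> uhp \<inter> ball (of_real x) \<delta> \<inter> {w. c < Re (A w)}" using WS by (simp add: S_def)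
    fix h :: real assume h: "0 < h"
    show "\<exists>w\<in>W. Im w < h"
    proof (rule ccontr)
      assume "\<not> ?thesis"
      then have "closure W \<subseteq> {w. h \<le> Im w}"
        by (intro closure_minimal closed_halfspace_Im_ge) (auto simp: not_less)
      then have clW: "closure W \<subseteq> uhp" using h by auto
      define B where "B = (\<lambda>w. A w - of_real (K - c) * b w)"
      have "Re (B z) \<le> c"
      proof (rule maximum_real_frontier[of B W])
        have holB: "B holomorphic_on uhp" unfolding B_def b_def using \<delta>
          by (intro holomorphic_intros A) auto
        show "B holomorphic_on interior W"
          by (rule holomorphic_on_subset[OF holB]) (use WS oW in \<open>auto simp: interior_open S_def\<close>)
        show "continuous_on (closure W) B"
          by (rule continuous_on_subset[OF holomorphic_on_imp_continuous_on[OF holB] clW])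
        show "bounded W" by (rule bounded_subset[OF bounded_ball]) (use WS in \<open>auto simp: S_def\<close>)
        show "z \<in> W" by fact
        fix w assume w: "w \<in> frontier W"
        then have wcl: "w \<in> closure W" and wn: "w \<notin> W" using oW by (auto simp: frontier_def interior_open)
        have Imw: "0 < Im w" using wcl clW by auto
        have "W \<subseteq> cball (of_real x) \<delta>" using WS by (auto simp: S_def)
        then have "w \<in> cball (of_real x) \<delta>" using closure_minimal[OF _ closed_cball] wcl by blast
        then have wb: "norm (w - of_real x) \<le> \<delta>" by (simp add: dist_norm norm_minus_commute)
        \<comment> \<open>A component of an open set has no frontier point in that set, since a ball
          around such a point would enlarge the component.\<close>
        have "w \<notin> S"
          unfolding W_def
        proof
          assume "w \<in> S"
          obtain e where e: "0 < e" "ball w e \<subseteq> S" using oS \<open>w \<in> S\<close> open_contains_ball by blast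
          obtain y where y: "y \<in> W" "dist y w < e" using wcl e closure_approachable by blast
          have "y \<in> ball w e" "w \<in> ball w e" using y e by (auto simp: dist_commute)
          then have "connected_component S y w"
            using e(2) by (meson connected_ball connected_component_def)
          then show False using y(1) wn
            by (auto simp: W_def intro: connected_component_trans)
        qed
        then consider "norm (w - of_real x) = \<delta>" | "Re (A w) \<le> c"
          using wb Imw by (auto simp: S_def dist_norm norm_minus_commute)
        then show "Re (B w) \<le> c"
        proof cases
          case 1
          have "K - c \<le> (K - c) * Re (b w)" using b1[OF 1] Imw Ka c by simp
          then show ?thesis using bd[of w] Imw by (simp add: B_def)
        next
          case 2
          have "0 \<le> (K - c) * Re (b w)" using b0[OF wb] Imw Ka c by simp
          then show ?thesis using 2 by (simp add: B_def)
        qed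
      qed
      then show False using z by (simp add: B_def)
    qed
  qed
qed

lemma at_real_within_uhp_neq_bot: "at (complex_of_real x) within uhp \<noteq> bot"
proof -
  have "complex_of_real x islimpt uhp"
    unfolding islimpt_approachable
  proof (intro allI impI)
    fix e :: real assume "0 < e"
    then show "\<exists>y\<in>uhp. y \<noteq> complex_of_real x \<and> dist y (complex_of_real x) < e"
      by (intro bexI[of _ "Complex x (e/2)"]) (auto simp: dist_norm complex_eq_iff cmod_def)
  qed
  then show ?thesis by (simp add: trivial_limit_within)
qed

text \<open>\<open>W\<close> may accumulate at the real line without containing a path that ends
  there, so the last piece is a vertical segment. It may leave \<open>W\<close>, but only below
  height \<open>h\<close> and without leaving the strip.\<close>

lemma path_from_real_line:
  assumes W: "open W" "connected W" "W \<subseteq> uhp" "W \<subseteq> {w. l < Re w \<and> Re w < r}"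
    and low: "\<And>h. 0 < h \<Longrightarrow> \<exists>w\<in>W. Im w < h" and z: "z \<in> W" and h: "0 < h"
  obtains g where "path g" "Im (pathstart g) = 0" "pathfinish g = z"
    "path_image g \<subseteq> {w. 0 \<le> Im w \<and> l < Re w \<and> Re w < r}" "path_image g \<subseteq> W \<union> {w. Im w < h}"
proof -
  obtain w where w: "w \<in> W" "Im w < h" using low[OF h] by blast
  obtain t where t: "path t" "path_image t \<subseteq> W" "pathstart t = w" "pathfinish t = z"
    using connected_open_path_connected[OF W(1,2)] w z unfolding path_connected_def by blast
  have "0 < Im w" "l < Re w" "Re w < r" using W w by auto
  have seg: "v = Complex (Re w) (Im v) \<and> 0 \<le> Im v \<and> Im v < h"
    if v: "v \<in> closed_segment (of_real (Re w)) w" for v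
  proof -
    obtain u where u: "0 \<le> u" "u \<le> 1" "v = (1 - u) *\<^sub>R of_real (Re w) + u *\<^sub>R w"
      using v unfolding in_segment by blast
    have "Re v = Re w" by (simp add: u(3) algebra_simps)
    moreover have "Im v = u * Im w" by (simp add: u(3))
    moreover have "u * Im w < h"
      using mult_left_le_one_le[of "Im w" u] u(1,2) w(2) \<open>0 < Im w\<close> by linarith
    ultimately show ?thesis using u(1) w(2) \<open>0 < Im w\<close> by (simp add: complex_eq_iff)
  qed
  show thesis
  proof
    show "path (linepath (of_real (Re w)) w +++ t)" using t by simp
    show "Im (pathstart (linepath (of_real (Re w)) w +++ t)) = 0" by simp
    show "pathfinish (linepath (of_real (Re w)) w +++ t) = z" using t by simp
    have im: "path_image (linepath (of_real (Re w)) w +++ t) = closed_segment (of_real (Re w)) w \<union> path_image t"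
      using t by (simp add: path_image_join)
    have *: "Re v = Re w" if "v \<in> closed_segment (of_real (Re w)) w" for v
      using seg[OF that] by (metis complex.sel(1))
    show "path_image (linepath (of_real (Re w)) w +++ t) \<subseteq> {w. 0 \<le> Im w \<and> l < Re w \<and> Re w < r}"
      unfolding im
    proof (intro Un_least subsetI)
      fix v assume v: "v \<in> closed_segment (of_real (Re w)) w"
      then show "v \<in> {w. 0 \<le> Im w \<and> l < Re w \<and> Re w < r}"
        using seg[OF v] *[OF v] \<open>l < Re w\<close> \<open>Re w < r\<close> by auto
    next
      fix v assume "v \<in> path_image t"
      then show "v \<in> {w. 0 \<le> Im w \<and> l < Re w \<and> Re w < r}" using t(2) W by force
    qed
    show "path_image (linepath (of_real (Re w)) w +++ t) \<subseteq> W \<union> {w. Im w < h}"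
      unfolding im using seg t(2) by blast
  qed
qed

section \<open>Crossing paths and alternating boundary values\<close>

lemma interlaced_paths_meet:
  assumes p: "path p" "path_image p \<subseteq> {w. 0 \<le> Im w}" and q: "path q" "path_image q \<subseteq> {w. 0 \<le> Im w}"
    and ends: "Im (pathstart p) = 0" "Im (pathfinish p) = 0" "Im (pathstart q) = 0" "Im (pathfinish q) = 0"
    and interlaced: "Re (pathstart p) < Re (pathstart q)" "Re (pathstart q) < Re (pathfinish p)"
      "Re (pathfinish p) < Re (pathfinish q)"
  obtains z where "z \<in> path_image p" "z \<in> path_image q"
proof -
  \<comment> \<open>\<open>v\<close> carries the half plane to \<open>real^2\<close>, where
    \<open>fashoda_interlace\<close> applies: in a large box resting on the real line all four
    endpoints lie on the bottom side.\<close>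
  define v :: "complex \<Rightarrow> real^2" where "v = (\<lambda>w. Re w *\<^sub>R axis 1 1 + Im w *\<^sub>R axis 2 1)"
  have v1: "v w $ 1 = Re w" and v2: "v w $ 2 = Im w" for w by (simp_all add: v_def axis_def)
  have contv: "continuous_on S v" for S
    unfolding v_def by (intro continuous_intros)
  have injv: "v x = v y \<Longrightarrow> x = y" for x y by (metis v1 v2 complex_eqI)
  have "bounded (path_image p \<union> path_image q)"
    using p(1) q(1) by (auto intro: compact_imp_bounded compact_path_image)
  then obtain R where R: "\<And>x. x \<in> path_image p \<union> path_image q \<Longrightarrow> norm x \<le> R"
    unfolding bounded_iff by blast
  have box: "v x \<in> cbox (vector [-R, 0]) (vector [R, R])"
    if "x \<in> path_image p \<union> path_image q" for x
  proof -
    have "0 \<le> Im x" using that p q by auto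
    moreover have "\<bar>Re x\<bar> \<le> R" "\<bar>Im x\<bar> \<le> R"
      using R[OF that] abs_Re_le_cmod[of x] abs_Im_le_cmod[of x] by auto
    ultimately show ?thesis by (auto simp: mem_box_cart forall_2 v1 v2 vector_2)
  qed
  obtain z where "z \<in> path_image (v \<circ> p)" "z \<in> path_image (v \<circ> q)"
  proof (rule fashoda_interlace[of "v \<circ> p" "v \<circ> q" "vector [-R, 0]" "vector [R, R]"])
    show "path (v \<circ> p)" "path (v \<circ> q)" using p q contv by (auto intro: path_continuous_image)
  qed (use box ends interlaced in \<open>auto simp: path_image_compose pathstart_compose pathfinish_compose v1 v2 vector_2\<close>)
  then obtain x y where "x \<in> path_image p" "y \<in> path_image q" "v x = v y"
    by (auto simp: path_image_compose)
  with injv that show thesis by blast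
qed

text \<open>Joining \<open>W1\<close> to \<open>W3\<close> inside \<open>U\<close> and
  \<open>W2\<close> to \<open>W4\<close> inside \<open>L\<close>, and prolonging both paths to the
  real line, gives interlaced endpoints. Yet the paths are disjoint: the end pieces lie in separate
  strips, the middle parts lie in \<open>U\<close> and \<open>L\<close>, and an end piece that
  leaves its region does so below both middle parts.\<close>

lemma interlaced_regions_not_separated:
  assumes U: "open U" "connected U" and L: "open L" "connected L"
    and UL: "U \<subseteq> uhp" "L \<subseteq> uhp" "U \<inter> L = {}"
    and W: "open W1" "connected W1" "open W2" "connected W2"
      "open W3" "connected W3" "open W4" "connected W4"
    and sub: "W1 \<subseteq> U" "W2 \<subseteq> L" "W3 \<subseteq> U" "W4 \<subseteq> L"
    and strips: "W1 \<subseteq> {w. l1 < Re w \<and> Re w < r1}" "W2 \<subseteq> {w. l2 < Re w \<and> Re w < r2}"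
      "W3 \<subseteq> {w. l3 < Re w \<and> Re w < r3}" "W4 \<subseteq> {w. l4 < Re w \<and> Re w < r4}"
      "r1 \<le> l2" "r2 \<le> l3" "r3 \<le> l4"
    and low: "\<And>h. 0 < h \<Longrightarrow> \<exists>w\<in>W1. Im w < h" "\<And>h. 0 < h \<Longrightarrow> \<exists>w\<in>W2. Im w < h"
      "\<And>h. 0 < h \<Longrightarrow> \<exists>w\<in>W3. Im w < h" "\<And>h. 0 < h \<Longrightarrow> \<exists>w\<in>W4. Im w < h"
  shows False
proof -
  obtain z1 z2 z3 z4 where z: "z1 \<in> W1" "z2 \<in> W2" "z3 \<in> W3" "z4 \<in> W4"
    using low[of 1] by auto
  obtain p0 where p0: "path p0" "path_image p0 \<subseteq> U" "pathstart p0 = z1" "pathfinish p0 = z3"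
    using connected_open_path_connected[OF U] z sub unfolding path_connected_def by blast
  obtain q0 where q0: "path q0" "path_image q0 \<subseteq> L" "pathstart q0 = z2" "pathfinish q0 = z4"
    using connected_open_path_connected[OF L] z sub unfolding path_connected_def by blast
  define P where "P = path_image p0 \<union> path_image q0"
  have "compact P" "P \<noteq> {}" using p0 q0 by (auto simp: P_def)
  \<comment> \<open>The lowest height reached by either middle part is the height below which the
    end pieces may leave their regions.\<close>
  then obtain w0 where w0: "w0 \<in> P" "\<And>w. w \<in> P \<Longrightarrow> Im w0 \<le> Im w"
    using continuous_attains_inf[of P Im] continuous_on_Im[OF continuous_on_id] by auto
  have h: "0 < Im w0" using w0(1) p0 q0 UL by (auto simp: P_def)
  have subs: "W1 \<subseteq> uhp" "W2 \<subseteq> uhp" "W3 \<subseteq> uhp" "W4 \<subseteq> uhp" using sub UL by auto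
  obtain g1 where g1: "path g1" "Im (pathstart g1) = 0" "pathfinish g1 = z1"
    "path_image g1 \<subseteq> {w. 0 \<le> Im w \<and> l1 < Re w \<and> Re w < r1}" "path_image g1 \<subseteq> W1 \<union> {w. Im w < Im w0}"
    by (rule path_from_real_line[OF W(1,2) subs(1) strips(1) low(1) z(1) h])
  obtain g2 where g2: "path g2" "Im (pathstart g2) = 0" "pathfinish g2 = z2"
    "path_image g2 \<subseteq> {w. 0 \<le> Im w \<and> l2 < Re w \<and> Re w < r2}" "path_image g2 \<subseteq> W2 \<union> {w. Im w < Im w0}"
    by (rule path_from_real_line[OF W(3,4) subs(2) strips(2) low(2) z(2) h])
  obtain g3 where g3: "path g3" "Im (pathstart g3) = 0" "pathfinish g3 = z3"
    "path_image g3 \<subseteq> {w. 0 \<le> Im w \<and> l3 < Re w \<and> Re w < r3}" "path_image g3 \<subseteq> W3 \<union> {w. Im w < Im w0}"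
    by (rule path_from_real_line[OF W(5,6) subs(3) strips(3) low(3) z(3) h])
  obtain g4 where g4: "path g4" "Im (pathstart g4) = 0" "pathfinish g4 = z4"
    "path_image g4 \<subseteq> {w. 0 \<le> Im w \<and> l4 < Re w \<and> Re w < r4}" "path_image g4 \<subseteq> W4 \<union> {w. Im w < Im w0}"
    by (rule path_from_real_line[OF W(7,8) subs(4) strips(4) low(4) z(4) h])
  define p where "p = g1 +++ p0 +++ reversepath g3"
  define q where "q = g2 +++ q0 +++ reversepath g4"
  have pi: "path_image p = path_image g1 \<union> path_image p0 \<union> path_image g3"
    using g1 g3 p0 by (auto simp: p_def path_image_join)
  have qi: "path_image q = path_image g2 \<union> path_image q0 \<union> path_image g4"
    using g2 g4 q0 by (auto simp: q_def path_image_join)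
  have start: "pathstart g1 \<in> path_image g1" "pathstart g2 \<in> path_image g2"
    "pathstart g3 \<in> path_image g3" "pathstart g4 \<in> path_image g4" by auto
  obtain z where zpq: "z \<in> path_image p" "z \<in> path_image q"
  proof (rule interlaced_paths_meet[of p q])
    show "path p" using g1 g3 p0 by (simp add: p_def)
    show "path q" using g2 g4 q0 by (simp add: q_def)
    have nonneg: "uhp \<subseteq> {w. 0 \<le> Im w}" by auto
    have "path_image p0 \<subseteq> {w. 0 \<le> Im w}" "path_image q0 \<subseteq> {w. 0 \<le> Im w}"
      using p0(2) q0(2) UL(1,2) nonneg by (meson subset_trans)+
    then show "path_image p \<subseteq> {w. 0 \<le> Im w}" "path_image q \<subseteq> {w. 0 \<le> Im w}"
      unfolding pi qi using g1(4) g3(4) g2(4) g4(4) by blast+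
    show "Im (pathstart p) = 0" "Im (pathfinish p) = 0" "Im (pathstart q) = 0" "Im (pathfinish q) = 0"
      using g1 g2 g3 g4 by (simp_all add: p_def q_def)
    have "Re (pathstart g1) < r1" "l2 < Re (pathstart g2)" "Re (pathstart g2) < r2" "l3 < Re (pathstart g3)"
      "Re (pathstart g3) < r3" "l4 < Re (pathstart g4)"
      using subsetD[OF g1(4) start(1)] subsetD[OF g2(4) start(2)] subsetD[OF g3(4) start(3)]
        subsetD[OF g4(4) start(4)] by simp_all
    then show "Re (pathstart p) < Re (pathstart q)" "Re (pathstart q) < Re (pathfinish p)"
      "Re (pathfinish p) < Re (pathfinish q)"
      using strips(5-7) by (simp_all add: p_def q_def)
  qed
  have "path_image g1 \<inter> path_image g2 = {}" "path_image g1 \<inter> path_image g4 = {}"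
    "path_image g3 \<inter> path_image g2 = {}" "path_image g3 \<inter> path_image g4 = {}"
  proof -
    have "l2 < r2" "l3 < r3"
      using subsetD[OF strips(2) z(2)] subsetD[OF strips(3) z(3)] by auto
    then have lr: "r1 \<le> l2" "r1 \<le> l4" "r2 \<le> l3" "r3 \<le> l4" using strips(5-7) by linarith+
    have dis: "S \<inter> T = {}" if "S \<subseteq> {w. 0 \<le> Im w \<and> l < Re w \<and> Re w < r}"
      "T \<subseteq> {w. 0 \<le> Im w \<and> l' < Re w \<and> Re w < r'}" "r \<le> l' \<or> r' \<le> l" for S T l r l' r'
    proof (rule equals0I)
      fix w assume "w \<in> S \<inter> T"
      then have "l < Re w" "Re w < r" "l' < Re w" "Re w < r'" using that(1,2) by blast+
      with that(3) show False by linarith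
    qed
    show "path_image g1 \<inter> path_image g2 = {}" "path_image g1 \<inter> path_image g4 = {}"
      "path_image g3 \<inter> path_image g2 = {}" "path_image g3 \<inter> path_image g4 = {}"
      using dis[OF g1(4) g2(4)] dis[OF g1(4) g4(4)] dis[OF g3(4) g2(4)] dis[OF g3(4) g4(4)] lr by blast+
  qed
  moreover have "path_image g1 \<inter> path_image q0 = {}" "path_image g3 \<inter> path_image q0 = {}"
  proof -
    have "\<forall>w\<in>path_image q0. w \<in> L \<and> \<not> Im w < Im w0"
      using q0(2) w0(2) unfolding P_def by (meson UnCI not_less subsetD)
    then show "path_image g1 \<inter> path_image q0 = {}" "path_image g3 \<inter> path_image q0 = {}"
      using g1(5) g3(5) sub(1,3) UL(3) by blast+
  qed
  moreover have "path_image p0 \<inter> path_image g2 = {}" "path_image p0 \<inter> path_image g4 = {}"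
  proof -
    have "\<forall>w\<in>path_image p0. w \<in> U \<and> \<not> Im w < Im w0"
      using p0(2) w0(2) unfolding P_def by (meson UnCI not_less subsetD)
    then show "path_image p0 \<inter> path_image g2 = {}" "path_image p0 \<inter> path_image g4 = {}"
      using g2(5) g4(5) sub(2,4) UL(3) by blast+
  qed
  moreover have "path_image p0 \<inter> path_image q0 = {}" using p0 q0 UL(3) by blast
  ultimately have "path_image p \<inter> path_image q = {}"
    unfolding pi qi Int_Un_distrib Int_Un_distrib2 by simp
  with zpq show False by blast
qed

text \<open>Connectedness of the level regions replaces the existence of a unimodal boundary function, so that
  Fatou's theorem on radial limits is not needed.\<close>

definition unimodal_on_uhp :: "(complex \<Rightarrow> complex) \<Rightarrow> bool" where
  "unimodal_on_uhp A \<longleftrightarrow> A holomorphic_on uhp \<and> bounded (Re ` A ` uhp) \<and>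
     (\<forall>c. connected {w \<in> uhp. c < Re (A w)} \<and> connected {w \<in> uhp. Re (A w) < c})"

lemma unimodal_no_alternation:
  assumes A: "unimodal_on_uhp A" and x: "x1 < x2" "x2 < x3" "x3 < x4" and ba: "b < a"
    and hi: "\<exists>\<^sub>F w in at (of_real x1) within uhp. a < Re (A w)"
      "\<exists>\<^sub>F w in at (of_real x3) within uhp. a < Re (A w)"
    and lo: "\<exists>\<^sub>F w in at (of_real x2) within uhp. Re (A w) < b"
      "\<exists>\<^sub>F w in at (of_real x4) within uhp. Re (A w) < b"
  shows False
proof -
  define c where "c = (a + b) / 2"
  have c: "c < a" "- c < - b" using ba by (auto simp: c_def field_simps)
  \<comment> \<open>Half the smallest gap, so that the strips around the four points do not
    overlap.\<close>
  define \<delta> where "\<delta> = min (x2 - x1) (min (x3 - x2) (x4 - x3)) / 2"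
  have \<delta>: "0 < \<delta>" "x1 + \<delta> \<le> x2 - \<delta>" "x2 + \<delta> \<le> x3 - \<delta>" "x3 + \<delta> \<le> x4 - \<delta>"
  proof -
    show "0 < \<delta>" using x by (simp add: \<delta>_def)
    have "2 * \<delta> \<le> x2 - x1" "2 * \<delta> \<le> x3 - x2" "2 * \<delta> \<le> x4 - x3" by (simp_all add: \<delta>_def)
    then show "x1 + \<delta> \<le> x2 - \<delta>" "x2 + \<delta> \<le> x3 - \<delta>" "x3 + \<delta> \<le> x4 - \<delta>" by linarith+
  qed
  have hol: "A holomorphic_on uhp" "(\<lambda>w. - A w) holomorphic_on uhp"
    using A by (auto simp: unimodal_on_uhp_def intro!: holomorphic_intros)
  obtain K where K: "\<And>w. w \<in> uhp \<Longrightarrow> \<bar>Re (A w)\<bar> \<le> K"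
    using A unfolding unimodal_on_uhp_def bounded_iff by auto
  have K1: "Re (A w) \<le> K" "Re (- A w) \<le> K" if "w \<in> uhp" for w using K[OF that] by auto
  \<comment> \<open>Low values of \<open>A\<close> are high values of \<open>- A\<close>, so the
    same lemma produces all four regions.\<close>
  have lo': "\<exists>\<^sub>F w in at (of_real x2) within uhp. - b < Re (- A w)"
      "\<exists>\<^sub>F w in at (of_real x4) within uhp. - b < Re (- A w)" using lo by simp_all
  have strip: "W \<subseteq> {w. x - \<delta> < Re w \<and> Re w < x + \<delta>}" if "W \<subseteq> uhp \<inter> ball (of_real x) \<delta> \<inter> X" for W x X
  proof
    fix w assume "w \<in> W"
    then have "norm (w - of_real x) < \<delta>" using that by (auto simp: dist_norm norm_minus_commute)
    then show "w \<in> {w. x - \<delta> < Re w \<and> Re w < x + \<delta>}"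
      using abs_Re_le_cmod[of "w - of_real x"] by auto
  qed
  note R = superlevel_component_reaches_real_line
  obtain W1 where W1: "open W1" "connected W1" "W1 \<subseteq> uhp \<inter> ball (of_real x1) \<delta> \<inter> {w. c < Re (A w)}"
    "\<And>h. 0 < h \<Longrightarrow> \<exists>w\<in>W1. Im w < h"
    using R[OF hol(1) K1(1) hi(1) c(1) \<delta>(1)] by blast
  obtain W3 where W3: "open W3" "connected W3" "W3 \<subseteq> uhp \<inter> ball (of_real x3) \<delta> \<inter> {w. c < Re (A w)}"
    "\<And>h. 0 < h \<Longrightarrow> \<exists>w\<in>W3. Im w < h"
    using R[OF hol(1) K1(1) hi(2) c(1) \<delta>(1)] by blast
  obtain W2 where W2: "open W2" "connected W2" "W2 \<subseteq> uhp \<inter> ball (of_real x2) \<delta> \<inter> {w. - c < Re (- A w)}"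
    "\<And>h. 0 < h \<Longrightarrow> \<exists>w\<in>W2. Im w < h"
    using R[OF hol(2) K1(2) lo'(1) c(2) \<delta>(1)] by blast
  obtain W4 where W4: "open W4" "connected W4" "W4 \<subseteq> uhp \<inter> ball (of_real x4) \<delta> \<inter> {w. - c < Re (- A w)}"
    "\<And>h. 0 < h \<Longrightarrow> \<exists>w\<in>W4. Im w < h"
    using R[OF hol(2) K1(2) lo'(2) c(2) \<delta>(1)] by blast
  have contA: "continuous_on uhp (\<lambda>w. Re (A w))"
    using holomorphic_on_imp_continuous_on[OF hol(1)] by (intro continuous_intros)
  show False
  proof (rule interlaced_regions_not_separated[of "{w \<in> uhp. c < Re (A w)}" "{w \<in> uhp. Re (A w) < c}" W1 W2 W3 W4])
    show "open {w \<in> uhp. c < Re (A w)}"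
      using continuous_open_preimage[OF contA open_uhp, of "{c<..}"] by (simp add: Int_def vimage_def)
    show "open {w \<in> uhp. Re (A w) < c}"
      using continuous_open_preimage[OF contA open_uhp, of "{..<c}"] by (simp add: Int_def vimage_def)
    show "connected {w \<in> uhp. c < Re (A w)}" "connected {w \<in> uhp. Re (A w) < c}"
      using A by (auto simp: unimodal_on_uhp_def)
    show "x1 + \<delta> \<le> x2 - \<delta>" "x2 + \<delta> \<le> x3 - \<delta>" "x3 + \<delta> \<le> x4 - \<delta>" by fact+
    show "W1 \<subseteq> {w. x1 - \<delta> < Re w \<and> Re w < x1 + \<delta>}" "W2 \<subseteq> {w. x2 - \<delta> < Re w \<and> Re w < x2 + \<delta>}"
      "W3 \<subseteq> {w. x3 - \<delta> < Re w \<and> Re w < x3 + \<delta>}" "W4 \<subseteq> {w. x4 - \<delta> < Re w \<and> Re w < x4 + \<delta>}"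
      using strip[OF W1(3)] strip[OF W2(3)] strip[OF W3(3)] strip[OF W4(3)] by blast+
    show "W1 \<subseteq> {w \<in> uhp. c < Re (A w)}" "W3 \<subseteq> {w \<in> uhp. c < Re (A w)}"
      using W1(3) W3(3) by blast+
    show "W2 \<subseteq> {w \<in> uhp. Re (A w) < c}" "W4 \<subseteq> {w \<in> uhp. Re (A w) < c}"
      using W2(3) W4(3) by auto
  qed (use W1(1,2,4) W2(1,2,4) W3(1,2,4) W4(1,2,4) in auto)
qed

text \<open>\<open>L\<close> is the upper limit, as \<open>x\<close> decreases to 0, of the largest
  cluster value at \<open>x\<close>. Values above \<open>L - e/3\<close> then recur arbitrarily
  close to 0. If values below \<open>L - e/2\<close> recurred as well, four alternating points could
  be picked from right to left.\<close>

lemma unimodal_right_limit: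
  assumes A: "unimodal_on_uhp A"
  obtains L where "\<And>e. 0 < e \<Longrightarrow> \<exists>\<eta>>0. \<forall>x. 0 < x \<longrightarrow> x < \<eta> \<longrightarrow>
      (\<forall>\<^sub>F w in at (of_real x) within uhp. \<bar>Re (A w) - L\<bar> < e)"
proof -
  obtain K where K: "\<And>w. w \<in> uhp \<Longrightarrow> \<bar>Re (A w)\<bar> \<le> K"
    using A unfolding unimodal_on_uhp_def bounded_iff by auto
  define hi where "hi a x \<longleftrightarrow> (\<exists>\<^sub>F w in at (complex_of_real x) within uhp. a < Re (A w))" for a x
  define lo where "lo b x \<longleftrightarrow> (\<exists>\<^sub>F w in at (complex_of_real x) within uhp. Re (A w) < b)" for b x
  define S where "S = {a. \<exists>\<eta>>0. \<forall>x. 0 < x \<longrightarrow> x < \<eta> \<longrightarrow> \<not> hi a x}"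
  have up: "a' \<in> S" if "a \<in> S" "a \<le> a'" for a a'
  proof -
    have "hi a' x \<Longrightarrow> hi a x" for x
      unfolding hi_def using that(2) by (auto elim!: frequently_elim1)
    then show ?thesis using that(1) unfolding S_def by blast
  qed
  have inuhp: "\<forall>\<^sub>F w in at (complex_of_real x) within uhp. w \<in> uhp" for x
    by (auto simp: eventually_at_topological intro!: exI[of _ UNIV])
  note nb = at_real_within_uhp_neq_bot
  have "K \<in> S"
  proof -
    have "\<not> hi K x" for x
      unfolding hi_def not_frequently using inuhp[of x]
      by eventually_elim (use K in \<open>force simp: abs_le_iff\<close>)
    then show ?thesis unfolding S_def by (auto intro: exI[of _ 1])
  qed
  have lb: "- K - 1 \<le> a" if aS: "a \<in> S" for a
  proof (rule ccontr)
    assume a: "\<not> - K - 1 \<le> a"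
    have "\<forall>\<^sub>F w in at (complex_of_real x) within uhp. a < Re (A w)" for x
      using inuhp[of x] by eventually_elim (use K a in \<open>force simp: abs_le_iff\<close>)
    then have hi_a: "hi a x" for x unfolding hi_def using nb eventually_frequently by blast
    obtain \<eta> where "\<eta> > 0" "\<And>x. 0 < x \<Longrightarrow> x < \<eta> \<Longrightarrow> \<not> hi a x" using aS unfolding S_def by blast
    from this(2)[of "\<eta>/2"] this(1) hi_a show False by simp
  qed
  define L where "L = Inf S"
  have bdd: "bdd_below S" using lb by (rule bdd_belowI)
  show thesis
  proof
    fix e :: real assume e: "0 < e"
    have "L + e/2 \<in> S"
    proof -
      obtain a where "a \<in> S" "a < L + e/2"
        using cInf_lessD[of S "L + e/2"] \<open>K \<in> S\<close> e by (auto simp: L_def)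
      then show ?thesis using up by simp
    qed
    then obtain \<eta>1 where \<eta>1: "\<eta>1 > 0" "\<And>x. 0 < x \<Longrightarrow> x < \<eta>1 \<Longrightarrow> \<not> hi (L + e/2) x"
      unfolding S_def by blast
    have "L - e/3 \<notin> S"
    proof
      assume "L - e/3 \<in> S"
      from cInf_lower[OF this bdd] e show False by (simp add: L_def)
    qed
    then have his: "\<exists>x. 0 < x \<and> x < \<eta> \<and> hi (L - e/3) x" if "0 < \<eta>" for \<eta>
      using that unfolding S_def by blast
    have "\<exists>\<eta>>0. \<forall>x. 0 < x \<longrightarrow> x < \<eta> \<longrightarrow> \<not> lo (L - e/2) x"
    proof (rule ccontr)
      assume "\<not> ?thesis"
      then have los: "\<exists>x. 0 < x \<and> x < \<eta> \<and> lo (L - e/2) x" if "0 < \<eta>" for \<eta> using that by blast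
      obtain x4 where x4: "0 < x4" "lo (L - e/2) x4" using los[of 1] by auto
      obtain x3 where x3: "0 < x3" "x3 < x4" "hi (L - e/3) x3" using his[OF x4(1)] by auto
      obtain x2 where x2: "0 < x2" "x2 < x3" "lo (L - e/2) x2" using los[OF x3(1)] by auto
      obtain x1 where x1: "0 < x1" "x1 < x2" "hi (L - e/3) x1" using his[OF x2(1)] by auto
      show False
        using unimodal_no_alternation[OF A x1(2) x2(2) x3(2), of "L - e/2" "L - e/3"]
          x1 x2 x3 x4 e by (simp add: hi_def lo_def)
    qed
    then obtain \<eta>2 where \<eta>2: "\<eta>2 > 0" "\<And>x. 0 < x \<Longrightarrow> x < \<eta>2 \<Longrightarrow> \<not> lo (L - e/2) x" by blast
    have "\<forall>\<^sub>F w in at (of_real x) within uhp. \<bar>Re (A w) - L\<bar> < e"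
      if "0 < x" "x < min \<eta>1 \<eta>2" for x
    proof -
      have "\<forall>\<^sub>F w in at (complex_of_real x) within uhp. \<not> L + e/2 < Re (A w)"
        "\<forall>\<^sub>F w in at (complex_of_real x) within uhp. \<not> Re (A w) < L - e/2"
        using \<eta>1(2)[of x] \<eta>2(2)[of x] that by (auto simp: hi_def lo_def not_frequently)
      then show ?thesis by eventually_elim (use e in \<open>auto simp: abs_if field_simps\<close>)
    qed
    then show "\<exists>\<eta>>0. \<forall>x. 0 < x \<longrightarrow> x < \<eta> \<longrightarrow> (\<forall>\<^sub>F w in at (of_real x) within uhp. \<bar>Re (A w) - L\<bar> < e)"
      using \<eta>1(1) \<eta>2(1) by (intro exI[of _ "min \<eta>1 \<eta>2"]) auto
  qed
qed

subsection \<open>Boundary asymptotics\<close>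

text \<open>Reflection in the imaginary axis reduces left-hand limits to right-hand ones. The outer
  conjugation restores holomorphy and leaves the real part alone.\<close>

lemma unimodal_reflect:
  assumes "unimodal_on_uhp A"
  shows "unimodal_on_uhp (\<lambda>w. cnj (A (- cnj w)))"
proof -
  have uhp_refl: "(\<lambda>w. - cnj w) ` uhp = uhp"
    by (auto simp: image_iff intro!: exI[of _ "- cnj _"])
  have "(\<lambda>w. A (- w)) holomorphic_on uminus ` uhp"
    using assms unfolding unimodal_on_uhp_def
    by (intro holomorphic_on_compose[of uminus _ A, unfolded o_def]) (auto intro!: holomorphic_intros simp: image_image)
  moreover have "uminus ` uhp = cnj ` uhp"
    by (auto simp: image_iff intro!: exI[of _ "- cnj _"])
  ultimately have "(\<lambda>w. A (- w)) holomorphic_on cnj ` uhp" by simp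
  then have hol: "(\<lambda>w. cnj (A (- cnj w))) holomorphic_on uhp"
    using holomorphic_on_compose_cnj_cnj[of "\<lambda>w. A (- w)" uhp] by (simp add: o_def open_uhp)
  have cont: "continuous_on S (\<lambda>w. - cnj w)" for S by (intro continuous_intros)
  have eq: "{w \<in> uhp. P (Re (cnj (A (- cnj w))))} = (\<lambda>w. - cnj w) ` {w \<in> uhp. P (Re (A w))}" for P
    by (auto simp: image_iff intro!: exI[of _ "- cnj _"])
  have "connected {w \<in> uhp. P (Re (cnj (A (- cnj w))))}" if "connected {w \<in> uhp. P (Re (A w))}" for P
    unfolding eq by (rule connected_continuous_image[OF cont that])
  from this[of "\<lambda>r. c < r" for c] this[of "\<lambda>r. r < c" for c]
  have conn: "connected {w \<in> uhp. c < Re (cnj (A (- cnj w)))}" "connected {w \<in> uhp. Re (cnj (A (- cnj w))) < c}" for c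
    using assms unfolding unimodal_on_uhp_def by blast+
  have "(\<lambda>w. cnj (A (- cnj w))) ` uhp = cnj ` A ` (\<lambda>w. - cnj w) ` uhp" by (simp add: image_image)
  then have "Re ` (\<lambda>w. cnj (A (- cnj w))) ` uhp = Re ` A ` uhp"
    unfolding uhp_refl by (simp add: image_image)
  then show ?thesis using assms hol conn unfolding unimodal_on_uhp_def by simp
qed

lemma unimodal_one_sided_limits:
  assumes A: "unimodal_on_uhp A"
  obtains L R where "\<And>e. 0 < e \<Longrightarrow> \<exists>\<eta>>0. \<forall>x. 0 < x \<longrightarrow> x < \<eta> \<longrightarrow>
      (\<forall>\<^sub>F w in at (of_real x) within uhp. \<bar>Re (A w) - R\<bar> < e) \<and>
      (\<forall>\<^sub>F w in at (of_real (- x)) within uhp. \<bar>Re (A w) - L\<bar> < e)"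
proof -
  obtain R where R: "\<And>e. 0 < e \<Longrightarrow> \<exists>\<eta>>0. \<forall>x. 0 < x \<longrightarrow> x < \<eta> \<longrightarrow>
      (\<forall>\<^sub>F w in at (of_real x) within uhp. \<bar>Re (A w) - R\<bar> < e)"
    using unimodal_right_limit[OF A] by blast
  obtain L where L: "\<And>e. 0 < e \<Longrightarrow> \<exists>\<eta>>0. \<forall>x. 0 < x \<longrightarrow> x < \<eta> \<longrightarrow>
      (\<forall>\<^sub>F w in at (of_real x) within uhp. \<bar>Re (cnj (A (- cnj w))) - L\<bar> < e)"
    using unimodal_right_limit[OF unimodal_reflect[OF A]] by blast
  have refl: "\<forall>\<^sub>F w in at (of_real (- x)) within uhp. P w"
    if "\<forall>\<^sub>F w in at (of_real x) within uhp. P (- cnj w)" for x and P :: "complex \<Rightarrow> bool"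
  proof -
    have "filterlim (\<lambda>w. - cnj w) (at (of_real x) within uhp) (at (of_real (- x)) within uhp)"
      unfolding filterlim_at
    proof
      have "((\<lambda>w. - cnj w) \<longlongrightarrow> - cnj (of_real (- x))) (at (of_real (- x)) within uhp)"
        by (intro tendsto_intros)
      then show "((\<lambda>w. - cnj w) \<longlongrightarrow> of_real x) (at (of_real (- x)) within uhp)" by simp
      show "\<forall>\<^sub>F w in at (of_real (- x)) within uhp. - cnj w \<in> uhp \<and> - cnj w \<noteq> of_real x"
        by (auto simp: eventually_at_topological complex_eq_iff intro!: exI[of _ UNIV])
    qed
    from eventually_compose_filterlim[OF that this] show ?thesis by simp
  qed
  show thesis
  proof
    fix e :: real assume e: "0 < e"
    obtain \<eta>1 where 1: "\<eta>1 > 0" "\<forall>x. 0 < x \<longrightarrow> x < \<eta>1 \<longrightarrow>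
      (\<forall>\<^sub>F w in at (of_real x) within uhp. \<bar>Re (A w) - R\<bar> < e)" using R[OF e] by blast
    obtain \<eta>2 where 2: "\<eta>2 > 0" "\<forall>x. 0 < x \<longrightarrow> x < \<eta>2 \<longrightarrow>
      (\<forall>\<^sub>F w in at (of_real x) within uhp. \<bar>Re (cnj (A (- cnj w))) - L\<bar> < e)" using L[OF e] by blast
    show "\<exists>\<eta>>0. \<forall>x. 0 < x \<longrightarrow> x < \<eta> \<longrightarrow>
      (\<forall>\<^sub>F w in at (of_real x) within uhp. \<bar>Re (A w) - R\<bar> < e) \<and>
      (\<forall>\<^sub>F w in at (of_real (- x)) within uhp. \<bar>Re (A w) - L\<bar> < e)"
    proof (intro exI[of _ "min \<eta>1 \<eta>2"] conjI allI impI)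
      fix x assume x: "0 < x" "x < min \<eta>1 \<eta>2"
      then show "\<forall>\<^sub>F w in at (of_real x) within uhp. \<bar>Re (A w) - R\<bar> < e" using 1 by simp
      show "\<forall>\<^sub>F w in at (of_real (- x)) within uhp. \<bar>Re (A w) - L\<bar> < e"
        by (rule refl) (use 2 x in simp)
    qed (use 1 2 in simp)
  qed
qed

text \<open>The frontier of the half disc \<open>W\<close> has three kinds of points. Nonzero real
  ones are covered by the hypothesis, on the circular side the barrier \<open>b\<close> absorbs the
  bound \<open>K\<close>, and at 0 a small multiple of a logarithm absorbs it. Letting that multiple
  tend to 0 leaves \<open>e/2 + K * Re (b z)\<close>, and \<open>Re (b z)\<close> tends to 0 at
  0.\<close>

lemma Lindelof_upper_bound:
  assumes B: "B holomorphic_on uhp" and K: "\<And>w. w \<in> uhp \<Longrightarrow> Re (B w) \<le> K" and K0: "0 \<le> K"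
    and lim: "\<And>e. 0 < e \<Longrightarrow> \<exists>\<eta>>0. \<forall>x. 0 < \<bar>x\<bar> \<longrightarrow> \<bar>x\<bar> < \<eta> \<longrightarrow>
      (\<forall>\<^sub>F w in at (of_real x) within uhp. Re (B w) < e)"
    and e: "0 < e"
  shows "\<forall>\<^sub>F w in at 0 within uhp. Re (B w) < e"
proof -
  obtain \<eta> where \<eta>: "\<eta> > 0" "\<And>x. 0 < \<bar>x\<bar> \<Longrightarrow> \<bar>x\<bar> < \<eta> \<Longrightarrow>
      (\<forall>\<^sub>F w in at (of_real x) within uhp. Re (B w) < e/2)" using lim[of "e/2"] e by auto
  define \<delta> where "\<delta> = \<eta> / 2"
  have \<delta>: "0 < \<delta>" "\<delta> < \<eta>" using \<eta> by (auto simp: \<delta>_def)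
  define b where "b = (\<lambda>w. (w\<^sup>2 - 2 * \<i> * of_real \<delta> * w) / of_real (\<delta>\<^sup>2))"
  have b_alt: "Re (b w) = ((Re w)\<^sup>2 - (Im w)\<^sup>2 + 2 * \<delta> * Im w) / \<delta>\<^sup>2" for w
    by (simp add: b_def power2_eq_square Re_divide_of_real del: of_real_power of_real_mult)
  have b0: "0 \<le> Re (b w)" "norm w = \<delta> \<Longrightarrow> 1 \<le> Re (b w)" if "norm w \<le> \<delta>" "0 \<le> Im w" for w
  proof -
    have "(Im w)\<^sup>2 \<le> \<delta> * Im w" using abs_Im_le_cmod[of w] that
      by (simp add: power2_eq_square mult_right_mono)
    moreover have "0 \<le> \<delta> * Im w" using that(2) \<delta> by simp
    moreover have "0 \<le> (Re w)\<^sup>2" by simp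
    ultimately have "0 \<le> (Re w)\<^sup>2 - (Im w)\<^sup>2 + 2 * \<delta> * Im w"
      and *: "(Re w)\<^sup>2 + (Im w)\<^sup>2 \<le> (Re w)\<^sup>2 - (Im w)\<^sup>2 + 2 * \<delta> * Im w" by linarith+
    then show "0 \<le> Re (b w)" unfolding b_alt by simp
    assume "norm w = \<delta>"
    then have "\<delta>\<^sup>2 = (Re w)\<^sup>2 + (Im w)\<^sup>2" using cmod_power2[of w] by simp
    with * have "\<delta>\<^sup>2 \<le> (Re w)\<^sup>2 - (Im w)\<^sup>2 + 2 * \<delta> * Im w" by simp
    then show "1 \<le> Re (b w)" using \<delta> by (simp add: b_alt del: power2_eq_square)
  qed
  define W where "W = uhp \<inter> ball 0 \<delta>"
  have Wu: "W \<subseteq> uhp" by (auto simp: W_def)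
  have below: "Re (B z) \<le> e/2 + K * Re (b z)" if z: "z \<in> W" for z
  proof -
    have zn: "0 < norm z" "norm z < \<delta>" using z by (auto simp: W_def)
    have bound: "Re (B z) + t * ln (norm z / \<delta>) - K * Re (b z) \<le> e/2" if t: "0 < t" for t
    proof -
      \<comment> \<open>The logarithm outweighs \<^term>\<open>B\<close> at the exceptional point 0; afterwards \<^term>\<open>t\<close> tends to 0.\<close>
      define C where "C = (\<lambda>w. B w + of_real t * (Ln w - of_real (ln \<delta>)) - of_real K * b w)"
      have ReC: "Re (C w) = Re (B w) + t * ln (norm w / \<delta>) - K * Re (b w)" if "w \<noteq> 0" for w
        using that \<delta> by (simp add: C_def ln_div)
      have "Re (C z) \<le> e/2"
      proof (rule Re_holomorphic_le_limsup[of W C])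
        show "open W" by (auto simp: W_def intro: open_uhp)
        show "bounded W" by (auto simp: W_def)
        have "w \<notin> \<real>\<^sub>\<le>\<^sub>0" if "w \<in> uhp" for w
          using that by (auto simp: complex_nonpos_Reals_iff)
        then have "C holomorphic_on uhp" unfolding C_def b_def using \<delta>
          by (intro holomorphic_intros B) auto
        then show "C holomorphic_on W" by (rule holomorphic_on_subset[OF _ Wu])
        show "z \<in> W" by fact
        fix \<xi> and d :: real assume \<xi>: "\<xi> \<in> frontier W" and d: "0 < d"
        have inW: "\<forall>\<^sub>F w in at \<xi> within W. w \<in> W"
          by (auto simp: eventually_at_topological intro!: exI[of _ UNIV])
        have le: "Re (C w) \<le> Re (B w) - K * Re (b w)" "K * Re (b w) \<ge> 0"
          "Re (B w) \<le> K" "Re (C w) \<le> K + t * ln (norm w / \<delta>)" if "w \<in> W" for w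
        proof -
          have w: "0 < norm w" "norm w < \<delta>" "0 < Im w" using that by (auto simp: W_def)
          have "ln (norm w / \<delta>) \<le> 0" using w \<delta> by simp
          then have "t * ln (norm w / \<delta>) \<le> 0" using t by (simp add: mult_le_0_iff)
          then show "Re (C w) \<le> Re (B w) - K * Re (b w)" using w ReC[of w] by auto
          show 2: "K * Re (b w) \<ge> 0" using K0 b0[of w] w by simp
          show 3: "Re (B w) \<le> K" using K w by simp
          show "Re (C w) \<le> K + t * ln (norm w / \<delta>)" using 2 3 w ReC[of w] by auto
        qed
        have clW: "closure W \<subseteq> {w. 0 \<le> Im w} \<inter> cball 0 \<delta>"
          by (rule closure_minimal) (auto simp: W_def intro!: closed_Int closed_halfspace_Im_ge)
        have \<xi>1: "\<xi> \<in> closure W" "\<xi> \<notin> W" using \<xi> \<open>open W\<close>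
          by (auto simp: frontier_def interior_open)
        then have \<xi>2: "0 \<le> Im \<xi>" "norm \<xi> \<le> \<delta>" "Im \<xi> = 0 \<or> norm \<xi> = \<delta>" using clW by (auto simp: W_def)
        consider "\<xi> = 0" | "norm \<xi> = \<delta>" | "Im \<xi> = 0" "\<xi> \<noteq> 0" "norm \<xi> < \<delta>"
          using \<xi>2 by force
        then show "\<forall>\<^sub>F w in at \<xi> within W. Re (C w) < e/2 + d"
        proof cases
          case 1
          \<comment> \<open>At this radius the logarithmic term equals exactly
            \<open>- K\<close>.\<close>
          define \<rho> where "\<rho> = \<delta> * exp (- (K / t))"
          have \<rho>: "0 < \<rho>" using \<delta> by (simp add: \<rho>_def)
          have "\<forall>\<^sub>F w in at \<xi> within W. norm w < \<rho>"
            using \<rho> 1 by (auto simp: eventually_at dist_norm intro!: exI[of _ \<rho>])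
          then show ?thesis using inW
          proof eventually_elim
            case (elim w)
            have "0 < norm w" using elim(2) by (auto simp: W_def)
            then have "ln (norm w / \<delta>) \<le> ln (\<rho> / \<delta>)" using elim \<delta> \<rho>
              by (intro ln_mono divide_right_mono) auto
            also have "\<dots> = - (K / t)" using \<delta> by (simp add: \<rho>_def)
            finally have "t * ln (norm w / \<delta>) \<le> t * - (K / t)" using t by (intro mult_left_mono) auto
            then have "t * ln (norm w / \<delta>) \<le> - K" using t by simp
            then show ?case using le(4)[OF elim(2)] e d by simp
          qed
        next
          case 2
          have "((\<lambda>w. K * Re (b w)) \<longlongrightarrow> K * Re (b \<xi>)) (at \<xi> within W)"
            unfolding b_def using \<delta> by (intro tendsto_intros) auto
          moreover have "K \<le> K * Re (b \<xi>)" using b0(2)[of \<xi>] \<xi>2 2 K0 by (simp add: mult_le_cancel_left1)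
          ultimately have "\<forall>\<^sub>F w in at \<xi> within W. K - e/2 < K * Re (b w)"
            using e by (intro order_tendstoD(1)) auto
          then show ?thesis using inW
            by eventually_elim (use le d in fastforce)
        next
          case 3
          define x where "x = Re \<xi>"
          have x: "\<xi> = of_real x" "0 < \<bar>x\<bar>" "\<bar>x\<bar> < \<eta>"
            using 3 \<delta> abs_Re_le_cmod[of \<xi>] by (auto simp: x_def complex_eq_iff)
          have "\<forall>\<^sub>F w in at \<xi> within W. Re (B w) < e/2"
            using filter_leD[OF at_le[OF Wu] \<eta>(2)[OF x(2,3)]] by (simp add: x)
          then show ?thesis using inW
            by eventually_elim (use le d in fastforce)
        qed
      qed
      then show ?thesis using ReC[of z] zn by auto
    qed
    show ?thesis
    proof (rule field_le_epsilon)
      fix s :: real assume s: "0 < s"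
      \<comment> \<open>With \<open>t = s / l\<close> the logarithmic term at \<open>z\<close> costs
        exactly \<open>s\<close>.\<close>
      define l where "l = - ln (norm z / \<delta>)"
      have l: "0 < l" using zn \<delta> by (simp add: l_def)
      show "Re (B z) \<le> e/2 + K * Re (b z) + s"
        using bound[of "s / l"] s l by (simp add: l_def field_simps)
    qed
  qed
  have "((\<lambda>w. K * Re (b w)) \<longlongrightarrow> K * Re (b 0)) (at 0 within uhp)"
    unfolding b_def using \<delta> by (intro tendsto_intros) auto
  then have "\<forall>\<^sub>F w in at 0 within uhp. K * Re (b w) < e/2"
    by (rule order_tendstoD) (use e in \<open>simp add: b_def\<close>)
  moreover have "\<forall>\<^sub>F w in at 0 within uhp. w \<in> W"
    using \<delta> by (auto simp: eventually_at W_def intro!: exI[of _ \<delta>])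
  ultimately show ?thesis by eventually_elim (use below in fastforce)
qed

text \<open>The comparison function has the same one-sided boundary limits, so the remainder
  \<open>B\<close> is bounded, and small near every nonzero real point close to 0. The exceptional
  point 0 is handled by Lindelof's principle for \<open>B\<close> and \<open>- B\<close>.\<close>

lemma unimodal_asymptotics:
  assumes A: "unimodal_on_uhp A"
  obtains R d :: real where
    "((\<lambda>w. Re (A w - (of_real R - \<i> * of_real d * Ln w))) \<longlongrightarrow> 0) (at 0 within uhp)"
proof -
  obtain L R where LR: "\<And>e. 0 < e \<Longrightarrow> \<exists>\<eta>>0. \<forall>x. 0 < x \<longrightarrow> x < \<eta> \<longrightarrow>
      (\<forall>\<^sub>F w in at (of_real x) within uhp. \<bar>Re (A w) - R\<bar> < e) \<and>
      (\<forall>\<^sub>F w in at (of_real (- x)) within uhp. \<bar>Re (A w) - L\<bar> < e)"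
    by (rule unimodal_one_sided_limits[OF A], rule that, assumption)
  \<comment> \<open>\<^term>\<open>R + d * Im (Ln w)\<close> is the harmonic function with boundary values \<^term>\<open>R\<close> on the positive
    and \<^term>\<open>L\<close> on the negative half line.\<close>
  define d where "d = (L - R) / pi"
  define B where "B = (\<lambda>w. A w - (of_real R - \<i> * of_real d * Ln w))"
  obtain K where K: "\<And>w. w \<in> uhp \<Longrightarrow> \<bar>Re (A w)\<bar> \<le> K"
    using A unfolding unimodal_on_uhp_def bounded_iff by auto
  have nonpos: "w \<notin> \<real>\<^sub>\<le>\<^sub>0" if "w \<in> uhp" for w
    using that by (auto simp: complex_nonpos_Reals_iff)
  have ReB: "Re (B w) = Re (A w) - R - d * Im (Ln w)" for w by (simp add: B_def)
  have Arg: "0 < Im (Ln w)" "Im (Ln w) < pi" if "w \<in> uhp" for w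
    using that Im_Ln_pos_lt[of w] by (auto dest: Im_Ln_pos_lt_imp)
  have holB: "B holomorphic_on uhp"
    using A nonpos unfolding B_def unimodal_on_uhp_def by (intro holomorphic_intros) auto
  have bdd: "\<bar>Re (B w)\<bar> \<le> K + \<bar>R\<bar> + \<bar>d\<bar> * pi" if "w \<in> uhp" for w
  proof -
    have "\<bar>d * Im (Ln w)\<bar> \<le> \<bar>d\<bar> * pi"
      using Arg[OF that] by (simp add: abs_mult mult_left_mono)
    then show ?thesis using K[OF that] unfolding ReB by linarith
  qed
  have lim: "\<exists>\<eta>>0. \<forall>x. 0 < \<bar>x\<bar> \<longrightarrow> \<bar>x\<bar> < \<eta> \<longrightarrow>
      (\<forall>\<^sub>F w in at (of_real x) within uhp. \<bar>Re (B w)\<bar> < e)" if e: "0 < e" for e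
  proof -
    obtain \<eta> where \<eta>: "\<eta> > 0" "\<And>x. 0 < x \<Longrightarrow> x < \<eta> \<Longrightarrow>
      (\<forall>\<^sub>F w in at (of_real x) within uhp. \<bar>Re (A w) - R\<bar> < e/2) \<and>
      (\<forall>\<^sub>F w in at (of_real (- x)) within uhp. \<bar>Re (A w) - L\<bar> < e/2)"
      using LR[of "e/2"] e by auto
    have inuhp: "\<forall>\<^sub>F w in at (complex_of_real x) within uhp. w \<in> uhp" for x
      by (auto simp: eventually_at_topological intro!: exI[of _ UNIV])
    have pos: "\<forall>\<^sub>F w in at (of_real x) within uhp. \<bar>Re (B w)\<bar> < e" if "0 < x" "x < \<eta>" for x
    proof -
      have "((\<lambda>w. d * Im (Ln w)) \<longlongrightarrow> d * Im (Ln (of_real x))) (at (of_real x) within uhp)"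
        using that by (intro tendsto_intros) auto
      then have "((\<lambda>w. d * Im (Ln w)) \<longlongrightarrow> 0) (at (of_real x) within uhp)"
        using that by (simp add: Ln_of_real)
      then have "\<forall>\<^sub>F w in at (of_real x) within uhp. \<bar>d * Im (Ln w)\<bar> < e/2"
        using e by (auto dest!: tendstoD[where e = "e/2"] simp: dist_norm)
      moreover have "\<forall>\<^sub>F w in at (of_real x) within uhp. \<bar>Re (A w) - R\<bar> < e/2" using \<eta>(2)[OF that] by blast
      ultimately show ?thesis by eventually_elim (unfold ReB, linarith)
    qed
    have neg: "\<forall>\<^sub>F w in at (of_real (- x)) within uhp. \<bar>Re (B w)\<bar> < e" if "0 < x" "x < \<eta>" for x
    proof -
      \<comment> \<open>The principal branch jumps across the negative half line, so the argument of
        \<open>w\<close> is written as \<open>pi\<close> plus that of \<open>- w\<close>, which is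
        continuous there.\<close>
      have "((\<lambda>w. d * (pi + Im (Ln (- w)))) \<longlongrightarrow> d * (pi + Im (Ln (- of_real (- x))))) (at (of_real (- x)) within uhp)"
        using that by (intro tendsto_intros) auto
      then have "((\<lambda>w. d * (pi + Im (Ln (- w)))) \<longlongrightarrow> L - R) (at (of_real (- x)) within uhp)"
        using that by (simp add: Ln_of_real d_def)
      then have "\<forall>\<^sub>F w in at (of_real (- x)) within uhp. \<bar>d * (pi + Im (Ln (- w))) - (L - R)\<bar> < e/2"
        using e by (auto dest!: tendstoD[where e = "e/2"] simp: dist_norm)
      moreover have "\<forall>\<^sub>F w in at (of_real (- x)) within uhp. \<bar>Re (A w) - L\<bar> < e/2" using \<eta>(2)[OF that] by blast
      ultimately show ?thesis using inuhp
      proof eventually_elim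
        case (elim w)
        have "Im (Ln (- w)) = Im (Ln w) - pi" using elim(3) by (subst Ln_minus) auto
        then have "\<bar>d * Im (Ln w) - (L - R)\<bar> < e/2" using elim(1) by simp
        with elim(2) show ?case unfolding ReB by linarith
      qed
    qed
    show ?thesis
    proof (intro exI[of _ \<eta>] conjI allI impI)
      fix x assume "0 < \<bar>x\<bar>" "\<bar>x\<bar> < \<eta>"
      then show "\<forall>\<^sub>F w in at (of_real x) within uhp. \<bar>Re (B w)\<bar> < e"
        using pos[of x] neg[of "- x"] by (cases "0 < x") auto
    qed (use \<eta> in simp)
  qed
  have K0: "0 \<le> K + \<bar>R\<bar> + \<bar>d\<bar> * pi" using order_trans[OF abs_ge_zero bdd[of \<i>]] by simp
  have up: "\<forall>\<^sub>F w in at 0 within uhp. Re (B w) < e" if e: "0 < e" for e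
  proof (rule Lindelof_upper_bound[OF holB _ K0 _ e])
    show "Re (B w) \<le> K + \<bar>R\<bar> + \<bar>d\<bar> * pi" if "w \<in> uhp" for w using bdd[OF that] by simp
    fix e :: real assume "0 < e"
    have "\<forall>\<^sub>F w in F. Re (B w) < e" if "\<forall>\<^sub>F w in F. \<bar>Re (B w)\<bar> < e" for F
      using that by eventually_elim auto
    with lim[OF \<open>0 < e\<close>]
    show "\<exists>\<eta>>0. \<forall>x. 0 < \<bar>x\<bar> \<longrightarrow> \<bar>x\<bar> < \<eta> \<longrightarrow> (\<forall>\<^sub>F w in at (of_real x) within uhp. Re (B w) < e)"
      by blast
  qed
  have low: "\<forall>\<^sub>F w in at 0 within uhp. Re (- B w) < e" if e: "0 < e" for e
  proof (rule Lindelof_upper_bound[OF _ _ K0 _ e])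
    show "(\<lambda>w. - B w) holomorphic_on uhp" by (intro holomorphic_intros holB)
    show "Re (- B w) \<le> K + \<bar>R\<bar> + \<bar>d\<bar> * pi" if "w \<in> uhp" for w using bdd[OF that] by simp
    fix e :: real assume "0 < e"
    have "\<forall>\<^sub>F w in F. Re (- B w) < e" if "\<forall>\<^sub>F w in F. \<bar>Re (B w)\<bar> < e" for F
      using that by eventually_elim auto
    with lim[OF \<open>0 < e\<close>]
    show "\<exists>\<eta>>0. \<forall>x. 0 < \<bar>x\<bar> \<longrightarrow> \<bar>x\<bar> < \<eta> \<longrightarrow> (\<forall>\<^sub>F w in at (of_real x) within uhp. Re (- B w) < e)"
      by blast
  qed
  have "((\<lambda>w. Re (B w)) \<longlongrightarrow> 0) (at 0 within uhp)"
    unfolding tendsto_iff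
  proof (intro allI impI)
    fix e :: real assume "0 < e"
    from up[OF this] low[OF this] show "\<forall>\<^sub>F w in at 0 within uhp. dist (Re (B w)) 0 < e"
      by eventually_elim (auto simp: dist_norm)
  qed
  then show thesis unfolding B_def by (rule that)
qed

text \<open>The exponential turns a bound on the real part alone into bounds on a modulus. In the
  constant, 2 comes from working with radius \<open>r/2\<close>, one factor \<open>exp 1\<close>
  from the upper bound for \<open>g\<close>, and the other from its lower bound at
  \<open>z\<close>.\<close>

lemma deriv_bound_Re:
  assumes B: "B holomorphic_on ball z r" and r: "0 < r" and e: "0 < e"
    and bd: "\<And>w. w \<in> ball z r \<Longrightarrow> \<bar>Re (B w)\<bar> \<le> e"
  shows "norm (deriv B z) \<le> 2 * exp 2 * e / r"
proof -
  \<comment> \<open>Cauchy's estimate applies to \<^term>\<open>g\<close>, since \<^term>\<open>norm (g w)\<close> lies between \<^term>\<open>exp (- 1) :: real\<close> and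
    \<^term>\<open>exp 1 :: real\<close>.\<close>
  define g where "g = (\<lambda>w. exp (B w / of_real e))"
  have holg: "g holomorphic_on ball z r" unfolding g_def using e by (intro holomorphic_intros B) auto
  have Re1: "\<bar>Re (B w / of_real e)\<bar> \<le> 1" if "w \<in> ball z r" for w
  proof -
    have "\<bar>Re (B w / of_real e)\<bar> = \<bar>Re (B w)\<bar> / e" using e by (simp only: Re_divide_of_real abs_divide)
    also have "\<dots> \<le> 1" using bd[OF that] e by simp
    finally show ?thesis .
  qed
  have gle: "norm (g w) \<le> exp 1" if "w \<in> ball z r" for w
    unfolding g_def norm_exp_eq_Re exp_le_cancel_iff using Re1[OF that] by linarith
  have "norm ((deriv ^^ 1) g z) \<le> fact 1 * exp 1 / (r/2) ^ 1"
  proof (rule Cauchy_inequality)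
    show "g holomorphic_on ball z (r/2)" by (rule holomorphic_on_subset[OF holg]) (use r in auto)
    show "continuous_on (cball z (r/2)) g"
      by (rule continuous_on_subset[OF holomorphic_on_imp_continuous_on[OF holg]]) (use r in auto)
    show "0 < r/2" using r by simp
    show "norm (g x) \<le> exp 1" if "norm (z - x) = r/2" for x
      by (rule gle) (use that r in \<open>simp add: dist_norm\<close>)
  qed
  then have g': "norm (deriv g z) \<le> 2 * exp 1 / r" by (simp add: mult.commute)
  have "(B has_field_derivative deriv B z) (at z)"
    using B r by (intro holomorphic_derivI[of B "ball z r"]) auto
  then have "(g has_field_derivative exp (B z / of_real e) * (deriv B z / of_real e)) (at z)"
    unfolding g_def using e by (auto intro!: derivative_eq_intros)
  then have dg: "deriv g z = exp (B z / of_real e) * (deriv B z / of_real e)" by (rule DERIV_imp_deriv)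
  have "exp (- 1) \<le> norm (exp (B z / of_real e))" 
    unfolding norm_exp_eq_Re exp_le_cancel_iff using Re1[OF centre_in_ball[THEN iffD2, OF r]] by linarith
  then have "exp (-1) * (norm (deriv B z) / e) \<le> norm (exp (B z / of_real e)) * (norm (deriv B z) / e)"
    using e by (intro mult_right_mono) auto
  also have "\<dots> = norm (deriv g z)" using e by (simp add: dg norm_mult norm_divide)
  also have "\<dots> \<le> 2 * exp 1 / r" by (rule g')
  finally have "exp 1 * (exp (-1) * (norm (deriv B z) / e)) \<le> exp 1 * (2 * exp 1 / r)"
    by (intro mult_left_mono) auto
  also have "exp 1 * (2 * exp 1 / r) = 2 * exp (2::real) / r" by (simp flip: exp_add)
  also have "exp 1 * (exp (-1) * (norm (deriv B z) / e)) = norm (deriv B z) / e"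
    by (simp flip: mult.assoc exp_add)
  finally show ?thesis using e by (simp add: field_simps)
qed

subsection \<open>Proper sense-preserving harmonic mappings\<close>

text \<open>Properness makes each fibre compact and local injectivity makes it discrete, hence
  finite. By properness again, points over a small neighbourhood of \<open>w\<close> lie close to
  the fibre, so that neighbourhood is evenly covered.\<close>

lemma proper_local_homeomorphism_covering_space:
  fixes F :: "'a::euclidean_space \<Rightarrow> 'a"
  assumes S: "open S" "continuous_on S F" and T: "F ` S = T" "open T"
    and loc: "\<And>z. z \<in> S \<Longrightarrow> \<exists>U. open U \<and> z \<in> U \<and> U \<subseteq> S \<and> inj_on F U"
    and proper: "\<And>K. compact K \<Longrightarrow> K \<subseteq> T \<Longrightarrow> compact (S \<inter> F -` K)"
  shows "covering_space S F T"
proof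
  show "continuous_on S F" "F ` S = T" by fact+
  fix w assume w: "w \<in> T"
  define P where "P = S \<inter> F -` {w}"
  obtain U where U: "\<And>z. z \<in> S \<Longrightarrow> open (U z) \<and> z \<in> U z \<and> U z \<subseteq> S \<and> inj_on F (U z)"
    using loc by metis
  have "finite P"
  proof (rule ccontr)
    assume "infinite P"
    moreover have "compact P" unfolding P_def using proper[of "{w}"] w by simp
    ultimately obtain z where z: "z \<in> P" "z islimpt P"
      by (auto simp: compact_eq_Bolzano_Weierstrass)
    then obtain y where y: "y \<in> P" "y \<in> U z" "y \<noteq> z"
      using U[of z] islimptE[OF z(2), of "U z"] unfolding P_def by blast
    then have "F y = F z" using z by (simp add: P_def)
    then show False using y z U[of z] by (auto simp: P_def dest: inj_onD)
  qed
  obtain d where d: "\<And>z. 0 < d z \<and> (\<forall>x\<in>P. x \<noteq> z \<longrightarrow> d z \<le> dist z x)"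
    using finite_set_avoid[OF \<open>finite P\<close>] by metis
  \<comment> \<open>Half of the distance \<open>d z\<close> from the other fibre points makes the
    sheets disjoint.\<close>
  define V where "V z = U z \<inter> ball z (d z / 2)" for z
  have V: "open (V z)" "z \<in> V z" "V z \<subseteq> S" "inj_on F (V z)" if "z \<in> P" for z
    using U[of z] that d[of z] by (auto simp: V_def P_def intro: inj_on_subset)
  have disj: "V z \<inter> V y = {}" if "z \<in> P" "y \<in> P" "z \<noteq> y" for z y
  proof (rule equals0I)
    fix x assume "x \<in> V z \<inter> V y"
    then have "dist z x < d z / 2" "dist y x < d y / 2" by (auto simp: V_def)
    moreover have "d z \<le> dist z y" "d y \<le> dist z y" using d[of z] d[of y] that by (auto simp: dist_commute)
    ultimately show False using dist_triangle[of z y x] by (simp add: dist_commute)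
  qed
  obtain r where r: "0 < r" "cball w r \<subseteq> T" using T(2) w open_contains_cball by blast
  define K where "K = S \<inter> F -` cball w r"
  have cK: "compact K" unfolding K_def using proper r by simp
  \<comment> \<open>The values near \<open>w\<close> that are attained outside the sheets. They form
    a compact set missing \<open>w\<close>, which can be cut away from \<open>N\<close>.\<close>
  define C where "C = F ` (K - (\<Union>z\<in>P. V z))"
  have "compact C" unfolding C_def
  proof (rule compact_continuous_image)
    show "continuous_on (K - (\<Union>z\<in>P. V z)) F" by (rule continuous_on_subset[OF S(2)]) (auto simp: K_def)
    show "compact (K - (\<Union>z\<in>P. V z))" using cK V by (intro compact_diff) auto
  qed
  have wC: "w \<notin> C"
  proof
    assume "w \<in> C"
    then obtain z where z: "z \<in> K" "z \<notin> (\<Union>z\<in>P. V z)" "w = F z" by (auto simp: C_def)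
    then have "z \<in> P" by (simp add: P_def K_def)
    with V(2) z(2) show False by blast
  qed
  have oFV: "open (F ` V z)" if "z \<in> P" for z
    using V[OF that] by (intro invariance_of_domain continuous_on_subset[OF S(2)])
  define N where "N = ball w r \<inter> (\<Inter>z\<in>P. F ` V z) \<inter> - C"
  have oN: "open N" unfolding N_def
    using \<open>compact C\<close> oFV \<open>finite P\<close> by (intro open_Int open_INT open_Compl compact_imp_closed) auto
  have wN: "w \<in> N" using r wC V(2) by (auto simp: N_def P_def image_iff)
  have NT: "N \<subseteq> T" using r(2) by (auto simp: N_def)
  define v where "v = (\<lambda>z. V z \<inter> F -` N) ` P"
  have "\<Union>v = S \<inter> F -` N"
  proof
    show "\<Union>v \<subseteq> S \<inter> F -` N" using V(3) by (auto simp: v_def)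
    show "S \<inter> F -` N \<subseteq> \<Union>v"
    proof
      fix x assume x: "x \<in> S \<inter> F -` N"
      then have "x \<in> K" "F x \<notin> C" by (auto simp: K_def N_def)
      then have "x \<in> (\<Union>z\<in>P. V z)" unfolding C_def by blast
      then show "x \<in> \<Union>v" using x by (auto simp: v_def)
    qed
  qed
  moreover have op: "open (V z \<inter> F -` N)" if "z \<in> P" for z
    using continuous_open_preimage[OF continuous_on_subset[OF S(2) V(3)[OF that]] V(1)[OF that] oN] .
  then have "\<forall>u\<in>v. openin (top_of_set S) u"
    using V(3) by (auto simp: v_def intro!: open_subset)
  moreover have "pairwise disjnt v"
    unfolding pairwise_def v_def disjnt_def using disj by blast
  moreover have "\<forall>u\<in>v. \<exists>q. homeomorphism u N F q"
  proof
    fix u assume "u \<in> v"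
    then obtain z where z: "z \<in> P" "u = V z \<inter> F -` N" by (auto simp: v_def)
    have "N \<subseteq> F ` V z" using z(1) by (auto simp: N_def)
    then have "F ` u = N" unfolding z(2) by blast
    moreover have "continuous_on u F" "inj_on F u" "open u"
      using z V[OF z(1)] op[OF z(1)] by (auto intro: continuous_on_subset[OF S(2)] inj_on_subset)
    ultimately show "\<exists>q. homeomorphism u N F q"
      using invariance_of_domain_homeomorphism[of u F] by (metis order_refl)
  qed
  ultimately show "\<exists>N. w \<in> N \<and> openin (top_of_set T) N \<and>
      (\<exists>v. \<Union>v = S \<inter> F -` N \<and> (\<forall>u\<in>v. openin (top_of_set S) u) \<and> pairwise disjnt v \<and>
        (\<forall>u\<in>v. \<exists>q. homeomorphism u N F q))"
    using wN open_subset[OF NT oN] by blast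
qed

text \<open>The identity of \<open>T\<close> lifts to a section \<open>g\<close>. Then
  \<open>g \<circ> F\<close> and the identity of \<open>S\<close> both lift \<open>F\<close> through
  \<open>F\<close> and agree at \<open>a\<close>, so they agree on the connected set
  \<open>S\<close>, and \<open>F\<close> has a left inverse.\<close>

lemma covering_space_simply_connected_inj:
  fixes F :: "'a::real_normed_vector \<Rightarrow> 'b::real_normed_vector"
  assumes cov: "covering_space S F T" and S: "connected S"
    and T: "simply_connected T" "locally path_connected T"
  shows "inj_on F S"
proof (cases "S = {}")
  case False
  then obtain a where a: "a \<in> S" by blast
  have F: "continuous_on S F" "F \<in> S \<rightarrow> T"
    using covering_space_imp_continuous[OF cov] covering_space_imp_surjective[OF cov] by auto
  obtain g where g: "continuous_on T g" "g \<in> T \<rightarrow> S" "g (F a) = a" "\<And>y. y \<in> T \<Longrightarrow> F (g y) = y"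
    using covering_space_lift_strong[OF cov a _ T, of "F a" "\<lambda>y. y"] F a by (auto simp: continuous_on_id)
  have "g (F x) = x" if "x \<in> S" for x
  proof (rule covering_space_lift_unique[OF cov, of "g \<circ> F" a "\<lambda>x. x" S F, unfolded o_def])
    show "continuous_on S (\<lambda>x. g (F x))"
      using F by (intro continuous_on_compose2[OF g(1)]) auto
    show "F x = F (g (F x))" if "x \<in> S" for x 
      by (rule g(4)[symmetric]) (use F(2) that in auto)
  qed (use F g a S that in auto)
  then show ?thesis by (metis inj_onI)
qed auto

text \<open>The real-linear part at \<open>z\<close> stretches every vector by at least the factor
  \<open>k\<close>. Near \<open>z\<close>, \<open>H\<close> and \<open>G\<close> differ from their
  linear parts by maps with Lipschitz constant \<open>k / 3\<close>, and two such errors are too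
  small to cancel it.\<close>

lemma sense_preserving_harmonic_locally_injective:
  assumes S: "open S" and H: "H holomorphic_on S" and G: "G holomorphic_on S"
    and dil: "norm (deriv G z) < norm (deriv H z)" and z: "z \<in> S"
  shows "\<exists>U. open U \<and> z \<in> U \<and> U \<subseteq> S \<and> inj_on (\<lambda>z. H z + cnj (G z)) U"
proof -
  define k where "k = norm (deriv H z) - norm (deriv G z)"
  have k: "0 < k / 3" using dil by (simp add: k_def)
  have "isCont (deriv H) z" "isCont (deriv G) z"
    using holomorphic_on_imp_continuous_on[OF holomorphic_deriv[OF H S]]
      holomorphic_on_imp_continuous_on[OF holomorphic_deriv[OF G S]] S z
    by (simp_all add: continuous_on_eq_continuous_at)
  then have "(deriv H \<longlongrightarrow> deriv H z) (nhds z)" "(deriv G \<longlongrightarrow> deriv G z) (nhds z)"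
    by (simp_all add: isCont_def tendsto_at_iff_tendsto_nhds)
  then have "\<forall>\<^sub>F w in nhds z. dist (deriv H w) (deriv H z) < k / 3 \<and> dist (deriv G w) (deriv G z) < k / 3 \<and> w \<in> S"
    using k by (intro eventually_conj tendstoD eventually_nhds_in_open S z)
  then obtain e where "0 < e" "\<forall>w. dist w z < e \<longrightarrow>
      dist (deriv H w) (deriv H z) < k / 3 \<and> dist (deriv G w) (deriv G z) < k / 3 \<and> w \<in> S"
    unfolding eventually_nhds_metric by blast
  then have e: "0 < e" "\<And>w. w \<in> ball z e \<Longrightarrow>
      dist (deriv H w) (deriv H z) < k / 3 \<and> dist (deriv G w) (deriv G z) < k / 3 \<and> w \<in> S"
    by (simp_all add: dist_commute)
  have bound: "norm ((A x - A y) - deriv A z * (x - y)) \<le> k / 3 * norm (x - y)"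
    if A: "A holomorphic_on S" and A': "\<And>w. w \<in> ball z e \<Longrightarrow> dist (deriv A w) (deriv A z) < k / 3"
      and xy: "x \<in> ball z e" "y \<in> ball z e" for A x y
  proof -
    have "norm ((A x - deriv A z * x) - (A y - deriv A z * y)) \<le> k / 3 * norm (x - y)"
    proof (rule field_differentiable_bound[of "ball z e"])
      show "((\<lambda>x. A x - deriv A z * x) has_field_derivative deriv A w - deriv A z) (at w within ball z e)"
        if "w \<in> ball z e" for w
      proof (rule has_field_derivative_at_within)
        have "(A has_field_derivative deriv A w) (at w)"
          using holomorphic_derivI[OF A S, of w] e(2)[OF that] by blast
        then show "((\<lambda>x. A x - deriv A z * x) has_field_derivative deriv A w - deriv A z) (at w)"
          by (auto intro!: derivative_eq_intros)
      qed
      show "norm (deriv A w - deriv A z) \<le> k / 3" if "w \<in> ball z e" for w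
        using A'[OF that] by (simp add: dist_norm)
    qed (use xy in auto)
    then show ?thesis by (simp add: algebra_simps)
  qed
  have "inj_on (\<lambda>z. H z + cnj (G z)) (ball z e)"
  proof (rule inj_onI, rule ccontr)
    fix x y assume xy: "x \<in> ball z e" "y \<in> ball z e" and eq: "H x + cnj (G x) = H y + cnj (G y)" and "x \<noteq> y"
    define E where "E = (H x - H y) - deriv H z * (x - y)"
    define D where "D = (G x - G y) - deriv G z * (x - y)"
    have ED: "norm E \<le> k / 3 * norm (x - y)" "norm D \<le> k / 3 * norm (x - y)"
      unfolding E_def D_def using bound[OF H _ xy] bound[OF G _ xy] e(2) by auto
    have "deriv H z * (x - y) = - cnj (deriv G z * (x - y)) - E - cnj D"
      using eq unfolding E_def D_def by (simp add: algebra_simps)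
    then have "norm (deriv H z * (x - y)) \<le> norm (- cnj (deriv G z * (x - y))) + norm E + norm (cnj D)"
      using norm_triangle_ineq4[of "- cnj (deriv G z * (x - y)) - E" "cnj D"]
        norm_triangle_ineq4[of "- cnj (deriv G z * (x - y))" E] by simp
    then have "norm (deriv H z) * norm (x - y) \<le> norm (deriv G z) * norm (x - y) + norm E + norm D"
      by (simp add: norm_mult del: complex_cnj_mult complex_cnj_diff)
    then have "k * norm (x - y) \<le> 2 * (k / 3) * norm (x - y)" using ED by (simp add: k_def algebra_simps)
    then show False using \<open>x \<noteq> y\<close> k by simp
  qed
  then show ?thesis using e by (intro exI[of _ "ball z e"]) auto
qed

text \<open>\<open>F\<close> inherits properness from \<open>f\<close>: thicken a compact subset of
  \<open>\<Omega>\<close> by \<open>e\<close>; near the circle \<open>f\<close> avoids the thickened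
  set and \<open>F\<close> is within \<open>e\<close> of \<open>f\<close>. The maximum principle for
  linear functionals of \<open>F\<close> puts the image into \<open>closure \<Omega>\<close>. Being
  open, it lies in the interior of that closure, which is \<open>\<Omega>\<close> by convexity, and
  properness makes it closed in \<open>\<Omega>\<close>.\<close>

lemma harmonic_shadow_homeomorphism:
  fixes H G f :: "complex \<Rightarrow> complex"
  defines "F \<equiv> \<lambda>z. H z + cnj (G z)"
  assumes \<Omega>: "open \<Omega>" "convex \<Omega>"
    and H: "H holomorphic_on ball 0 1" and G: "G holomorphic_on ball 0 1"
    and dil: "\<And>z. z \<in> ball 0 1 \<Longrightarrow> norm (deriv G z) < norm (deriv H z)"
    and f: "continuous_on (ball 0 1) f" "inj_on f (ball 0 1)" "f ` ball 0 1 = \<Omega>"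
    and lim: "\<And>e. 0 < e \<Longrightarrow> \<exists>r<1. \<forall>z. r < norm z \<longrightarrow> norm z < 1 \<longrightarrow> norm (F z - f z) < e"
  shows "inj_on F (ball 0 1)" "F ` ball 0 1 = \<Omega>"
proof -
  let ?D = "ball 0 1 :: complex set"
  have contF: "continuous_on ?D F"
    unfolding F_def by (intro continuous_intros holomorphic_on_imp_continuous_on H G)
  note loc = sense_preserving_harmonic_locally_injective[OF open_ball H G dil, folded F_def]
  obtain g where g: "homeomorphism ?D \<Omega> f g"
    using invariance_of_domain_homeomorphism[OF open_ball f(1) _ f(2)] f(3) by auto
  have properf: "\<exists>r<1. \<forall>z. r < norm z \<longrightarrow> norm z < 1 \<longrightarrow> f z \<notin> K" if K: "compact K" "K \<subseteq> \<Omega>" for K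
  proof -
    have "compact (g ` K)" "g ` K \<subseteq> ?D"
      using K g by (auto simp: homeomorphism_def intro!: compact_continuous_image continuous_on_subset[of \<Omega> g])
    then have "compact (norm ` g ` K)" "\<And>x. x \<in> norm ` g ` K \<Longrightarrow> x < 1"
      by (auto intro!: compact_continuous_image continuous_intros)
    then have "\<exists>r<1. \<forall>x\<in>norm ` g ` K. x \<le> r"
    proof (cases "K = {}")
      case False
      then show ?thesis using compact_attains_sup[OF \<open>compact (norm ` g ` K)\<close>] \<open>\<And>x. x \<in> norm ` g ` K \<Longrightarrow> x < 1\<close>
        by (metis image_is_empty)
    qed (auto intro: exI[of _ 0])
    then obtain r where r: "r < 1" "\<And>w. w \<in> K \<Longrightarrow> norm (g w) \<le> r" by auto
    have "f z \<notin> K" if "r < norm z" "norm z < 1" for z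
      using r(2)[of "f z"] g that by (auto simp: homeomorphism_def)
    with r(1) show ?thesis by blast
  qed
  have properF: "\<exists>r<1. \<forall>z. r < norm z \<longrightarrow> norm z < 1 \<longrightarrow> F z \<notin> K" if K: "compact K" "K \<subseteq> \<Omega>" for K
  proof -
    obtain e where e: "0 < e" "(\<Union>x\<in>K. cball x e) \<subseteq> \<Omega>"
      using compact_subset_open_imp_cball_epsilon_subset[OF K(1) \<Omega>(1) K(2)] by blast
    obtain r1 where r1: "r1 < 1" "\<And>z. r1 < norm z \<Longrightarrow> norm z < 1 \<Longrightarrow> f z \<notin> (\<Union>x\<in>K. cball x e)"
      using properf[OF compact_minkowski_sum_cball[OF K(1)] e(2)] by blast
    obtain r2 where r2: "r2 < 1" "\<And>z. r2 < norm z \<Longrightarrow> norm z < 1 \<Longrightarrow> norm (F z - f z) < e"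
      using lim[OF e(1)] by blast
    have "F z \<notin> K" if "max r1 r2 < norm z" "norm z < 1" for z
      using r1(2)[of z] r2(2)[of z] that by (auto simp: dist_norm)
    then show ?thesis using r1 r2 by (intro exI[of _ "max r1 r2"]) auto
  qed
  have cpt: "compact (?D \<inter> F -` K)" if K: "compact K" "K \<subseteq> \<Omega>" for K
  proof -
    obtain r where r: "r < 1" "\<And>z. r < norm z \<Longrightarrow> norm z < 1 \<Longrightarrow> F z \<notin> K"
      using properF[OF K] by blast
    have "?D \<inter> F -` K = cball 0 r \<inter> F -` K" using r by force
    moreover have "closed (cball 0 r \<inter> F -` K)"
      using r(1) K by (intro continuous_closed_preimage continuous_on_subset[OF contF] compact_imp_closed) auto
    ultimately show ?thesis
      by (metis bounded_Int bounded_cball compact_eq_bounded_closed)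
  qed
  have openF: "open (F ` ?D)"
  proof -
    have "\<exists>T. open T \<and> F z \<in> T \<and> T \<subseteq> F ` ?D" if z: "z \<in> ?D" for z
    proof -
      obtain U where U: "open U" "z \<in> U" "U \<subseteq> ?D" "inj_on F U" using loc[OF z z] by blast
      then have "open (F ` U)" by (intro invariance_of_domain continuous_on_subset[OF contF])
      then show ?thesis using U by blast
    qed
    then show ?thesis by (subst open_subopen) auto
  qed
  have "F ` ?D \<subseteq> closure \<Omega>"
  proof (rule ccontr)
    assume "\<not> ?thesis"
    then obtain z0 where z0: "z0 \<in> ?D" "F z0 \<notin> closure \<Omega>" by blast
    then obtain a b where ab: "inner a (F z0) < b" "\<And>x. x \<in> closure \<Omega> \<Longrightarrow> b < inner a x"
      using separating_hyperplane_closed_point[OF convex_closure[OF \<Omega>(2)] closed_closure] by blast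
    \<comment> \<open>The functional \<open>inner a\<close> of \<open>F\<close> is harmonic; up to
      sign, \<open>A\<close> is a holomorphic function with that real part.\<close>
    define A where "A = (\<lambda>z. - (cnj a * H z + a * G z))"
    have ReA: "Re (A z) = - inner a (F z)" for z
      by (simp add: A_def F_def inner_complex_def algebra_simps)
    have "Re (A z0) \<le> - b"
    proof (rule Re_holomorphic_le_limsup[of ?D A])
      show "A holomorphic_on ?D" unfolding A_def by (intro holomorphic_intros H G)
      fix \<xi> and e :: real assume \<xi>: "\<xi> \<in> frontier ?D" and e: "0 < e"
      define e' where "e' = e / (norm a + 1)"
      have e': "0 < e'" "norm a * e' \<le> e" using e
        by (auto simp: e'_def field_simps add_pos_nonneg)
      obtain r where r: "r < 1" "\<And>z. r < norm z \<Longrightarrow> norm z < 1 \<Longrightarrow> norm (F z - f z) < e'"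
        using lim[OF e'(1)] by blast
      have "((\<lambda>z. norm z) \<longlongrightarrow> norm \<xi>) (at \<xi> within ?D)" by (intro tendsto_intros)
      moreover have "norm \<xi> = 1" using \<xi> by simp
      ultimately have "\<forall>\<^sub>F z in at \<xi> within ?D. r < norm z" using r(1) by (intro order_tendstoD(1)) auto
      moreover have "\<forall>\<^sub>F z in at \<xi> within ?D. z \<in> ?D"
        by (auto simp: eventually_at_topological intro!: exI[of _ UNIV])
      ultimately show "\<forall>\<^sub>F z in at \<xi> within ?D. Re (A z) < - b + e"
      proof eventually_elim
        case (elim z)
        have "f z \<in> \<Omega>" using elim(2) f(3) by auto
        then have "f z \<in> closure \<Omega>" by (rule subsetD[OF closure_subset])
        then have "b < inner a (f z)" by (rule ab)
        moreover have "inner a (f z) - inner a (F z) \<le> norm a * norm (f z - F z)"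
          unfolding inner_diff_right[symmetric] by (rule norm_cauchy_schwarz)
        moreover have "norm a * norm (f z - F z) \<le> norm a * e'"
          using r(2)[of z] elim by (intro mult_left_mono) (auto simp: norm_minus_commute)
        ultimately show ?case using e' unfolding ReA by linarith
      qed
    qed (use z0 in auto)
    then show False using ab unfolding ReA by simp
  qed
  then have sub: "F ` ?D \<subseteq> \<Omega>"
    using convex_interior_closure[OF \<Omega>(2)] interior_maximal[OF _ openF] interior_open[OF \<Omega>(1)] by metis
  have "F ` ?D = \<Omega>"
  proof -
    have "connected \<Omega>" by (rule convex_connected[OF \<Omega>(2)])
    moreover have "openin (top_of_set \<Omega>) (F ` ?D)" by (rule open_subset[OF sub openF])
    moreover have "closedin (top_of_set \<Omega>) (F ` ?D)"
      unfolding closedin_limpt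
    proof (intro conjI sub allI impI)
      fix w assume w: "w islimpt F ` ?D \<and> w \<in> \<Omega>"
      obtain r where r: "0 < r" "cball w r \<subseteq> \<Omega>" using \<Omega>(1) w open_contains_cball by blast
      define K where "K = ?D \<inter> F -` cball w r"
      have "compact (F ` K)" unfolding K_def using cpt[OF compact_cball r(2)]
        by (intro compact_continuous_image continuous_on_subset[OF contF]) auto
      then have "closed (F ` K)" by (rule compact_imp_closed)
      moreover have "w islimpt F ` K"
        unfolding islimpt_approachable
      proof (intro allI impI)
        fix e :: real assume "0 < e"
        have "\<exists>x\<in>F ` ?D. x \<noteq> w \<and> dist x w < min e r"
          by (rule w[THEN conjunct1, unfolded islimpt_approachable, rule_format])
            (use r(1) \<open>0 < e\<close> in simp)
        then obtain y where y: "y \<in> ?D" "F y \<noteq> w" "dist (F y) w < min e r" by blast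
        then have "F y \<in> F ` K" by (intro imageI) (simp add: K_def dist_commute)
        then show "\<exists>x\<in>F ` K. x \<noteq> w \<and> dist x w < e" using y by auto
      qed
      ultimately have "w \<in> F ` K" by (simp add: closed_limpt)
      then show "w \<in> F ` ?D" by (auto simp: K_def)
    qed
    ultimately show ?thesis unfolding connected_clopen by (metis centre_in_ball empty_iff image_eqI zero_less_one)
  qed
  then show "F ` ?D = \<Omega>" .
  have "covering_space ?D F \<Omega>"
    by (rule proper_local_homeomorphism_covering_space[OF open_ball contF \<open>F ` ?D = \<Omega>\<close> \<Omega>(1) loc cpt])
  then show "inj_on F ?D"
    by (rule covering_space_simply_connected_inj)
      (use \<Omega> in \<open>auto intro: convex_imp_simply_connected open_imp_locally_path_connected\<close>)
qed

subsection \<open>Transfer to the disc\<close>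

lemma eventually_at_0_within_uhp:
  "(\<forall>\<^sub>F w in at 0 within uhp. P w) \<longleftrightarrow> (\<exists>\<delta>>0. \<forall>w. 0 < Im w \<longrightarrow> norm w < \<delta> \<longrightarrow> P w)"
proof -
  have "w \<noteq> 0" if "0 < Im w" for w using that by auto
  then show ?thesis unfolding eventually_at by simp
qed

text \<open>The disc around \<open>w\<close> of radius \<open>Im w\<close> stays in the half plane,
  and for \<open>w\<close> close to 0 the real part is small on all of it, so the gradient estimate
  applies with that radius.\<close>

lemma Im_mult_deriv_tendsto_0:
  assumes B: "B holomorphic_on uhp" and lim: "((\<lambda>w. Re (B w)) \<longlongrightarrow> 0) (at 0 within uhp)"
  shows "((\<lambda>w. of_real (Im w) * deriv B w) \<longlongrightarrow> 0) (at 0 within uhp)"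
  unfolding tendsto_iff
proof (intro allI impI)
  fix e :: real assume e: "0 < e"
  \<comment> \<open>The gradient estimate then gives \<open>2 * exp 2 * d\<close>, which is
    \<open>e / 2\<close>.\<close>
  define d where "d = e / (4 * exp 2)"
  have d: "0 < d" using e by (simp add: d_def)
  obtain \<delta> where \<delta>: "0 < \<delta>" "\<And>w. w \<in> uhp \<Longrightarrow> norm w < \<delta> \<Longrightarrow> \<bar>Re (B w)\<bar> < d"
    using tendstoD[OF lim d] unfolding eventually_at_0_within_uhp by auto
  have "norm (of_real (Im w) * deriv B w) < e" if w: "w \<in> uhp" "norm w < \<delta> / 2" for w
  proof -
    have sub: "ball w (Im w) \<subseteq> uhp \<inter> ball 0 \<delta>"
    proof
      fix v assume "v \<in> ball w (Im w)"
      then have v: "norm (v - w) < Im w" by (simp add: dist_norm norm_minus_commute)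
      then have "\<bar>Im v - Im w\<bar> < Im w" using abs_Im_le_cmod[of "v - w"] by simp
      moreover have "norm v \<le> norm w + norm (v - w)" using norm_triangle_ineq[of w "v - w"] by simp
      then have "norm v < \<delta>" using v abs_Im_le_cmod[of w] w by simp
      ultimately show "v \<in> uhp \<inter> ball 0 \<delta>" by auto
    qed
    have "norm (deriv B w) \<le> 2 * exp 2 * d / Im w"
    proof (rule deriv_bound_Re[OF _ _ d])
      show "B holomorphic_on ball w (Im w)" by (rule holomorphic_on_subset[OF B]) (use sub in blast)
      show "0 < Im w" using w by simp
      show "\<bar>Re (B v)\<bar> \<le> d" if "v \<in> ball w (Im w)" for v
        using \<delta>(2)[of v] sub that by fastforce
    qed
    then have "Im w * norm (deriv B w) \<le> 2 * exp 2 * d" using w by (simp add: field_simps)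
    also have "\<dots> < e" using e by (simp add: d_def)
    finally show ?thesis using w by (simp add: norm_mult)
  qed
  then show "\<forall>\<^sub>F w in at 0 within uhp. dist (of_real (Im w) * deriv B w) 0 < e"
    using \<delta>(1) unfolding eventually_at_0_within_uhp by (intro exI[of _ "\<delta>/2"]) auto
qed

text \<open>The real parts of the two unimodal functions are the real and the imaginary part of
  \<open>h + cnj k\<close>. The combination \<open>B1 + \<i> * B2\<close> eliminates
  \<open>k\<close>, which dictates the form of \<open>D\<close>; since \<open>d1\<close> and
  \<open>d2\<close> are real, \<open>D\<close> vanishes exactly if neither component jumps.\<close>

lemma unimodal_pair_asymptotics:
  assumes h: "h holomorphic_on uhp" and k: "k holomorphic_on uhp"
    and uni: "unimodal_on_uhp (\<lambda>w. h w + k w)" "unimodal_on_uhp (\<lambda>w. - \<i> * (h w - k w))"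
  obtains D p where "D = 0 \<longrightarrow> ((\<lambda>w. h w + cnj (k w)) \<longlongrightarrow> p) (at 0 within uhp)"
    "((\<lambda>w. of_real (Im w) * (deriv h w - D / w)) \<longlongrightarrow> 0) (at 0 within uhp)"
proof -
  obtain R1 d1 where 1:
    "((\<lambda>w. Re (h w + k w - (of_real R1 - \<i> * of_real d1 * Ln w))) \<longlongrightarrow> 0) (at 0 within uhp)"
    by (rule unimodal_asymptotics[OF uni(1)])
  obtain R2 d2 where 2:
    "((\<lambda>w. Re (- \<i> * (h w - k w) - (of_real R2 - \<i> * of_real d2 * Ln w))) \<longlongrightarrow> 0) (at 0 within uhp)"
    by (rule unimodal_asymptotics[OF uni(2)])
  define B1 where "B1 = (\<lambda>w. h w + k w - (of_real R1 - \<i> * of_real d1 * Ln w))"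
  define B2 where "B2 = (\<lambda>w. - \<i> * (h w - k w) - (of_real R2 - \<i> * of_real d2 * Ln w))"
  define D :: complex where "D = (of_real d2 - \<i> * of_real d1) / 2"
  have nonpos: "w \<notin> \<real>\<^sub>\<le>\<^sub>0" if "w \<in> uhp" for w
    using that by (auto simp: complex_nonpos_Reals_iff)
  have hol: "B1 holomorphic_on uhp" "B2 holomorphic_on uhp"
    unfolding B1_def B2_def using nonpos by (auto intro!: holomorphic_intros h k)
  show thesis
  proof
    show "D = 0 \<longrightarrow> ((\<lambda>w. h w + cnj (k w)) \<longlongrightarrow> of_real R1 + \<i> * of_real R2) (at 0 within uhp)"
    proof
      assume "D = 0"
      then have "d1 = 0" "d2 = 0" by (auto simp: D_def complex_eq_iff)
      then have "((\<lambda>w. of_real (Re (B1 w)) + \<i> * of_real (Re (B2 w)) + (of_real R1 + \<i> * of_real R2))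
          \<longlongrightarrow> of_real 0 + \<i> * of_real 0 + (of_real R1 + \<i> * of_real R2)) (at 0 within uhp)"
        using 1 2 unfolding B1_def B2_def by (intro tendsto_intros) auto
      moreover have "of_real (Re (B1 w)) + \<i> * of_real (Re (B2 w)) + (of_real R1 + \<i> * of_real R2) = h w + cnj (k w)" for w
        using \<open>d1 = 0\<close> \<open>d2 = 0\<close> by (simp add: B1_def B2_def complex_eq_iff)
      ultimately show "((\<lambda>w. h w + cnj (k w)) \<longlongrightarrow> of_real R1 + \<i> * of_real R2) (at 0 within uhp)"
        by simp
    qed
  next
    have "((\<lambda>w. of_real (Im w) * deriv B1 w) \<longlongrightarrow> 0) (at 0 within uhp)"
      "((\<lambda>w. of_real (Im w) * deriv B2 w) \<longlongrightarrow> 0) (at 0 within uhp)"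
      using Im_mult_deriv_tendsto_0 hol 1 2 unfolding B1_def B2_def by blast+
    then have "((\<lambda>w. (of_real (Im w) * deriv B1 w + \<i> * (of_real (Im w) * deriv B2 w)) / 2) \<longlongrightarrow> (0 + \<i> * 0) / 2)
        (at 0 within uhp)" by (intro tendsto_intros) auto
    moreover have "\<forall>\<^sub>F w in at 0 within uhp. (of_real (Im w) * deriv B1 w + \<i> * (of_real (Im w) * deriv B2 w)) / 2
        = of_real (Im w) * (deriv h w - D / w)"
    proof -
      have "(of_real (Im w) * deriv B1 w + \<i> * (of_real (Im w) * deriv B2 w)) / 2
        = of_real (Im w) * (deriv h w - D / w)" if w: "w \<in> uhp" for w
      proof -
        have hk: "(h has_field_derivative deriv h w) (at w)" "(k has_field_derivative deriv k w) (at w)"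
          using h k w open_uhp by (auto intro: holomorphic_derivI)
        have "(B1 has_field_derivative deriv h w + deriv k w + \<i> * of_real d1 / w) (at w)"
          unfolding B1_def using nonpos[OF w] by (auto intro!: derivative_eq_intros hk simp: field_simps)
        moreover have "(B2 has_field_derivative - \<i> * (deriv h w - deriv k w) + \<i> * of_real d2 / w) (at w)"
          unfolding B2_def using nonpos[OF w] by (auto intro!: derivative_eq_intros hk simp: field_simps)
        ultimately have dB: "deriv B1 w = deriv h w + deriv k w + \<i> * of_real d1 / w"
          "deriv B2 w = - \<i> * (deriv h w - deriv k w) + \<i> * of_real d2 / w"
          by (simp_all only: DERIV_imp_deriv)
        have "w \<noteq> 0" using w by auto
        then show ?thesis unfolding dB by (simp add: D_def field_simps)
      qed
      then show ?thesis by (auto simp: eventually_at_topological intro!: exI[of _ UNIV])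
    qed
    ultimately show "((\<lambda>w. of_real (Im w) * (deriv h w - D / w)) \<longlongrightarrow> 0) (at 0 within uhp)"
      using Lim_transform_eventually by fastforce
  qed
qed

section \<open>The Cayley transform between the half plane and the disc, with 0 corresponding to the
  boundary point\<close>

definition cayley :: "complex \<Rightarrow> complex \<Rightarrow> complex" where
  "cayley \<zeta> w = \<zeta> * (\<i> - w) / (\<i> + w)"

definition cayley_inv :: "complex \<Rightarrow> complex \<Rightarrow> complex" where
  "cayley_inv \<zeta> z = \<i> * (\<zeta> - z) / (\<zeta> + z)"

lemma i_plus_uhp_neq_0: "w \<in> uhp \<Longrightarrow> \<i> + w \<noteq> 0"
  by (auto simp: complex_eq_iff)

lemma plus_ball_neq_0: "norm \<zeta> = 1 \<Longrightarrow> z \<in> ball 0 1 \<Longrightarrow> \<zeta> + z \<noteq> 0"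
  by (auto simp: add_eq_0_iff norm_minus_cancel)

lemma cayley_in_ball:
  assumes "norm \<zeta> = 1" "w \<in> uhp" shows "cayley \<zeta> w \<in> ball 0 1"
proof -
  have "(norm (\<i> - w))\<^sup>2 < (norm (\<i> + w))\<^sup>2"
    unfolding cmod_power2 using assms(2) by (simp add: power2_eq_square algebra_simps)
  then have "norm (\<i> - w) < norm (\<i> + w)" by (rule power2_less_imp_less) simp
  moreover have "0 < norm (\<i> + w)" using i_plus_uhp_neq_0[OF assms(2)] by simp
  ultimately show ?thesis using assms(1)
    by (simp add: cayley_def norm_mult norm_divide)
qed

text \<open>This relates \<open>1 - norm z\<close> to the height of the transformed point, and so
  turns nontangential approach in the disc into nontangential approach in the half plane.\<close>

lemma Im_cayley_inv:
  assumes "norm \<zeta> = 1"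
  shows "Im (cayley_inv \<zeta> z) = (1 - (norm z)\<^sup>2) / (norm (\<zeta> + z))\<^sup>2"
proof -
  have "(Re \<zeta>)\<^sup>2 + (Im \<zeta>)\<^sup>2 = 1" using assms cmod_power2[of \<zeta>] by simp
  then have "Re (\<i> * (\<zeta> - z)) = Im z - Im \<zeta>" "Im (\<i> * (\<zeta> - z)) = Re \<zeta> - Re z"
    "(Re \<zeta> - Re z) * (Re \<zeta> + Re z) - (Im z - Im \<zeta>) * (Im \<zeta> + Im z) = 1 - (norm z)\<^sup>2"
    unfolding cmod_power2 by (simp_all add: power2_eq_square algebra_simps)
  then show ?thesis by (simp add: cayley_inv_def Im_divide cmod_power2)
qed

lemma cayley_inv_in_uhp:
  assumes "norm \<zeta> = 1" "z \<in> ball 0 1" shows "cayley_inv \<zeta> z \<in> uhp"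
proof -
  have "(norm z)\<^sup>2 < 1" using assms(2) by (simp add: power_less_one_iff)
  then show ?thesis using Im_cayley_inv[OF assms(1), of z] plus_ball_neq_0[OF assms] by simp
qed

lemma cayley_inv_cayley:
  assumes "norm \<zeta> = 1" "w \<in> uhp" shows "cayley_inv \<zeta> (cayley \<zeta> w) = w"
proof -
  have "\<zeta> - cayley \<zeta> w = 2 * \<zeta> * w / (\<i> + w)" "\<zeta> + cayley \<zeta> w = 2 * \<zeta> * \<i> / (\<i> + w)"
    using i_plus_uhp_neq_0[OF assms(2)] by (simp_all add: cayley_def field_simps)
  moreover have "\<zeta> \<noteq> 0" using assms by auto
  ultimately show ?thesis using i_plus_uhp_neq_0[OF assms(2)] by (simp add: cayley_inv_def)
qed

lemma cayley_cayley_inv: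
  assumes "norm \<zeta> = 1" "z \<in> ball 0 1" shows "cayley \<zeta> (cayley_inv \<zeta> z) = z"
proof -
  have "\<i> - cayley_inv \<zeta> z = 2 * \<i> * z / (\<zeta> + z)" "\<i> + cayley_inv \<zeta> z = 2 * \<i> * \<zeta> / (\<zeta> + z)"
    using plus_ball_neq_0[OF assms] by (simp_all add: cayley_inv_def field_simps)
  moreover have "\<zeta> \<noteq> 0" using assms by auto
  ultimately show ?thesis using plus_ball_neq_0[OF assms] by (simp add: cayley_def)
qed

text \<open>Under \<open>\<psi>\<close> the level regions are continuous images of intersections of
  \<open>\<Omega>\<close> with half planes, which are convex.\<close>

lemma unimodal_of_homeomorphism:
  fixes \<Phi> :: "complex \<Rightarrow> complex"
  assumes A: "A holomorphic_on uhp" and \<Omega>: "convex \<Omega>" "bounded \<Omega>"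
    and hom: "homeomorphism uhp \<Omega> \<Phi> \<psi>" and Re: "\<And>w. w \<in> uhp \<Longrightarrow> Re (A w) = inner a (\<Phi> w)"
  shows "unimodal_on_uhp A"
proof -
  have \<Phi>: "\<Phi> ` uhp = \<Omega>" "\<psi> ` \<Omega> = uhp" "continuous_on \<Omega> \<psi>" "\<And>x. x \<in> \<Omega> \<Longrightarrow> \<Phi> (\<psi> x) = x"
    "\<And>w. w \<in> uhp \<Longrightarrow> \<psi> (\<Phi> w) = w"
    using hom by (auto simp: homeomorphism_def)
  have "Re ` A ` uhp = (\<lambda>x. inner a x) ` \<Omega>"
    unfolding \<Phi>(1)[symmetric] image_image by (intro image_cong refl Re)
  then have bdd: "bounded (Re ` A ` uhp)"
    using bounded_linear_image[OF \<Omega>(2) bounded_linear_inner_right] by simp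
  have eq: "{w \<in> uhp. P (Re (A w))} = \<psi> ` {x \<in> \<Omega>. P (inner a x)}" for P
  proof
    show "{w \<in> uhp. P (Re (A w))} \<subseteq> \<psi> ` {x \<in> \<Omega>. P (inner a x)}"
    proof
      fix w assume "w \<in> {w \<in> uhp. P (Re (A w))}"
      then have w: "w \<in> uhp" "P (inner a (\<Phi> w))" using Re by auto
      then have "\<Phi> w \<in> {x \<in> \<Omega>. P (inner a x)}" using \<Phi>(1) by blast
      then show "w \<in> \<psi> ` {x \<in> \<Omega>. P (inner a x)}" using \<Phi>(5)[OF w(1)] by (metis imageI)
    qed
    show "\<psi> ` {x \<in> \<Omega>. P (inner a x)} \<subseteq> {w \<in> uhp. P (Re (A w))}"
    proof
      fix w assume "w \<in> \<psi> ` {x \<in> \<Omega>. P (inner a x)}"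
      then obtain x where x: "x \<in> \<Omega>" "P (inner a x)" "w = \<psi> x" by blast
      then have "w \<in> uhp" using \<Phi>(2) by blast
      then show "w \<in> {w \<in> uhp. P (Re (A w))}" using x \<Phi>(4)[OF x(1)] Re[of w] by simp
    qed
  qed
  have conn: "connected {w \<in> uhp. P (Re (A w))}" if "convex {x. P (inner a x)}" for P
    unfolding eq
  proof (rule connected_continuous_image)
    show "continuous_on {x \<in> \<Omega>. P (inner a x)} \<psi>" by (rule continuous_on_subset[OF \<Phi>(3)]) auto
    have "convex (\<Omega> \<inter> {x. P (inner a x)})" by (rule convex_Int[OF \<Omega>(1) that])
    then show "connected {x \<in> \<Omega>. P (inner a x)}" by (simp add: convex_connected Int_def)
  qed
  show ?thesis
    unfolding unimodal_on_uhp_def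
    using A bdd conn[of "\<lambda>r. c < r" for c] conn[of "\<lambda>r. r < c" for c]
      convex_halfspace_gt[of _ a] convex_halfspace_lt[of a] by auto
qed

text \<open>The alternatives are \<open>D = 0\<close> and \<open>D \<noteq> 0\<close> for the jump
  coefficient in the half plane. In the second case \<open>deriv h w\<close> differs from
  \<open>D / w\<close> by \<open>o(1 / Im w)\<close>, which close to 0 is at most half of
  \<open>norm (D / w)\<close> as long as \<open>Im w\<close> is at least a fixed multiple of
  \<open>norm w\<close>. Only \<open>\<delta>\<close> depends on that multiple, not
  \<open>C\<close>.\<close>

lemma univalent_harmonic_boundary_dichotomy:
  fixes H G :: "complex \<Rightarrow> complex"
  defines "F \<equiv> \<lambda>z. H z + cnj (G z)"
  assumes \<zeta>: "norm \<zeta> = 1" and \<Omega>: "convex \<Omega>" "bounded \<Omega>"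
    and H: "H holomorphic_on ball 0 1" and G: "G holomorphic_on ball 0 1"
    and F: "inj_on F (ball 0 1)" "F ` ball 0 1 = \<Omega>"
  obtains p where "(F \<longlongrightarrow> p) (at \<zeta> within ball 0 1)"
  | C where "0 < C" "\<And>\<kappa>. 0 < \<kappa> \<Longrightarrow> \<exists>\<delta>>0. \<forall>z. norm z < 1 \<longrightarrow> norm (\<zeta> - z) < \<delta> \<longrightarrow> \<kappa> * norm (\<zeta> - z) \<le> 1 - norm z
      \<longrightarrow> C \<le> norm (\<zeta> - z) * norm (deriv H z)"
proof -
  let ?c = "cayley \<zeta>" and ?ci = "cayley_inv \<zeta>"
  have holc: "?c holomorphic_on uhp"
    using i_plus_uhp_neq_0 unfolding cayley_def by (intro holomorphic_intros) auto
  have holci: "?ci holomorphic_on ball 0 1"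
    using plus_ball_neq_0[OF \<zeta>] unfolding cayley_inv_def by (intro holomorphic_intros) auto
  have cB: "?c ` uhp \<subseteq> ball 0 1" using cayley_in_ball[OF \<zeta>] by blast
  define h where "h = (\<lambda>w. H (?c w))"
  define k where "k = (\<lambda>w. G (?c w))"
  have hk: "h holomorphic_on uhp" "k holomorphic_on uhp"
    unfolding h_def k_def
    by (rule holomorphic_on_compose_gen[OF holc H cB, unfolded o_def]
        holomorphic_on_compose_gen[OF holc G cB, unfolded o_def])+
  have contF: "continuous_on (ball 0 1) F"
    unfolding F_def by (intro continuous_intros holomorphic_on_imp_continuous_on H G)
  obtain g where g: "homeomorphism (ball 0 1) \<Omega> F g"
    using invariance_of_domain_homeomorphism[OF open_ball contF _ F(1)] F(2) by auto
  have "homeomorphism uhp (ball 0 1) ?c ?ci"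
    by (rule homeomorphismI) (use holc holci cayley_in_ball[OF \<zeta>] cayley_inv_in_uhp[OF \<zeta>]
        cayley_inv_cayley[OF \<zeta>] cayley_cayley_inv[OF \<zeta>] in \<open>auto intro: holomorphic_on_imp_continuous_on\<close>)
  from homeomorphism_compose[OF this g]
  have hom: "homeomorphism uhp \<Omega> (F \<circ> ?c) (?ci \<circ> g)" .
  \<comment> \<open>The directions \<open>1\<close> here and \<open>\<i>\<close> below single out
    the real and the imaginary part of \<open>F\<close>.\<close>
  have uni1: "unimodal_on_uhp (\<lambda>w. h w + k w)"
    by (rule unimodal_of_homeomorphism[OF _ \<Omega> hom, where a = 1], intro holomorphic_intros hk)
      (simp add: F_def h_def k_def inner_complex_def)
  have uni2: "unimodal_on_uhp (\<lambda>w. - \<i> * (h w - k w))"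
    by (rule unimodal_of_homeomorphism[OF _ \<Omega> hom, where a = \<i>], intro holomorphic_intros hk)
      (simp add: F_def h_def k_def inner_complex_def)
  obtain p D where pD: "D = 0 \<longrightarrow> ((\<lambda>w. h w + cnj (k w)) \<longlongrightarrow> p) (at 0 within uhp)"
    "((\<lambda>w. of_real (Im w) * (deriv h w - D / w)) \<longlongrightarrow> 0) (at 0 within uhp)"
    by (rule unimodal_pair_asymptotics[OF hk uni1 uni2])
  show thesis
  proof (cases "D = 0")
    case True
    have "filterlim ?ci (at 0 within uhp) (at \<zeta> within ball 0 1)"
      unfolding filterlim_at
    proof
      show "(?ci \<longlongrightarrow> 0) (at \<zeta> within ball 0 1)"
        unfolding cayley_inv_def using \<zeta> by (auto intro!: tendsto_eq_intros)
      have "?ci z \<in> uhp \<and> ?ci z \<noteq> 0" if "z \<in> ball 0 1" for z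
        using cayley_inv_in_uhp[OF \<zeta> that] by auto
      then show "\<forall>\<^sub>F z in at \<zeta> within ball 0 1. ?ci z \<in> uhp \<and> ?ci z \<noteq> 0"
        by (auto simp: eventually_at_topological intro!: exI[of _ UNIV])
    qed
    from filterlim_compose[OF pD(1)[THEN mp, OF True] this]
    have "((\<lambda>z. h (?ci z) + cnj (k (?ci z))) \<longlongrightarrow> p) (at \<zeta> within ball 0 1)" .
    moreover have "\<forall>\<^sub>F z in at \<zeta> within ball 0 1. h (?ci z) + cnj (k (?ci z)) = F z"
      using cayley_cayley_inv[OF \<zeta>]
      by (auto simp: eventually_at_topological h_def k_def F_def intro!: exI[of _ UNIV])
    ultimately have "(F \<longlongrightarrow> p) (at \<zeta> within ball 0 1)" by (rule Lim_transform_eventually)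
    then show thesis by (rule that(1))
  next
    case False
    show thesis
    proof (rule that(2))
      \<comment> \<open>One factor 2 is lost to the error term, the other to the derivative of the
        Cayley map.\<close>
      show "0 < norm D / 4" using False by simp
      fix \<kappa> :: real assume \<kappa>: "0 < \<kappa>"
      \<comment> \<open>Nontangential approach will give
        \<open>Im w >= \<kappa> * norm w / 4\<close>, and then \<open>e / Im w\<close> is at most
        half of \<open>norm (D / w)\<close>.\<close>
      define e where "e = \<kappa> * norm D / 8"
      have e: "0 < e" using \<kappa> False by (simp add: e_def)
      obtain \<delta> where \<delta>: "0 < \<delta>"
        "\<And>w. w \<in> uhp \<Longrightarrow> norm w < \<delta> \<Longrightarrow> norm (of_real (Im w) * (deriv h w - D / w)) < e"
        using tendstoD[OF pD(2) e] unfolding eventually_at_0_within_uhp by auto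
      have "norm D / 4 \<le> norm (\<zeta> - z) * norm (deriv H z)"
        if z: "norm z < 1" "norm (\<zeta> - z) < min \<delta> 1" "\<kappa> * norm (\<zeta> - z) \<le> 1 - norm z" for z
      proof -
        have zB: "z \<in> ball 0 1" using z by simp
        define w where "w = ?ci z"
        have w: "w \<in> uhp" "?c w = z"
          using cayley_inv_in_uhp[OF \<zeta> zB] cayley_cayley_inv[OF \<zeta> zB] by (auto simp: w_def)
        have "2 * norm \<zeta> = norm ((\<zeta> + z) + (\<zeta> - z))" by (simp add: norm_mult)
        then have "2 * norm \<zeta> \<le> norm (\<zeta> + z) + norm (\<zeta> - z)" by (simp only: norm_triangle_ineq)
        then have n1: "1 \<le> norm (\<zeta> + z)" using z \<zeta> by simp
        have n2: "norm (\<zeta> + z) \<le> 2" using norm_triangle_ineq[of \<zeta> z] z \<zeta> by simp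
        have nw: "norm w = norm (\<zeta> - z) / norm (\<zeta> + z)"
          by (simp add: w_def cayley_inv_def norm_mult norm_divide)
        then have nwle: "norm w \<le> norm (\<zeta> - z)" using n1 by (simp add: divide_le_eq mult_le_cancel_left1)
        have w0: "0 < norm w" using w(1) by auto
        have "\<kappa> * norm w \<le> 1 - norm z"
          using order_trans[OF mult_left_mono[OF nwle less_imp_le[OF \<kappa>]] z(3)] .
        also have "\<dots> \<le> 1 - (norm z)\<^sup>2" using z(1) by (simp add: power2_eq_square mult_left_le)
        also have "\<dots> = Im w * (norm (\<zeta> + z))\<^sup>2"
          using Im_cayley_inv[OF \<zeta>, of z] plus_ball_neq_0[OF \<zeta> zB] by (simp add: w_def)
        also have "\<dots> \<le> Im w * 4"
          using power_mono[OF n2, of 2] w(1) by (intro mult_left_mono) auto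
        finally have Imw: "\<kappa> * norm w \<le> 4 * Im w" by simp
        have hw: "deriv h w = deriv H z * deriv ?c w"
          unfolding h_def using deriv_chain[of ?c w H] holomorphic_on_imp_differentiable_at[OF holc open_uhp w(1)]
            holomorphic_on_imp_differentiable_at[OF H open_ball zB] w(2) by (simp add: o_def)
        have "(?c has_field_derivative - 2 * \<i> * \<zeta> / (\<i> + w)\<^sup>2) (at w)"
          unfolding cayley_def using i_plus_uhp_neq_0[OF w(1)]
          by (auto intro!: derivative_eq_intros simp: field_simps power2_eq_square)
        then have "norm (deriv ?c w) = 2 / (norm (\<i> + w))\<^sup>2"
          using \<zeta> by (simp add: DERIV_imp_deriv norm_mult norm_divide norm_power)
        moreover have "1 \<le> norm (\<i> + w)" using abs_Im_le_cmod[of "\<i> + w"] w(1) by simp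
        then have "1 \<le> (norm (\<i> + w))\<^sup>2" by (rule one_le_power)
        ultimately have c2: "norm (deriv ?c w) \<le> 2" by (simp add: divide_le_eq)
        have "Im w * norm (deriv h w - D / w) < e"
          using \<delta>(2)[OF w(1)] nwle z(2) w(1) by (simp add: norm_mult)
        then have "norm (deriv h w - D / w) < e / Im w" using w(1) by (simp add: field_simps)
        also have "\<dots> \<le> e / (\<kappa> * norm w / 4)"
          using Imw \<kappa> w0 e w(1) by (intro divide_left_mono) auto
        also have "\<dots> = norm D / (2 * norm w)" using \<kappa> w0 by (simp add: e_def field_simps)
        finally have "norm (deriv h w - D / w) \<le> norm D / (2 * norm w)" by simp
        moreover have "norm (D / w) \<le> norm (deriv h w) + norm (deriv h w - D / w)"
          using norm_triangle_ineq4[of "deriv h w" "deriv h w - D / w"] by simp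
        ultimately have "norm D / norm w \<le> norm (deriv h w) + norm D / (2 * norm w)"
          by (simp add: norm_divide)
        then have "norm D / (2 * norm w) \<le> norm (deriv h w)" by (simp add: field_simps)
        also have "\<dots> \<le> norm (deriv H z) * 2"
          unfolding hw norm_mult using c2 by (intro mult_left_mono) auto
        finally have "norm D / 4 \<le> norm w * norm (deriv H z)" using w0 by (simp add: field_simps)
        also have "\<dots> \<le> norm (\<zeta> - z) * norm (deriv H z)" by (intro mult_right_mono nwle) auto
        finally show ?thesis .
      qed
      then show "\<exists>\<delta>>0. \<forall>z. norm z < 1 \<longrightarrow> norm (\<zeta> - z) < \<delta> \<longrightarrow> \<kappa> * norm (\<zeta> - z) \<le> 1 - norm z
          \<longrightarrow> norm D / 4 \<le> norm (\<zeta> - z) * norm (deriv H z)"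
        using \<delta>(1) by (intro exI[of _ "min \<delta> 1"]) auto
    qed
  qed
qed

subsection \<open>Area and curves\<close>

text \<open>The Jacobian formula is applied on \<open>real^2\<close> and Tonelli's theorem on
  \<open>real \<times> real\<close>; this identifies the two area measures.\<close>

lemma lborel_prod_eq_distr_vec2:
  "(lborel :: (real \<times> real) measure) = distr (lborel :: (real^2) measure) borel (\<lambda>v. (v $ 1, v $ 2))"
proof (rule lborel_eqI)
  have meas: "(\<lambda>v::real^2. (v $ 1, v $ 2)) \<in> borel_measurable borel"
    by (intro borel_measurable_continuous_onI continuous_intros)
  fix l u :: "real \<times> real" assume lu: "\<And>b. b \<in> Basis \<Longrightarrow> l \<bullet> b \<le> u \<bullet> b"
  have bp: "(1, 0) \<in> (Basis :: (real \<times> real) set)" "(0, 1) \<in> (Basis :: (real \<times> real) set)"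
    by (auto simp: Basis_prod_def)
  have le: "fst l \<le> fst u" "snd l \<le> snd u"
    using lu[OF bp(1)] lu[OF bp(2)] by (auto simp: inner_prod_def)
  define l' u' :: "real^2" where "l' = vector [fst l, snd l]" and "u' = vector [fst u, snd u]"
  have pre: "(\<lambda>v::real^2. (v $ 1, v $ 2)) -` box l u = box l' u'"
    by (auto simp: l'_def u'_def mem_box_cart forall_2 vector_2 mem_box Basis_prod_def inner_prod_def)
  have B2: "Basis = {axis 1 1 :: real^2, axis 2 1}"
    by (auto simp: Basis_vec_def UNIV_2)
  have ne: "axis 1 1 \<noteq> (axis 2 1 :: real^2)" by (simp add: axis_eq_axis)
  have "emeasure (distr (lborel :: (real^2) measure) borel (\<lambda>v. (v $ 1, v $ 2))) (box l u)
      = emeasure lborel (box l' u')"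
    using meas by (simp add: emeasure_distr pre)
  also have "\<dots> = ennreal (\<Prod>b\<in>Basis. (u' - l') \<bullet> b)"
    by (rule emeasure_lborel_box) (auto simp: B2 inner_axis l'_def u'_def vector_2 le)
  also have "(\<Prod>b\<in>Basis. (u' - l') \<bullet> b) = (fst u - fst l) * (snd u - snd l)"
    using ne by (simp add: B2 inner_axis l'_def u'_def vector_2)
  also have "\<dots> = (\<Prod>b\<in>Basis. (u - l) \<bullet> b)"
    by (simp add: Basis_prod_def inner_prod_def)
  finally show "emeasure (distr (lborel :: (real^2) measure) borel (\<lambda>v. (v $ 1, v $ 2))) (box l u)
      = ennreal (\<Prod>b\<in>Basis. (u - l) \<bullet> b)" .
qed simp

text \<open>After both planes are identified with \<open>real^2\<close> by \<open>e\<close> and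
  \<open>q\<close>, the integral is the area of an injective image, which is open and bounded.
  Continuity of \<open>w\<close> makes the integrand Borel, so that the integral can be moved to the
  product.\<close>

lemma nn_integral_jacobian_finite:
  fixes \<Psi> :: "real \<times> real \<Rightarrow> complex"
  assumes S: "open S" and inj: "inj_on \<Psi> S" and bdd: "bounded (\<Psi> ` S)"
    and der: "\<And>p. p \<in> S \<Longrightarrow> (\<Psi> has_derivative \<Psi>' p) (at p)"
    and w: "continuous_on S w" "\<And>p. p \<in> S \<Longrightarrow> w p =
      \<bar>Re (\<Psi>' p (1, 0)) * Im (\<Psi>' p (0, 1)) - Re (\<Psi>' p (0, 1)) * Im (\<Psi>' p (1, 0))\<bar>"
  shows "(\<integral>\<^sup>+p. ennreal (indicator S p * w p) \<partial>lborel) < \<infinity>"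
proof -
  define e :: "real^2 \<Rightarrow> real \<times> real" where "e = (\<lambda>v. (v $ 1, v $ 2))"
  define q :: "complex \<Rightarrow> real^2" where "q = (\<lambda>z. Re z *\<^sub>R axis 1 1 + Im z *\<^sub>R axis 2 1)"
  have q12: "q z $ 1 = Re z" "q z $ 2 = Im z" for z by (simp_all add: q_def axis_def)
  have bl_e: "bounded_linear e" unfolding e_def
    by (intro bounded_linear_Pair bounded_linear_vec_nth)
  have bl_q: "bounded_linear q" unfolding q_def
    by (intro bounded_linear_add bounded_linear_scaleR_left[THEN bounded_linear_compose]
        bounded_linear_Re bounded_linear_Im)
  have inj_e: "e x = e y \<Longrightarrow> x = y" for x y by (simp add: e_def vec_eq_iff forall_2)
  have inj_q: "q x = q y \<Longrightarrow> x = y" for x y by (metis q12 complex_eqI)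
  define R where "R = e -` S"
  define T where "T = (\<lambda>v. q (\<Psi> (e v)))"
  define T' where "T' = (\<lambda>v h. q (\<Psi>' (e v) (e h)))"
  have oR: "open R" unfolding R_def
    by (rule open_vimage[OF S]) (use bl_e in \<open>simp add: linear_continuous_on\<close>)
  have derT: "(T has_derivative T' v) (at v)" if v: "v \<in> R" for v
  proof -
    have "(e has_derivative e) (at v)" by (rule bounded_linear_imp_has_derivative[OF bl_e])
    moreover have "(\<Psi> has_derivative \<Psi>' (e v)) (at (e v))" using v by (intro der) (simp add: R_def)
    ultimately have "((\<lambda>v. \<Psi> (e v)) has_derivative (\<lambda>h. \<Psi>' (e v) (e h))) (at v)"
      by (rule has_derivative_compose)
    from bounded_linear.has_derivative[OF bl_q this] show ?thesis unfolding T_def T'_def .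
  qed
  have injT: "inj_on T R"
    using inj inj_e inj_q unfolding inj_on_def T_def R_def by blast
  have "continuous_on R T"
    using derT by (auto intro!: continuous_at_imp_continuous_on has_derivative_continuous)
  then have "open (T ` R)" by (rule invariance_of_domain[OF _ oR injT])
  moreover have "bounded (T ` R)"
  proof (rule bounded_subset)
    show "bounded (q ` \<Psi> ` S)" by (rule bounded_linear_image[OF bdd bl_q])
    show "T ` R \<subseteq> q ` \<Psi> ` S" by (auto simp: T_def R_def)
  qed
  ultimately have "T ` R \<in> lmeasurable" by (intro lmeasurable_open)
  then have int: "(\<lambda>x. \<bar>det (matrix (T' x))\<bar>) integrable_on R"
    by (subst measurable_differentiable_image_eq[symmetric])
      (use oR derT injT in \<open>auto intro: has_derivative_at_withinI\<close>)
  have det: "\<bar>det (matrix (T' v))\<bar> = w (e v)" if v: "v \<in> R" for v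
  proof -
    have "e (axis 1 1) = (1, 0)" "e (axis 2 1) = (0, 1)" by (simp_all add: e_def axis_def)
    then have "det (matrix (T' v)) = Re (\<Psi>' (e v) (1, 0)) * Im (\<Psi>' (e v) (0, 1))
        - Re (\<Psi>' (e v) (0, 1)) * Im (\<Psi>' (e v) (1, 0))"
      by (simp add: det_2 matrix_def T'_def q12)
    then show ?thesis using w(2)[of "e v"] v by (simp add: R_def)
  qed
  have "(\<lambda>v. w (e v)) integrable_on R" by (rule integrable_eq[OF int]) (use det in auto)
  then have "(\<lambda>v. w (e v)) absolutely_integrable_on R"
    by (rule nonnegative_absolutely_integrable_1) (use det in \<open>metis abs_ge_zero\<close>)
  then have "(\<integral>\<^sup>+v. ennreal (norm (indicator R v *\<^sub>R w (e v))) \<partial>lebesgue) < \<infinity>"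
    unfolding set_integrable_def integrable_iff_bounded by blast
  moreover have "ennreal (norm (indicator R v *\<^sub>R w (e v))) = ennreal (indicator S (e v) * w (e v))" for v
    using det[of v] by (auto simp: R_def indicator_def)
  ultimately have "(\<integral>\<^sup>+v. ennreal (indicator S (e v) * w (e v)) \<partial>lborel) < \<infinity>"
    by (simp add: nn_integral_completion)
  moreover have "(\<lambda>p. indicator S p *\<^sub>R w p) \<in> borel_measurable borel"
    by (rule borel_measurable_continuous_on_indicator) (use S w in auto)
  then have "(\<lambda>p. ennreal (indicator S p * w p)) \<in> borel_measurable borel" by simp
  moreover have "e \<in> borel_measurable borel"
    using bl_e by (intro borel_measurable_continuous_onI linear_continuous_on)
  ultimately show ?thesis
    unfolding lborel_prod_eq_distr_vec2 e_def[symmetric] by (subst nn_integral_distr) auto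
qed

text \<open>By Tonelli the inner integral is finite for almost every \<open>m\<close>, and a
  nonempty open interval is not a null set.\<close>

lemma nn_integral_slice_finite:
  fixes g :: "real \<times> real \<Rightarrow> ennreal"
  assumes g: "g \<in> borel_measurable borel" "(\<integral>\<^sup>+p. g p \<partial>lborel) < \<infinity>" and ab: "a < b"
  obtains m where "a < m" "m < b" "(\<integral>\<^sup>+t. g (m, t) \<partial>lborel) < \<infinity>"
proof -
  have g': "g \<in> borel_measurable (lborel \<Otimes>\<^sub>M lborel)" unfolding lborel_prod using g by simp
  have "(\<integral>\<^sup>+m. (\<integral>\<^sup>+t. g (m, t) \<partial>lborel) \<partial>lborel) = (\<integral>\<^sup>+p. g p \<partial>(lborel \<Otimes>\<^sub>M lborel))"
    by (rule lborel.nn_integral_fst[OF g'])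
  also have "\<dots> < \<infinity>" unfolding lborel_prod by (rule g)
  finally have fin: "(\<integral>\<^sup>+m. (\<integral>\<^sup>+t. g (m, t) \<partial>lborel) \<partial>lborel) \<noteq> \<infinity>" by simp
  have "(\<lambda>m. \<integral>\<^sup>+t. g (m, t) \<partial>lborel) \<in> borel_measurable lborel"
    by (rule lborel.borel_measurable_nn_integral_fst[OF g'])
  from nn_integral_PInf_AE[OF this fin]
  have ae: "AE m in lborel. (\<integral>\<^sup>+t. g (m, t) \<partial>lborel) \<noteq> \<infinity>" .
  have "\<exists>m. a < m \<and> m < b \<and> (\<integral>\<^sup>+t. g (m, t) \<partial>lborel) \<noteq> \<infinity>"
  proof (rule ccontr)
    assume "\<not> ?thesis"
    with ae have "AE m in lborel. m \<notin> {a<..<b}" by (auto elim: eventually_mono)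
    then have "{a<..<b} \<in> null_sets lborel"
      using AE_iff_null_sets[of "{a<..<b}" lborel] by simp
    then show False using ab by (simp add: null_sets_def)
  qed
  then show thesis using that by (auto simp: top.not_eq_extremum)
qed

section \<open>Jacobians of harmonic mappings and of the family of curves\<close>

lemma jacobian_harmonic:
  fixes P Q a b :: complex
  defines "L \<equiv> \<lambda>h. P * h + cnj (Q * h)"
  shows "Re (L a) * Im (L b) - Re (L b) * Im (L a)
    = ((norm P)\<^sup>2 - (norm Q)\<^sup>2) * (Re a * Im b - Re b * Im a)"
  unfolding L_def cmod_power2 by (simp add: power2_eq_square algebra_simps)

lemma norm_cis_diff_le: "norm (cis a - cis b) \<le> \<bar>a - b\<bar>"
proof (rule power2_le_imp_le)
  have "(norm (cis a - cis b))\<^sup>2 = 2 - 2 * cos (a - b)"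
    unfolding cmod_power2
    using sin_cos_squared_add[of a] sin_cos_squared_add[of b]
    by (simp add: cos_diff power2_eq_square algebra_simps)
  also have "cos (a - b) = 1 - 2 * (sin ((a - b) / 2))\<^sup>2"
    using cos_double_sin[of "(a - b) / 2"] by (simp only: mult_2 field_sum_of_halves)
  also have "2 - 2 * (1 - 2 * (sin ((a - b) / 2))\<^sup>2) = (2 * \<bar>sin ((a - b) / 2)\<bar>)\<^sup>2"
    by (simp add: power_mult_distrib)
  also have "\<dots> \<le> (\<bar>a - b\<bar>)\<^sup>2"
    using abs_sin_x_le_abs_x[of "(a - b) / 2"] by (intro power_mono) auto
  finally show "(norm (cis a - cis b))\<^sup>2 \<le> \<bar>a - b\<bar>\<^sup>2" .
qed simp

lemma cis_eq_imp_eq: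
  assumes "cis a = cis b" "\<bar>a - b\<bar> < 2 * pi" shows "a = b"
proof -
  have "cis (a - b) = 1" using assms(1) by (simp flip: cis_divide)
  then have "cos (a - b) = 1" by (simp add: complex_eq_iff)
  then obtain n :: int where n: "a - b = of_int n * 2 * pi" using cos_one_2pi_int by blast
  then have "\<bar>of_int n :: real\<bar> < 1" using assms(2) by (simp add: abs_mult)
  then have "n = 0" by linarith
  then show ?thesis using n by simp
qed

lemma abs_diff_has_derivative:
  fixes c x :: real assumes "x \<noteq> c"
  shows "((\<lambda>x. \<bar>x - c\<bar>) has_derivative (\<lambda>h. sgn (x - c) * h)) (at x)"
proof (cases "c < x")
  case True
  have "((\<lambda>x. x - c) has_derivative (\<lambda>h. sgn (x - c) * h)) (at x)"
    using True by (auto intro!: derivative_eq_intros)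
  then show ?thesis
    by (rule has_derivative_transform_within_open[of _ _ _ _ "{c<..}"]) (use True in auto)
next
  case False
  have "((\<lambda>x. c - x) has_derivative (\<lambda>h. sgn (x - c) * h)) (at x)"
    using False assms by (auto intro!: derivative_eq_intros)
  then show ?thesis
    by (rule has_derivative_transform_within_open[of _ _ _ _ "{..<c}"]) (use False assms in auto)
qed

lemma exists_Gamma_curve_finite_integral:
  fixes H G \<phi> :: "complex \<Rightarrow> complex"
  defines "F \<equiv> \<lambda>z. H z + cnj (G z)"
  assumes H: "H holomorphic_on ball 0 1" and G: "G holomorphic_on ball 0 1"
    and dil: "\<And>z. z \<in> ball 0 1 \<Longrightarrow> norm (deriv G z) < norm (deriv H z)"
    and F: "inj_on F (ball 0 1)" "bounded (F ` ball 0 1)"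
    and \<phi>: "\<And>z. z \<in> ball 0 1 \<Longrightarrow> \<phi> z = deriv G z / deriv H z"
    and C: "0 < C" and lower: "\<And>\<kappa>. 0 < \<kappa> \<Longrightarrow> \<exists>\<delta>>0. \<forall>z. norm z < 1 \<longrightarrow> norm (cis \<theta>0 - z) < \<delta> \<longrightarrow>
      \<kappa> * norm (cis \<theta>0 - z) \<le> 1 - norm z \<longrightarrow> C \<le> norm (cis \<theta>0 - z) * norm (deriv H z)"
  obtains m where "0 < m" "m < 1 / pi"
    "arc_length_integral (Gamma_params m \<theta>0) (Gamma_curve m \<theta>0)
      (\<lambda>z. (1 - (norm (\<phi> z))\<^sup>2) / (1 - (norm z)\<^sup>2)) < \<infinity>"
proof -
  \<comment> \<open>On a curve of slope \<open>m\<close> between 1/8 and 1/4 the distance to the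
    circle is at least \<open>\<bar>s t\<bar> / 8\<close> and the distance to
    \<open>cis \<theta>0\<close> at most \<open>2 * \<bar>s t\<bar>\<close>; hence the aperture
    1/16.\<close>
  obtain \<delta> where \<delta>: "0 < \<delta>" "\<And>z. norm z < 1 \<Longrightarrow> norm (cis \<theta>0 - z) < \<delta> \<Longrightarrow>
      1/16 * norm (cis \<theta>0 - z) \<le> 1 - norm z \<Longrightarrow> C \<le> norm (cis \<theta>0 - z) * norm (deriv H z)"
    using lower[of "1/16"] by auto
  \<comment> \<open>The bound \<open>\<delta> / 2\<close> brings the points of the curves into the
    range of the lower bound; the bound 1 keeps the angles within one period and
    \<open>m * \<bar>s t\<bar>\<close> below 1/4.\<close>
  define \<eta> where "\<eta> = min 1 (\<delta> / 2)"
  have \<eta>: "0 < \<eta>" "\<eta> \<le> 1" "2 * \<eta> \<le> \<delta>" using \<delta>(1) by (auto simp: \<eta>_def)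
  have pi1: "1/4 < 1 / pi" using pi_less_4 by (simp add: field_simps)
  define \<gamma> where "\<gamma> = (\<lambda>p. Gamma_curve (fst p) \<theta>0 (snd p))"
  define s where "s = (\<lambda>t. t - \<theta>0)"
  have \<gamma>_alt: "\<gamma> p = of_real (1 - fst p * \<bar>snd p - \<theta>0\<bar>) * cis (snd p)" for p
    by (simp add: \<gamma>_def Gamma_curve_def)
  have ms: "0 < m * \<bar>s t\<bar>" "m * \<bar>s t\<bar> < 1" if "1/8 < m" "m < 1/4" "0 < \<bar>s t\<bar>" "\<bar>s t\<bar> \<le> pi" for m t
  proof -
    show "0 < m * \<bar>s t\<bar>" using that by (intro mult_pos_pos) auto
    have "m * \<bar>s t\<bar> \<le> 1/4 * pi" using that by (intro mult_mono) auto
    then show "m * \<bar>s t\<bar> < 1" using pi_less_4 by simp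
  qed
  have n\<gamma>: "norm (\<gamma> (m, t)) = 1 - m * \<bar>s t\<bar>" if "1/8 < m" "m < 1/4" "0 < \<bar>s t\<bar>" "\<bar>s t\<bar> \<le> pi" for m t
    using ms[OF that] by (simp add: \<gamma>_alt norm_mult s_def del: of_real_diff of_real_mult)
  have \<gamma>_ball: "\<gamma> (m, t) \<in> ball 0 1" if "1/8 < m" "m < 1/4" "0 < \<bar>s t\<bar>" "\<bar>s t\<bar> \<le> pi" for m t
    using n\<gamma>[OF that] ms[OF that] by simp
  \<comment> \<open>The line \<open>t = \<theta>0\<close> is removed because all curves meet there
    and \<open>\<bar>t - \<theta>0\<bar>\<close> is not differentiable. Slopes below 1/4 are
    admissible as \<open>pi < 4\<close>; slopes above 1/8 keep the approach uniformly
    nontangential.\<close>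
  define S where "S = {1/8<..<1/4::real} \<times> ({\<theta>0 - \<eta><..<\<theta>0 + \<eta>} - {\<theta>0})"
  have S_iff: "(m, t) \<in> S \<longleftrightarrow> 1/8 < m \<and> m < 1/4 \<and> 0 < \<bar>s t\<bar> \<and> \<bar>s t\<bar> < \<eta>" for m t
    by (auto simp: S_def s_def)
  have S_pi: "\<bar>s t\<bar> \<le> pi" if "\<bar>s t\<bar> < \<eta>" for t using that \<eta> pi_gt3 by simp
  have S_D: "1/8 < m" "m < 1/4" "0 < \<bar>s t\<bar>" "\<bar>s t\<bar> \<le> pi" "\<bar>s t\<bar> < \<eta>" if "(m, t) \<in> S" for m t
    using that S_pi by (auto simp: S_iff)
  have oS: "open S" unfolding S_def by (intro open_Times open_Diff) auto
  have S_ball: "p \<in> S \<Longrightarrow> \<gamma> p \<in> ball 0 1" for p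
    using \<gamma>_ball S_D by (cases p) blast
  have \<gamma>_inj: "inj_on \<gamma> S"
  proof (rule inj_onI)
    fix p q assume pq: "p \<in> S" "q \<in> S" and eq: "\<gamma> p = \<gamma> q"
    obtain m t where p: "p = (m, t)" by (cases p)
    obtain m' t' where q: "q = (m', t')" by (cases q)
    note D = S_D[OF pq(1)[unfolded p]] and D' = S_D[OF pq(2)[unfolded q]]
    have r: "m * \<bar>s t\<bar> = m' * \<bar>s t'\<bar>"
      using n\<gamma>[OF D(1-4)] n\<gamma>[OF D'(1-4)] eq by (simp add: p q)
    have "of_real (1 - m * \<bar>s t\<bar>) \<noteq> (0::complex)" using ms[OF D(1-4)] by (simp del: of_real_diff of_real_mult)
    then have "cis t = cis t'" using eq r by (simp add: \<gamma>_alt p q s_def del: of_real_diff of_real_mult)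
    moreover have "\<bar>t - t'\<bar> < 2 * pi" using D(5) D'(5) \<eta>(2) pi_gt3 by (simp add: s_def)
    ultimately have "t = t'" by (rule cis_eq_imp_eq)
    then show "p = q" using r D(3) by (simp add: p q)
  qed
  define \<gamma>' where "\<gamma>' = (\<lambda>p h. of_real (- (fst h * \<bar>snd p - \<theta>0\<bar>) - fst p * (sgn (snd p - \<theta>0) * snd h)) * cis (snd p)
      + of_real (1 - fst p * \<bar>snd p - \<theta>0\<bar>) * (of_real (snd h) * (\<i> * cis (snd p))))"
  have \<gamma>_der: "(\<gamma> has_derivative \<gamma>' p) (at p)" if "snd p \<noteq> \<theta>0" for p
  proof -
    have "((\<lambda>p. \<bar>snd p - \<theta>0\<bar>) has_derivative (\<lambda>h. sgn (snd p - \<theta>0) * snd h)) (at p)"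
      by (rule has_derivative_compose[OF has_derivative_snd[OF has_derivative_ident] abs_diff_has_derivative[OF that]])
    then show ?thesis unfolding \<gamma>_alt[abs_def] \<gamma>'_def
      by (auto intro!: derivative_eq_intros simp: scaleR_conv_of_real algebra_simps)
  qed
  define \<Psi> where "\<Psi> = (\<lambda>p. F (\<gamma> p))"
  define \<Psi>' where "\<Psi>' = (\<lambda>p h. deriv H (\<gamma> p) * \<gamma>' p h + cnj (deriv G (\<gamma> p) * \<gamma>' p h))"
  \<comment> \<open>The Jacobian of \<open>F\<close> at \<open>\<gamma> p\<close> times the absolute
    Jacobian of \<open>\<gamma>\<close> at \<open>p\<close>.\<close>
  define w where "w = (\<lambda>p. ((norm (deriv H (\<gamma> p)))\<^sup>2 - (norm (deriv G (\<gamma> p)))\<^sup>2) *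
      (\<bar>snd p - \<theta>0\<bar> * (1 - fst p * \<bar>snd p - \<theta>0\<bar>)))"
  have sq: "(norm (deriv G z))\<^sup>2 < (norm (deriv H z))\<^sup>2" if "z \<in> ball 0 1" for z
    using dil[OF that] by (intro power_strict_mono) auto
  have contw: "continuous_on S w"
  proof -
    have cont\<gamma>: "continuous_on S \<gamma>" unfolding \<gamma>_alt[abs_def] by (intro continuous_intros)
    have "continuous_on S (\<lambda>p. deriv H (\<gamma> p))" "continuous_on S (\<lambda>p. deriv G (\<gamma> p))"
      using S_ball holomorphic_deriv[OF H open_ball] holomorphic_deriv[OF G open_ball]
      by (auto intro!: continuous_on_compose2[OF _ cont\<gamma>] holomorphic_on_imp_continuous_on simp del: mem_ball)
    then show "continuous_on S w" unfolding w_def by (intro continuous_intros)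
  qed
  have fin: "(\<integral>\<^sup>+p. ennreal (indicator S p * w p) \<partial>lborel) < \<infinity>"
  proof (rule nn_integral_jacobian_finite[OF oS, of \<Psi> \<Psi>'])
    show "inj_on \<Psi> S"
    proof -
      have "\<gamma> ` S \<subseteq> ball 0 1" using S_ball by blast
      from comp_inj_on[OF \<gamma>_inj inj_on_subset[OF F(1) this]] show ?thesis by (simp add: \<Psi>_def o_def)
    qed
    show "bounded (\<Psi> ` S)"
      by (rule bounded_subset[OF F(2)]) (use S_ball in \<open>auto simp: \<Psi>_def simp del: mem_ball\<close>)
    show "(\<Psi> has_derivative \<Psi>' p) (at p)" if p: "p \<in> S" for p
    proof -
      have g: "(\<gamma> has_derivative \<gamma>' p) (at p)" by (rule \<gamma>_der) (use p in \<open>auto simp: S_def\<close>)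
      have "(H has_derivative (\<lambda>h. deriv H (\<gamma> p) * h)) (at (\<gamma> p))" "(G has_derivative (\<lambda>h. deriv G (\<gamma> p) * h)) (at (\<gamma> p))"
        using holomorphic_derivI[OF H open_ball S_ball[OF p]] holomorphic_derivI[OF G open_ball S_ball[OF p]]
        by (simp_all add: has_field_derivative_def)
      from this[THEN has_derivative_compose[OF g]] show ?thesis
        unfolding \<Psi>_def \<Psi>'_def F_def
        by (intro has_derivative_add bounded_linear.has_derivative[OF bounded_linear_cnj])
    qed
    show "continuous_on S w" by (rule contw)
    fix p assume p: "p \<in> S"
    obtain m t where mt: "p = (m, t)" by (cases p)
    note D = S_D[OF p[unfolded mt]]
    have "Re (\<gamma>' p (1, 0)) = - (\<bar>s t\<bar> * cos t)" "Im (\<gamma>' p (1, 0)) = - (\<bar>s t\<bar> * sin t)"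
      "Re (\<gamma>' p (0, 1)) = - (m * sgn (s t)) * cos t - (1 - m * \<bar>s t\<bar>) * sin t"
      "Im (\<gamma>' p (0, 1)) = - (m * sgn (s t)) * sin t + (1 - m * \<bar>s t\<bar>) * cos t"
      by (simp_all add: \<gamma>'_def mt s_def)
    \<comment> \<open>Here \<open>A = \<bar>s t\<bar>\<close>, \<open>k = m * sgn (s t)\<close>,
      \<open>r = 1 - m * \<bar>s t\<bar>\<close>, and \<open>c\<close>, \<open>d\<close> are the
      cosine and sine of \<open>t\<close>. The terms with \<open>k\<close> cancel: the radial slant
      of the curve does not affect the area.\<close>
    moreover have "- (A * c) * (- k * d + r * c) - (- k * c - r * d) * - (A * d) = - (A * r) * (c\<^sup>2 + d\<^sup>2)"
      for A c d k r :: real by (simp add: power2_eq_square algebra_simps)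
    ultimately have "Re (\<gamma>' p (1, 0)) * Im (\<gamma>' p (0, 1)) - Re (\<gamma>' p (0, 1)) * Im (\<gamma>' p (1, 0))
        = - (\<bar>s t\<bar> * (1 - m * \<bar>s t\<bar>)) * ((cos t)\<^sup>2 + (sin t)\<^sup>2)" by (simp only:)
    then have "Re (\<gamma>' p (1, 0)) * Im (\<gamma>' p (0, 1)) - Re (\<gamma>' p (0, 1)) * Im (\<gamma>' p (1, 0))
        = - (\<bar>s t\<bar> * (1 - m * \<bar>s t\<bar>))" by simp
    then have "\<bar>Re (\<Psi>' p (1, 0)) * Im (\<Psi>' p (0, 1)) - Re (\<Psi>' p (0, 1)) * Im (\<Psi>' p (1, 0))\<bar>
        = \<bar>((norm (deriv H (\<gamma> p)))\<^sup>2 - (norm (deriv G (\<gamma> p)))\<^sup>2) * - (\<bar>s t\<bar> * (1 - m * \<bar>s t\<bar>))\<bar>"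
      unfolding \<Psi>'_def jacobian_harmonic by simp
    also have "\<dots> = w p"
    proof -
      have "\<bar>(norm (deriv H (\<gamma> p)))\<^sup>2 - (norm (deriv G (\<gamma> p)))\<^sup>2\<bar>
          = (norm (deriv H (\<gamma> p)))\<^sup>2 - (norm (deriv G (\<gamma> p)))\<^sup>2"
        using sq[OF S_ball[OF p]] by (intro abs_of_pos) simp
      moreover have "\<bar>1 - m * \<bar>s t\<bar>\<bar> = 1 - m * \<bar>s t\<bar>" using ms[OF D(1-4)] by simp
      ultimately show ?thesis by (simp add: w_def mt s_def abs_mult)
    qed
    finally show "w p = \<bar>Re (\<Psi>' p (1, 0)) * Im (\<Psi>' p (0, 1)) - Re (\<Psi>' p (0, 1)) * Im (\<Psi>' p (1, 0))\<bar>" ..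
  qed
  define g where "g = (\<lambda>p. ennreal (indicator S p * w p))"
  have "(\<lambda>p. indicator S p *\<^sub>R w p) \<in> borel_measurable borel"
    by (rule borel_measurable_continuous_on_indicator) (use oS contw in auto)
  then have gmeas: "g \<in> borel_measurable borel" by (simp add: g_def)
  obtain m where m: "1/8 < m" "m < 1/4" "(\<integral>\<^sup>+t. g (m, t) \<partial>lborel) < \<infinity>"
    using nn_integral_slice_finite[OF gmeas _, of "1/8" "1/4"] fin by (auto simp: g_def)
  define u where "u = (\<lambda>z. (1 - (norm (\<phi> z))\<^sup>2) / (1 - (norm z)\<^sup>2))"
  define I where "I = {\<theta>0 - pi..\<theta>0 + pi}"
  have m0: "0 < m" "m < 1 / pi" using m(1) order_less_trans[OF m(2) pi1] by auto
  have params: "t \<in> Gamma_params m \<theta>0 \<longleftrightarrow> 0 < \<bar>s t\<bar> \<and> \<bar>s t\<bar> \<le> pi" for t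
  proof -
    have "pi \<le> 1 / m" using m0 by (simp add: field_simps)
    then show ?thesis by (auto simp: Gamma_params_def s_def)
  qed
  have vd: "norm (vector_derivative (Gamma_curve m \<theta>0) (at t)) \<le> 2" if t: "0 < \<bar>s t\<bar>" "\<bar>s t\<bar> \<le> pi" for t
  proof -
    have "((\<lambda>t. (m, t)) has_derivative (\<lambda>h. (0, h))) (at t)"
      by (intro has_derivative_Pair has_derivative_const has_derivative_ident)
    from has_derivative_compose[OF this, of \<gamma> "\<gamma>' (m, t)"]
    have "((\<lambda>t. \<gamma> (m, t)) has_derivative (\<lambda>h. \<gamma>' (m, t) (0, h))) (at t)"
      using \<gamma>_der[of "(m, t)"] t by (auto simp: s_def)
    moreover have "(\<lambda>h. \<gamma>' (m, t) (0, h)) = (\<lambda>h. h *\<^sub>R \<gamma>' (m, t) (0, 1))"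
      by (auto simp: \<gamma>'_def scaleR_conv_of_real algebra_simps)
    ultimately have "(Gamma_curve m \<theta>0 has_vector_derivative \<gamma>' (m, t) (0, 1)) (at t)"
      by (simp add: has_vector_derivative_def \<gamma>_def)
    then have "vector_derivative (Gamma_curve m \<theta>0) (at t) = \<gamma>' (m, t) (0, 1)"
      by (rule vector_derivative_at)
    also have "norm \<dots> \<le> norm (of_real (- (m * sgn (s t))) * cis t) + norm (of_real (1 - m * \<bar>s t\<bar>) * (\<i> * cis t))"
      unfolding \<gamma>'_def by (rule order_trans[OF _ norm_triangle_ineq]) (simp add: s_def)
    also have "\<dots> = m * \<bar>sgn (s t)\<bar> + \<bar>1 - m * \<bar>s t\<bar>\<bar>"
      using m0 by (simp add: norm_mult abs_mult del: of_real_diff of_real_mult of_real_minus)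
    also have "\<dots> \<le> 2"
    proof -
      have 1: "\<bar>sgn (s t)\<bar> = 1" using t by (simp add: abs_sgn_eq)
      have "\<bar>1 - m * \<bar>s t\<bar>\<bar> \<le> 1" using ms[OF m(1,2) t] by linarith
      then show ?thesis unfolding 1 using m(2) by linarith
    qed
    finally show ?thesis .
  qed
  have u_le: "u (\<gamma> (m, t)) \<le> 8 / \<bar>s t\<bar>" "0 \<le> u (\<gamma> (m, t))" "1 / (1 - (norm (\<gamma> (m, t)))\<^sup>2) \<le> 8 / \<bar>s t\<bar>"
    "0 < 1 - (norm (\<gamma> (m, t)))\<^sup>2"
    if t: "0 < \<bar>s t\<bar>" "\<bar>s t\<bar> \<le> pi" for t
  proof -
    let ?z = "\<gamma> (m, t)"
    have zb: "?z \<in> ball 0 1" by (rule \<gamma>_ball[OF m(1,2) t])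
    have "(norm ?z)\<^sup>2 \<le> norm ?z" using zb by (simp add: power2_eq_square mult_left_le)
    then have "m * \<bar>s t\<bar> \<le> 1 - (norm ?z)\<^sup>2" using n\<gamma>[OF m(1,2) t] by simp
    moreover have "1/8 * \<bar>s t\<bar> \<le> m * \<bar>s t\<bar>" using m by (intro mult_right_mono) auto
    ultimately have l: "\<bar>s t\<bar> / 8 \<le> 1 - (norm ?z)\<^sup>2" by simp
    then show pos: "0 < 1 - (norm ?z)\<^sup>2" using t by linarith
    have "1 / (1 - (norm ?z)\<^sup>2) \<le> 1 / (\<bar>s t\<bar> / 8)" using l t pos by (intro divide_left_mono) auto
    then show 1: "1 / (1 - (norm ?z)\<^sup>2) \<le> 8 / \<bar>s t\<bar>" by simp
    have "norm (\<phi> ?z) < 1" using \<phi>[OF zb] dil[OF zb] by (simp add: norm_divide divide_less_eq)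
    then have "(norm (\<phi> ?z))\<^sup>2 \<le> 1" by (simp add: power_le_one)
    then show "0 \<le> u ?z" using pos by (simp add: u_def)
    have "u ?z \<le> 1 / (1 - (norm ?z)\<^sup>2)" unfolding u_def using pos by (intro divide_right_mono) auto
    with 1 show "u ?z \<le> 8 / \<bar>s t\<bar>" by simp
  qed
  \<comment> \<open>Near the boundary point, \<^term>\<open>1 - (norm (\<phi> z))\<^sup>2\<close> is the Jacobian of \<^term>\<open>F\<close> divided by
    \<^term>\<open>(norm (deriv H z))\<^sup>2\<close>, so the lower bound on the derivative of \<^term>\<open>H\<close> compares \<^term>\<open>u\<close> with the
    Jacobian \<^term>\<open>w\<close> of \<^term>\<open>\<Psi>\<close>, whose integral is an area.\<close>
  have near: "u (\<gamma> (m, t)) \<le> 64 / C\<^sup>2 * w (m, t)" if mt: "(m, t) \<in> S" for t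
  proof -
    let ?z = "\<gamma> (m, t)"
    note D = S_D[OF mt]
    have zb: "?z \<in> ball 0 1" by (rule S_ball[OF mt])
    define P where "P = norm (deriv H ?z)"
    define Q where "Q = norm (deriv G ?z)"
    have PQ: "Q\<^sup>2 < P\<^sup>2" "0 < P"
      using sq[OF zb] le_less_trans[OF norm_ge_zero dil[OF zb]] by (simp_all add: P_def Q_def)
    have "norm (cis \<theta>0 - ?z) \<le> norm (cis \<theta>0 - cis t) + norm (cis t - ?z)"
      using norm_triangle_ineq[of "cis \<theta>0 - cis t" "cis t - ?z"] by simp
    also have "norm (cis \<theta>0 - cis t) \<le> \<bar>s t\<bar>" using norm_cis_diff_le[of \<theta>0 t] by (simp add: s_def)
    also have "cis t - ?z = of_real (m * \<bar>s t\<bar>) * cis t" by (simp add: \<gamma>_alt s_def algebra_simps)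
    also have "norm \<dots> = m * \<bar>s t\<bar>" using m0 by (simp add: norm_mult)
    also have "m * \<bar>s t\<bar> \<le> 1 * \<bar>s t\<bar>" using m by (intro mult_right_mono) auto
    finally have dz: "norm (cis \<theta>0 - ?z) \<le> 2 * \<bar>s t\<bar>" by simp
    have "1/8 * \<bar>s t\<bar> \<le> m * \<bar>s t\<bar>" using m by (intro mult_right_mono) auto
    then have "C \<le> norm (cis \<theta>0 - ?z) * P" unfolding P_def
      using dz D(5) \<eta>(3) n\<gamma>[OF D(1-4)] zb by (intro \<delta>(2)) auto
    also have "\<dots> \<le> 2 * \<bar>s t\<bar> * P" using dz PQ by (intro mult_right_mono) auto
    finally have CP: "C \<le> 2 * \<bar>s t\<bar> * P" .
    then have "C\<^sup>2 \<le> (2 * \<bar>s t\<bar> * P)\<^sup>2" using C by (intro power_mono) auto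
    then have P2: "1 / P\<^sup>2 \<le> 4 * \<bar>s t\<bar>\<^sup>2 / C\<^sup>2" using C PQ by (simp add: field_simps power_mult_distrib)
    have n\<phi>: "norm (\<phi> ?z) = Q / P" using \<phi>[OF zb] by (simp add: P_def Q_def norm_divide)
    have "1 - (norm (\<phi> ?z))\<^sup>2 = (P\<^sup>2 - Q\<^sup>2) * (1 / P\<^sup>2)"
      unfolding n\<phi> power_divide using PQ(2) by (simp add: diff_divide_distrib)
    also have "\<dots> \<le> (P\<^sup>2 - Q\<^sup>2) * (4 * \<bar>s t\<bar>\<^sup>2 / C\<^sup>2)" using P2 PQ by (intro mult_left_mono) auto
    finally have "u ?z \<le> (P\<^sup>2 - Q\<^sup>2) * (4 * \<bar>s t\<bar>\<^sup>2 / C\<^sup>2) / (1 - (norm ?z)\<^sup>2)"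
      unfolding u_def using u_le(4)[OF D(3,4)] by (intro divide_right_mono) auto
    also have "\<dots> = (P\<^sup>2 - Q\<^sup>2) * (4 * \<bar>s t\<bar>\<^sup>2 / C\<^sup>2) * (1 / (1 - (norm ?z)\<^sup>2))" by simp
    also have "\<dots> \<le> (P\<^sup>2 - Q\<^sup>2) * (4 * \<bar>s t\<bar>\<^sup>2 / C\<^sup>2) * (8 / \<bar>s t\<bar>)"
      using u_le(3)[OF D(3,4)] PQ by (intro mult_left_mono) auto
    \<comment> \<open>The constant is \<open>4 * 8 * 2\<close>; the factor \<open>1/2\<close> is
      split off as a lower bound for \<open>1 - m * \<bar>s t\<bar>\<close>, which is at least
      3/4.\<close>
    also have "\<dots> = 64 / C\<^sup>2 * ((P\<^sup>2 - Q\<^sup>2) * (\<bar>s t\<bar> * (1/2)))"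
    proof -
      have "X * (4 * A\<^sup>2 / K) * (8 / A) = 64 / K * (X * (A * (1/2)))" if "A \<noteq> 0" for X A K :: real
        using that by (cases "K = 0") (simp_all add: field_simps power2_eq_square)
      from this[OF less_imp_neq[OF D(3), symmetric]] show ?thesis .
    qed
    also have "\<dots> \<le> 64 / C\<^sup>2 * ((P\<^sup>2 - Q\<^sup>2) * (\<bar>s t\<bar> * (1 - m * \<bar>s t\<bar>)))"
    proof -
      have "m * \<bar>s t\<bar> \<le> 1/4 * 1" using m D(5) \<eta>(2) by (intro mult_mono) auto
      then show ?thesis using PQ by (intro mult_left_mono) auto
    qed
    also have "\<dots> = 64 / C\<^sup>2 * w (m, t)" by (simp add: w_def P_def Q_def s_def)
    finally show ?thesis .
  qed
  \<comment> \<open>The speed of the curve is at most 2, whence \<open>128 = 2 * 64\<close> near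
    \<open>\<theta>0\<close>. At angular distance at least \<open>\<eta>\<close>, \<open>u\<close>
    is at most \<open>8 / \<eta>\<close>, which gives \<open>16 / \<eta>\<close> on the bounded
    interval \<open>I\<close>.\<close>
  have bound: "ennreal (u (Gamma_curve m \<theta>0 t) * norm (vector_derivative (Gamma_curve m \<theta>0) (at t))) * indicator (Gamma_params m \<theta>0) t
      \<le> ennreal (128 / C\<^sup>2) * g (m, t) + ennreal (16 / \<eta>) * indicator I t" for t
  proof (cases "t \<in> Gamma_params m \<theta>0")
    case True
    then have t: "0 < \<bar>s t\<bar>" "\<bar>s t\<bar> \<le> pi" using params by auto
    have tI: "t \<in> I" using t(2) by (auto simp: I_def s_def)
    have \<gamma>t: "Gamma_curve m \<theta>0 t = \<gamma> (m, t)" by (simp add: \<gamma>_def)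
    have "u (\<gamma> (m, t)) * norm (vector_derivative (Gamma_curve m \<theta>0) (at t)) \<le> u (\<gamma> (m, t)) * 2"
      using vd[OF t] u_le(2)[OF t] by (intro mult_left_mono)
    also have "ennreal (u (\<gamma> (m, t)) * 2) \<le> ennreal (128 / C\<^sup>2) * g (m, t) + ennreal (16 / \<eta>)"
    proof (cases "\<bar>s t\<bar> < \<eta>")
      case True
      then have mt: "(m, t) \<in> S" using t m by (simp add: S_iff)
      have "ennreal (u (\<gamma> (m, t)) * 2) \<le> ennreal (128 / C\<^sup>2 * w (m, t))"
        using near[OF mt] by (intro ennreal_leI) simp
      also have "\<dots> = ennreal (128 / C\<^sup>2) * ennreal (w (m, t))" by (rule ennreal_mult') simp
      also have "ennreal (w (m, t)) = g (m, t)" using mt by (simp add: g_def)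
      also have "ennreal (128 / C\<^sup>2) * g (m, t) \<le> ennreal (128 / C\<^sup>2) * g (m, t) + ennreal (16 / \<eta>)" by simp
      finally show ?thesis .
    next
      case False
      have "u (\<gamma> (m, t)) \<le> 8 / \<bar>s t\<bar>" by (rule u_le(1)[OF t])
      also have "\<dots> \<le> 8 / \<eta>" using False \<eta>(1) t by (intro divide_left_mono) auto
      finally have "ennreal (u (\<gamma> (m, t)) * 2) \<le> ennreal (16 / \<eta>)" by (intro ennreal_leI) simp
      also have "\<dots> \<le> ennreal (128 / C\<^sup>2) * g (m, t) + ennreal (16 / \<eta>)" by simp
      finally show ?thesis .
    qed
    finally show ?thesis using True tI by (simp add: \<gamma>t ennreal_leI)
  qed simp
  have "(\<lambda>t. (m, t)) \<in> borel_measurable borel"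
    by (intro borel_measurable_continuous_onI continuous_intros)
  then have gm: "(\<lambda>t. g (m, t)) \<in> borel_measurable borel" by (rule measurable_compose[OF _ gmeas])
  have "arc_length_integral (Gamma_params m \<theta>0) (Gamma_curve m \<theta>0) u
      \<le> (\<integral>\<^sup>+t. ennreal (128 / C\<^sup>2) * g (m, t) + ennreal (16 / \<eta>) * indicator I t \<partial>lborel)"
    unfolding arc_length_integral_def by (intro nn_integral_mono bound)
  also have "\<dots> = ennreal (128 / C\<^sup>2) * (\<integral>\<^sup>+t. g (m, t) \<partial>lborel) + ennreal (16 / \<eta>) * emeasure lborel I"
    using gm by (subst nn_integral_add) (auto simp: nn_integral_cmult I_def)
  also have "\<dots> < \<infinity>"
    using m(3) by (auto simp: I_def ennreal_mult_less_top less_top[symmetric] ennreal_add_eq_top ennreal_mult_eq_top_iff)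
  finally show thesis using that m0 unfolding u_def by blast
qed

section \<open>The boundary function, and the proof of the theorem\<close>

lemma boundary_function_continuous_atI:
  assumes \<zeta>: "norm \<zeta> = 1" and p: "(f \<longlongrightarrow> p) (at \<zeta> within ball 0 1)"
  shows "boundary_function_continuous_at f \<zeta>"
proof -
  have nb: "at \<xi> within ball 0 1 \<noteq> bot" if "norm \<xi> = 1" for \<xi> :: complex
    using that by (simp add: at_within_ball_bot_iff)
  have bf: "boundary_function f \<xi> = l" if "norm \<xi> = 1" "(f \<longlongrightarrow> l) (at \<xi> within ball 0 1)" for \<xi> l
    unfolding boundary_function_def by (rule tendsto_Lim[OF nb[OF that(1)] that(2)])
  have "(boundary_function f \<longlongrightarrow> p) (at \<zeta> within boundary_domain f)"
    unfolding tendsto_iff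
  proof (intro allI impI)
    fix e :: real assume e: "0 < e"
    \<comment> \<open>Half of \<open>e\<close>, because a strict bound on \<open>f\<close> survives
      only as a weak one in its limits at neighbouring boundary points.\<close>
    obtain d where d: "0 < d" "\<And>z. z \<in> ball 0 1 \<Longrightarrow> z \<noteq> \<zeta> \<Longrightarrow> dist z \<zeta> < d \<Longrightarrow> dist (f z) p < e/2"
      using tendstoD[OF p, of "e/2"] e unfolding eventually_at by auto
    have "dist (boundary_function f \<xi>) p < e" if \<xi>: "\<xi> \<in> boundary_domain f" "dist \<xi> \<zeta> < d" for \<xi>
    proof -
      have n\<xi>: "norm \<xi> = 1" using \<xi> by (simp add: boundary_domain_def)
      obtain l where l: "(f \<longlongrightarrow> l) (at \<xi> within ball 0 1)" using \<xi> unfolding boundary_domain_def by blast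
      have "\<forall>\<^sub>F z in at \<xi> within ball 0 1. z \<in> ball \<zeta> d"
        using \<xi>(2) by (intro eventually_at_in_open' topological_tendstoD[OF tendsto_ident_at]) (auto simp: dist_commute)
      moreover have "\<forall>\<^sub>F z in at \<xi> within ball 0 1. z \<in> ball 0 1"
        by (auto simp: eventually_at_topological intro!: exI[of _ UNIV])
      ultimately have "\<forall>\<^sub>F z in at \<xi> within ball 0 1. dist (f z) p \<le> e/2"
      proof eventually_elim
        case (elim z)
        then have "z \<noteq> \<zeta>" using \<zeta> by auto
        with elim show ?case using d(2)[of z] by (simp add: dist_commute)
      qed
      moreover have "((\<lambda>z. dist (f z) p) \<longlongrightarrow> dist l p) (at \<xi> within ball 0 1)"
        by (intro tendsto_intros l)
      ultimately have "dist l p \<le> e/2" using nb[OF n\<xi>] by (intro tendsto_upperbound)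
      then show ?thesis using bf[OF n\<xi> l] e by simp
    qed
    then show "\<forall>\<^sub>F \<xi> in at \<zeta> within boundary_domain f. dist (boundary_function f \<xi>) p < e"
      using d(1) by (auto simp: eventually_at)
  qed
  then show ?thesis
    using p \<zeta> bf[OF \<zeta> p] by (auto simp: boundary_function_continuous_at_def boundary_domain_def continuous_within)
qed

theorem theorem3:
  fixes \<Omega> :: "complex set"
    and f F1 F2 H1 G1 H2 G2 \<phi> :: "complex \<Rightarrow> complex"
    and \<theta>0 :: real
  assumes "open \<Omega>" "connected \<Omega>" "\<Omega> \<noteq> {}" "bounded \<Omega>" "convex \<Omega>" "simply_connected \<Omega>"
    and "biharmonic_mapping_on (ball 0 1) f"
    and "inj_on f (ball 0 1)"
    and "f ` ball 0 1 = \<Omega>"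
    and "\<And>z. z \<in> ball 0 1 \<Longrightarrow> f z = F1 z + of_real ((norm z)\<^sup>2) * F2 z"
    and "harmonic_mapping_on (ball 0 1) F1" "harmonic_mapping_on (ball 0 1) F2"
    and "H1 holomorphic_on ball 0 1" "G1 holomorphic_on ball 0 1"
    and "H2 holomorphic_on ball 0 1" "G2 holomorphic_on ball 0 1"
    and "\<And>z. z \<in> ball 0 1 \<Longrightarrow> F1 z = H1 z + cnj (G1 z)"
    and "\<And>z. z \<in> ball 0 1 \<Longrightarrow> F2 z = H2 z + cnj (G2 z)"
    and "F2 \<in> o[filtercomap norm (at_left 1)](\<lambda>z. of_real (1 / (1 - norm z)))"
    and "\<And>z. z \<in> ball 0 1 \<Longrightarrow> deriv H1 z + deriv H2 z \<noteq> 0"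
    and "\<And>z. z \<in> ball 0 1 \<Longrightarrow> \<phi> z = (deriv G1 z + deriv G2 z) / (deriv H1 z + deriv H2 z)"
    and "\<And>z. z \<in> ball 0 1 \<Longrightarrow> norm (\<phi> z) < 1"
    and "\<And>m. 0 < m \<Longrightarrow> m < 1 / pi \<Longrightarrow>
           arc_length_integral (Gamma_params m \<theta>0) (Gamma_curve m \<theta>0)
             (\<lambda>z. (1 - (norm (\<phi> z))\<^sup>2) / (1 - (norm z)\<^sup>2)) = \<infinity>"
  shows "boundary_function_continuous_at f (cis \<theta>0)"
proof -
  define H where "H = (\<lambda>z. H1 z + H2 z)"
  define G where "G = (\<lambda>z. G1 z + G2 z)"
  define F where "F = (\<lambda>z. H z + cnj (G z))"
  have hol: "H holomorphic_on ball 0 1" "G holomorphic_on ball 0 1"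
    unfolding H_def G_def by (intro holomorphic_intros assms)+
  have dHG: "deriv H z = deriv H1 z + deriv H2 z" "deriv G z = deriv G1 z + deriv G2 z"
    if "z \<in> ball 0 1" for z
    unfolding H_def G_def
    using assms(13-16) that open_ball by (auto intro!: deriv_add holomorphic_on_imp_differentiable_at)
  have dil: "norm (deriv G z) < norm (deriv H z)" if "z \<in> ball 0 1" for z
    using assms(20-22)[OF that] by (simp add: dHG[OF that] norm_divide divide_less_eq)
  have \<phi>: "\<phi> z = deriv G z / deriv H z" if "z \<in> ball 0 1" for z
    using assms(21)[OF that] dHG[OF that] by simp
  have "\<forall>z\<in>ball 0 1. f differentiable (at z)"
    using assms(7) by (simp add: biharmonic_mapping_on_def numeral_eq_Suc)
  then have contf: "continuous_on (ball 0 1) f"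
    by (auto intro!: continuous_at_imp_continuous_on differentiable_imp_continuous_within)
  have lim: "\<exists>r<1. \<forall>z. r < norm z \<longrightarrow> norm z < 1 \<longrightarrow> norm (F z - f z) < e" if e: "0 < e" for e
  proof -
    \<comment> \<open>Since \<open>1 - (norm z)\<^sup>2\<close> is at most
      \<open>2 * (1 - norm z)\<close>, the choice \<open>e/3\<close> leads to
      \<open>2 * e / 3\<close>, strictly below \<open>e\<close>.\<close>
    have "\<forall>\<^sub>F z in filtercomap norm (at_left 1). norm (F2 z) \<le> e/3 * norm (complex_of_real (1 / (1 - norm z)))"
      using landau_o.smallD[OF assms(19), of "e/3"] e by simp
    then obtain Q where Q: "eventually Q (at_left (1::real))"
      "\<And>z. Q (norm z) \<Longrightarrow> norm (F2 z) \<le> e/3 * norm (complex_of_real (1 / (1 - norm z)))"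
      unfolding eventually_filtercomap by blast
    then obtain r where r: "r < 1" "\<And>y. r < y \<Longrightarrow> y < 1 \<Longrightarrow> Q y"
      unfolding eventually_at_left_field by blast
    have "norm (F z - f z) < e" if z: "r < norm z" "norm z < 1" for z
    proof -
      have zb: "z \<in> ball 0 1" using z by simp
      have "F z = F1 z + F2 z" using assms(17,18)[OF zb] by (simp add: F_def H_def G_def)
      then have "F z - f z = of_real (1 - (norm z)\<^sup>2) * F2 z"
        using assms(10)[OF zb] by (simp add: algebra_simps)
      then have "norm (F z - f z) = \<bar>1 - (norm z)\<^sup>2\<bar> * norm (F2 z)"
        by (simp only: norm_mult norm_of_real)
      also have "1 - (norm z)\<^sup>2 = (1 - norm z) * (1 + norm z)" by (simp add: power2_eq_square algebra_simps)
      also have "\<bar>(1 - norm z) * (1 + norm z)\<bar> = (1 - norm z) * (1 + norm z)"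
        using z by (intro abs_of_nonneg mult_nonneg_nonneg) auto
      also have "(1 - norm z) * (1 + norm z) * norm (F2 z) \<le> (1 - norm z) * 2 * (e/3 * (1 / (1 - norm z)))"
      proof (rule mult_mono)
        show "(1 - norm z) * (1 + norm z) \<le> (1 - norm z) * 2" using z by (intro mult_left_mono) auto
        have "norm (complex_of_real (1 / (1 - norm z))) = 1 / (1 - norm z)" unfolding norm_of_real using z by simp
        then show "norm (F2 z) \<le> e/3 * (1 / (1 - norm z))" using Q(2)[OF r(2)[OF z]] by simp
      qed (use z in auto)
      also have "\<dots> = 2 * e / 3"
      proof -
        have "x * 2 * (e/3 * (1 / x)) = 2 * e / 3" if "x \<noteq> 0" for x using that by simp
        then show ?thesis using z(2) by (metis less_irrefl right_minus_eq)
      qed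
      also have "\<dots> < e" using e by simp
      finally show ?thesis .
    qed
    then show ?thesis using r(1) by blast
  qed
  note shadow = harmonic_shadow_homeomorphism[OF assms(1,5) hol dil contf assms(8,9) lim[unfolded F_def], folded F_def]
  have \<zeta>: "norm (cis \<theta>0) = 1" by simp
  show ?thesis
  proof (rule univalent_harmonic_boundary_dichotomy[OF \<zeta> assms(5,4) hol shadow[unfolded F_def], folded F_def])
    fix p assume "(F \<longlongrightarrow> p) (at (cis \<theta>0) within ball 0 1)"
    moreover have "((\<lambda>z. F z - f z) \<longlongrightarrow> 0) (at (cis \<theta>0) within ball 0 1)"
      unfolding tendsto_iff
    proof (intro allI impI)
      fix e :: real assume "0 < e"
      from lim[OF this] obtain r where r: "r < 1" "\<And>z. r < norm z \<Longrightarrow> norm z < 1 \<Longrightarrow> norm (F z - f z) < e" by blast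
      have "((\<lambda>z. norm z) \<longlongrightarrow> norm (cis \<theta>0)) (at (cis \<theta>0) within ball 0 1)" by (intro tendsto_intros)
      then have "\<forall>\<^sub>F z in at (cis \<theta>0) within ball 0 1. r < norm z" by (rule order_tendstoD) (use r in simp)
      moreover have "\<forall>\<^sub>F z in at (cis \<theta>0) within ball 0 1. z \<in> ball 0 1"
        by (auto simp: eventually_at_topological intro!: exI[of _ UNIV])
      ultimately show "\<forall>\<^sub>F z in at (cis \<theta>0) within ball 0 1. dist (F z - f z) 0 < e"
        by eventually_elim (use r(2) in simp)
    qed
    ultimately have "((\<lambda>z. F z - (F z - f z)) \<longlongrightarrow> p - 0) (at (cis \<theta>0) within ball 0 1)" by (rule tendsto_diff)
    then have "(f \<longlongrightarrow> p) (at (cis \<theta>0) within ball 0 1)" by simp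
    then show ?thesis by (rule boundary_function_continuous_atI[OF \<zeta>])
  next
    fix C :: real assume C: "0 < C" "\<And>\<kappa>. 0 < \<kappa> \<Longrightarrow> \<exists>\<delta>>0. \<forall>z. norm z < 1 \<longrightarrow> norm (cis \<theta>0 - z) < \<delta> \<longrightarrow>
      \<kappa> * norm (cis \<theta>0 - z) \<le> 1 - norm z \<longrightarrow> C \<le> norm (cis \<theta>0 - z) * norm (deriv H z)"
    have bdd: "bounded (F ` ball 0 1)" using shadow(2) assms(4) by simp
    obtain m where "0 < m" "m < 1 / pi" "arc_length_integral (Gamma_params m \<theta>0) (Gamma_curve m \<theta>0)
      (\<lambda>z. (1 - (norm (\<phi> z))\<^sup>2) / (1 - (norm z)\<^sup>2)) < \<infinity>"
      using exists_Gamma_curve_finite_integral[OF hol dil shadow(1)[unfolded F_def] bdd[unfolded F_def] \<phi> C] by blast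
    with assms(23) show ?thesis by simp
  qed
qed

end
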